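(* Let $1<p\le 2$ and let $f\in L^1$ be a first-order Haar chaos, $f=\sum_{k\ge0}c_kh_{2^k}$. Suppose the symbol $\hat f(z)=\sum_k c_kz^k$ is analytic and has no zeros in the disk $\mathbb D_{2^{-1/p}}$, but it is not the case that both $\hat f$ and $1/\hat f$ are bounded analytic functions on $\mathbb D_{2^{-1/2}}$. Then for every $1<q<p$ the system of dilations and translations $\{f_n\}_{n\ge1}$ of $f$ is a Schauder basis of $L^q_0$ (in the natural order $n=1,2,\dots$) which is not equivalent to the Haar system.
   Context: All functions are complex-valued on $I=(0,1]$; $L^q_0$ is the closed subspace of mean-zero functions in $L^q(0,1)$; $\mathbb D_R=\{z\in\mathbb C:|z|<R\}$. Let $h=\chi_{(0,1/2]}-\chi_{(1/2,1]}$. For $n=2^k+j$ with $k\ge0$, $0\le j\le 2^k-1$, $h_n(t)=h(2^kt-j)$ for $t\in(j2^{-k},(j+1)2^{-k}]$ and $0$ otherwise. For mean-zero $f\in L^1$, the system of dilations and translations is $f_n(t)=f(2^kt-j)$ on $(j2^{-k},(j+1)2^{-k}]$, $0$ otherwise. A first-order Haar chaos is a function $f=\sum_{k\ge0}c_kh_{2^k}$, $c_k\in\mathbb C$; its symbol is $\hat f(z)=\sum_k c_kz^k$. A basis $\{f_n\}$ of $L^q_0$ is equivalent to $\{h_n\}$ if there is a linear isomorphism of $L^q_0$ onto itself mapping $h_n$ to $f_n$ for all $n$. *)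

theory Defs
  imports "HOL-Analysis.Analysis"
begin

definition I01 :: "real set" where "I01 = {0<..1}"

abbreviation MI :: "real measure" where "MI \<equiv> lebesgue_on I01"

definition Lq :: "real \<Rightarrow> (real \<Rightarrow> complex) \<Rightarrow> bool" where
  "Lq q g \<longleftrightarrow> g \<in> borel_measurable MI \<and> integrable MI (\<lambda>t. norm (g t) powr q)"

definition Lq0 :: "real \<Rightarrow> (real \<Rightarrow> complex) \<Rightarrow> bool" where
  "Lq0 q g \<longleftrightarrow> Lq q g \<and> integral\<^sup>L MI g = 0"

definition Lq_norm :: "real \<Rightarrow> (real \<Rightarrow> complex) \<Rightarrow> real" where
  "Lq_norm q g = (integral\<^sup>L MI (\<lambda>t. norm (g t) powr q)) powr (1 / q)"

definition haar :: "real \<Rightarrow> complex" where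
  "haar t = (if 0 < t \<and> t \<le> 1/2 then 1 else if 1/2 < t \<and> t \<le> 1 then -1 else 0)"

definition dlog :: "nat \<Rightarrow> nat" where
  "dlog n = (LEAST k. n < 2 ^ Suc k)"

definition dil :: "(real \<Rightarrow> complex) \<Rightarrow> nat \<Rightarrow> real \<Rightarrow> complex" where
  "dil f n t = (let k = dlog n; j = n - 2 ^ k in
     (if real j / 2 ^ k < t \<and> t \<le> (real j + 1) / 2 ^ k then f (2 ^ k * t - real j) else 0))"

definition haar_sys :: "nat \<Rightarrow> real \<Rightarrow> complex" where
  "haar_sys n = dil haar n"

text \<open>First-order Haar chaos sum_k c_k h_{2^k} (pointwise the sum is finite for each t in (0,1]).\<close>
definition haar_chaos :: "(nat \<Rightarrow> complex) \<Rightarrow> real \<Rightarrow> complex" where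
  "haar_chaos c t = (\<Sum>k. c k * haar_sys (2 ^ k) t)"

definition symbol :: "(nat \<Rightarrow> complex) \<Rightarrow> complex \<Rightarrow> complex" where
  "symbol c z = (\<Sum>k. c k * z ^ k)"

definition schauder_basis_Lq0 :: "real \<Rightarrow> (nat \<Rightarrow> real \<Rightarrow> complex) \<Rightarrow> bool" where
  "schauder_basis_Lq0 q F \<longleftrightarrow>
     (\<forall>n\<ge>1. Lq0 q (F n)) \<and>
     (\<forall>g. Lq0 q g \<longrightarrow> (\<exists>!a :: nat \<Rightarrow> complex.
        (\<lambda>N. Lq_norm q (\<lambda>t. g t - (\<Sum>m<N. a m * F (Suc m) t))) \<longlonglongrightarrow> 0))"

text \<open>Equivalence to the Haar system: a linear isomorphism T of L^q_0 onto itself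
  (functions modulo a.e. equality; bounded with bounded inverse) with T h_n = f_n.\<close>
definition equiv_haar_Lq0 :: "real \<Rightarrow> (nat \<Rightarrow> real \<Rightarrow> complex) \<Rightarrow> bool" where
  "equiv_haar_Lq0 q F \<longleftrightarrow>
    (\<exists>T :: (real \<Rightarrow> complex) \<Rightarrow> (real \<Rightarrow> complex).
       (\<forall>g. Lq0 q g \<longrightarrow> Lq0 q (T g)) \<and>
       (\<forall>g u a b. Lq0 q g \<longrightarrow> Lq0 q u \<longrightarrow>
          (AE t in MI. T (\<lambda>s. a * g s + b * u s) t = a * T g t + b * T u t)) \<and>
       (\<exists>C. \<forall>g. Lq0 q g \<longrightarrow> Lq_norm q (T g) \<le> C * Lq_norm q g) \<and>
       (\<exists>C. \<forall>g. Lq0 q g \<longrightarrow> Lq_norm q g \<le> C * Lq_norm q (T g)) \<and>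
       (\<forall>u. Lq0 q u \<longrightarrow> (\<exists>g. Lq0 q g \<and> (AE t in MI. T g t = u t))) \<and>
       (\<forall>n\<ge>1. AE t in MI. T (haar_sys n) t = F n t))"

end

theory Submission
  imports Defs "HOL-Complex_Analysis.Cauchy_Integral_Formula"
begin

text \<open>
  Let \<open>V h_n = h_(2n)\<close>; this scales the \<open>L^q\<close> norm of a single level of the Haar system by \<open>2^(-1/q)\<close>, and
  \<open>f_n = \<Sum>m. c_m V^m h_n\<close>. If \<open>d\<close> are the Taylor coefficients of the reciprocal of the symbol, both
  \<open>\<Sum>m. |c_m| 2^(-m/q)\<close> and \<open>\<Sum>m. |d_m| 2^(-m/q)\<close> converge because \<open>2^(-1/q) < 2^(-1/p)\<close>, so the
  coefficients of \<open>g\<close> must be those of \<open>\<Sum>m. d_m V^m g\<close>. A partial sum of the resulting series differs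
  from the Haar partial sum only by boundary terms, whose norm is dominated by a convolution of an
  absolutely summable sequence with the null sequence of the level norms of \<open>g\<close>.

  For the second claim, take many copies of a finite chaos \<open>\<Sum>k. x_k h_(2^k)\<close> on well separated dyadic
  levels. By a subgaussian estimate every \<open>L^s\<close> norm of the sum of \<open>M\<close> copies is at most of the order
  \<open>sqrt M\<close> times the norm of \<open>x\<close> in the weighted space with norm \<open>sqrt (\<Sum>k. |x_k|^2 / 2^k)\<close>. Hence, by
  duality between \<open>L^q\<close> and its dual, an isomorphism mapping \<open>h_n\<close> to \<open>f_n\<close> makes convolution with \<open>c\<close>
  and with \<open>d\<close> bounded on this space, which is a Hardy space on the disk of radius \<open>2^(-1/2)\<close>. Multipliers
  of a Hardy space are bounded analytic functions, so the symbol and its reciprocal are bounded there.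
\<close>

subsection \<open>The spaces \<open>L^q\<close> on the unit interval\<close>

text \<open>The obstacle is the operator \<open>V\<close>. On a single level it scales norms by
  \<open>2^(-1/q)\<close>, but on the many-level sums of the second part it acts like a factor
  \<open>2^(-1/2)\<close>, which is larger since \<open>q < 2\<close>. Hence the series of
  \<open>c_m V^m\<close> and \<open>d_m V^m\<close> need not define bounded operators on
  \<open>L^q\<close>, and the basis part never applies them to a function. The coefficients are
  finite sums along the chains \<open>b, 2b, 4b, ...\<close> with \<open>b\<close> odd, where
  inversion is an identity of formal power series, and only their level norms are estimated. These
  tend to zero, and that suffices because the boundary terms of \<open>V^m\<close> at
  \<open>N\<close> occupy at most \<open>m + 1\<close> levels ending at that of \<open>N\<close>.
  The count \<open>m + 1\<close> is the origin of the weight \<open>Suc m\<close> on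
  \<open>c\<close>; the gap between \<open>2^(-1/q)\<close> and \<open>2^(-1/p)\<close> absorbs it.

  In the second part upper moment bounds suffice, since duality takes the place of lower ones. The
  pairing of two sums of \<open>M\<close> copies is \<open>M/2\<close> times a bilinear form, so the
  two factors \<open>sqrt M\<close> cancel and \<open>M\<close> may be chosen after the test
  sequences.\<close>

lemma I01_sets [measurable]: "I01 \<in> sets lebesgue"
  by (simp add: I01_def)

lemma space_MI [simp]: "space MI = I01"
  by (simp add: space_restrict_space)

lemma emeasure_MI: "emeasure MI I01 = 1"
  by (simp add: emeasure_restrict_space I01_def)

lemma finite_measure_MI: "finite_measure MI"
  by (rule finite_measureI) (simp add: emeasure_MI)

interpretation MI: finite_measure MI
  by (rule finite_measure_MI)

lemma measure_MI [simp]: "measure MI I01 = 1"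
  by (simp add: measure_def emeasure_MI)

lemma Lq_norm_nonneg [simp]: "0 \<le> Lq_norm q f"
  by (simp add: Lq_norm_def)

lemma Lq_norm_powr: "q > 0 \<Longrightarrow> Lq_norm q f powr q = integral\<^sup>L MI (\<lambda>t. norm (f t) powr q)"
  by (simp add: Lq_norm_def powr_powr)

lemma Lq_norm_le_iff:
  assumes "q > 0" "A \<ge> 0"
  shows "Lq_norm q f \<le> A \<longleftrightarrow> integral\<^sup>L MI (\<lambda>t. norm (f t) powr q) \<le> A powr q"
  using assms Lq_norm_powr[of q f]
  by (metis Lq_norm_nonneg powr_less_mono2 powr_mono2 not_le order_less_imp_le)

text \<open>Convexity of \<open>x powr q\<close> at \<open>a/A\<close> and \<open>b/B\<close> with
  weights \<open>A/(A+B)\<close> and \<open>B/(A+B)\<close>: the pointwise form of Minkowski's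
  inequality after normalisation. Convexity is invoked only at positive points; when
  \<open>a\<close> or \<open>b\<close> vanishes, \<open>x powr q \<le> x\<close> on
  \<open>[0,1]\<close> is enough.\<close>

lemma powr_add_le:
  assumes "q \<ge> 1" "a \<ge> 0" "b \<ge> 0" "A > 0" "B > 0"
  shows "((a + b) / (A + B)) powr q \<le> A / (A + B) * (a / A) powr q + B / (A + B) * (b / B) powr (q::real)"
proof (cases "a = 0 \<or> b = 0")
  case False
  then have pos: "a > 0" "b > 0" using assms by auto
  have e: "A / (A+B) = 1 - B/(A+B)" using assms by (simp add: field_simps)
  have "((1 - B/(A+B)) *\<^sub>R (a/A) + (B/(A+B)) *\<^sub>R (b/B)) powr q
     \<le> (1 - B/(A+B)) * (a/A) powr q + (B/(A+B)) * (b/B) powr q"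
    using powr_convex[OF assms(1)] by (rule convex_onD) (use pos assms in auto)
  moreover have "(1 - B/(A+B)) *\<^sub>R (a/A) + (B/(A+B)) *\<^sub>R (b/B) = (a+b)/(A+B)"
    unfolding e[symmetric] using assms by (simp add: add_divide_distrib)
  ultimately show ?thesis unfolding e by simp
next
  case True
  have *: "(x / (A' + B')) powr q \<le> A' / (A' + B') * (x / A') powr q" 
    if "x \<ge> 0" "A' > 0" "B' > 0" for x A' B' :: real
  proof -
    have "x / (A' + B') = (A' / (A' + B')) * (x / A')" using that by simp
    then have "(x / (A' + B')) powr q = (A' / (A' + B')) powr q * (x / A') powr q"
      unfolding powr_mult[symmetric] by simp
    also have "(A' / (A' + B')) powr q \<le> (A' / (A' + B')) powr 1"
      by (rule powr_mono') (use that assms in auto)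
    finally show ?thesis using that by (simp add: mult_right_mono)
  qed
  show ?thesis using True *[of b B A] *[of a A B] assms by (auto simp: add.commute)
qed

lemma norm_add_powr_le:
  fixes x y :: complex assumes "q \<ge> 1"
  shows "norm (x + y) powr q \<le> 2 powr q * (norm x powr q + norm y powr q)"
proof -
  have "norm (x + y) powr q \<le> (2 * max (norm x) (norm y)) powr q"
    by (rule powr_mono2) (use assms norm_triangle_ineq[of x y] in auto)
  also have "\<dots> = 2 powr q * (max (norm x) (norm y)) powr q" by (simp add: powr_mult)
  also have "(max (norm x) (norm y)) powr q \<le> norm x powr q + norm y powr q"
    by (simp add: max_def)
  finally show ?thesis by simp
qed

lemma Lq_add:
  assumes "q \<ge> 1" "Lq q f" "Lq q g" shows "Lq q (\<lambda>t. f t + g t)"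
proof -
  have [measurable]: "f \<in> borel_measurable MI" "g \<in> borel_measurable MI" using assms by (auto simp: Lq_def)
  have "integrable MI (\<lambda>t. norm (f t + g t) powr q)"
  proof (rule Bochner_Integration.integrable_bound)
    show "integrable MI (\<lambda>t. 2 powr q * (norm (f t) powr q + norm (g t) powr q))"
      using assms by (auto simp: Lq_def)
  qed (auto simp: norm_add_powr_le assms)
  then show ?thesis by (auto simp: Lq_def)
qed

lemma Lq_cmult: "Lq q f \<Longrightarrow> Lq q (\<lambda>t. c * f t)"
  by (auto simp: Lq_def norm_mult powr_mult)

lemma Lq_norm_cmult: "q > 0 \<Longrightarrow> Lq_norm q (\<lambda>t. c * f t) = norm c * Lq_norm q f"
  by (simp add: Lq_norm_def norm_mult powr_mult powr_powr)

lemma Lq_minus: "Lq q f \<Longrightarrow> Lq q (\<lambda>t. - f t)"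
  by (auto simp: Lq_def)

lemma Lq_diff:
  assumes "q \<ge> 1" "Lq q f" "Lq q g" shows "Lq q (\<lambda>t. f t - g t)"
  using Lq_add[OF assms(1,2) Lq_minus[OF assms(3)]] by simp

lemma Lq_zero [simp]: "Lq q (\<lambda>t. 0)"
  by (auto simp: Lq_def)

lemma Lq_norm_zero [simp]: "Lq_norm q (\<lambda>t. 0) = 0"
  by (simp add: Lq_norm_def)

lemma Lq_sum:
  assumes "q \<ge> 1" "\<And>i. i \<in> A \<Longrightarrow> Lq q (f i)" shows "Lq q (\<lambda>t. \<Sum>i\<in>A. f i t)"
  using assms(2) by (induction A rule: infinite_finite_induct) (auto intro: Lq_add assms(1))

lemma Lq_norm_minus: "Lq_norm q (\<lambda>t. - f t) = Lq_norm q f"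
  by (simp add: Lq_norm_def)

lemma Lq_norm_cong_AE:
  assumes "f \<in> borel_measurable MI" "g \<in> borel_measurable MI" "AE t in MI. f t = g t"
  shows "Lq_norm q f = Lq_norm q g"
proof -
  note [measurable] = assms(1,2)
  have "integral\<^sup>L MI (\<lambda>t. norm (f t) powr q) = integral\<^sup>L MI (\<lambda>t. norm (g t) powr q)"
    by (rule integral_cong_AE) (use assms(3) in auto)
  then show ?thesis by (simp add: Lq_norm_def)
qed

lemma Lq_norm_cong:
  assumes "\<And>t. t \<in> I01 \<Longrightarrow> f t = g t"
  shows "Lq_norm q f = Lq_norm q g"
proof -
  have "integral\<^sup>L MI (\<lambda>t. norm (f t) powr q) = integral\<^sup>L MI (\<lambda>t. norm (g t) powr q)"
    by (rule Bochner_Integration.integral_cong) (use assms in auto)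
  then show ?thesis by (simp add: Lq_norm_def)
qed

lemma Lq_norm_mono:
  assumes "q > 0" "Lq q g" "\<And>t. t \<in> I01 \<Longrightarrow> norm (f t) \<le> norm (g t)"
  shows "Lq_norm q f \<le> Lq_norm q g"
proof -
  have "integral\<^sup>L MI (\<lambda>t. norm (f t) powr q) \<le> integral\<^sup>L MI (\<lambda>t. norm (g t) powr q)"
    by (rule integral_mono') (use assms in \<open>auto simp: Lq_def intro!: powr_mono2\<close>)
  then show ?thesis using assms by (simp add: Lq_norm_def powr_mono2)
qed

lemma Lq_bounded:
  assumes "q > 0" "f \<in> borel_measurable MI" "\<And>t. t \<in> I01 \<Longrightarrow> norm (f t) \<le> B"
  shows "Lq q f"
proof -
  note [measurable] = assms(2)
  have "integrable MI (\<lambda>t. norm (f t) powr q)"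
    by (rule MI.integrable_const_bound[where B="B powr q"]) (use assms in \<open>auto intro!: powr_mono2\<close>)
  then show ?thesis using assms by (auto simp: Lq_def)
qed

lemma Lq_norm_triangle:
  assumes "q \<ge> 1" "Lq q f" "Lq q g"
  shows "Lq_norm q (\<lambda>t. f t + g t) \<le> Lq_norm q f + Lq_norm q g"
proof -
  \<comment> \<open>Strict upper bounds \<open>A\<close> and \<open>B\<close> of the norms are
    positive, so dividing by them is safe even if a norm vanishes. They are lowered to the norms at
    the end.\<close>
  have *: "Lq_norm q (\<lambda>t. f t + g t) \<le> A + B" if AB: "A > Lq_norm q f" "B > Lq_norm q g" for A B
  proof -
    have pos: "A > 0" "B > 0" using AB Lq_norm_nonneg[of q f] Lq_norm_nonneg[of q g] by linarith+
    let ?F = "\<lambda>t. norm (f t) powr q" and ?G = "\<lambda>t. norm (g t) powr q"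
    have int: "integrable MI ?F" "integrable MI ?G" using assms by (auto simp: Lq_def)
    have FA: "integral\<^sup>L MI ?F \<le> A powr q" "integral\<^sup>L MI ?G \<le> B powr q"
      using AB pos assms(1) Lq_norm_le_iff[of q A f] Lq_norm_le_iff[of q B g] by auto
    have pt: "norm (f t + g t) powr q \<le> (A+B) powr q *
        (A/(A+B) * (?F t / A powr q) + B/(A+B) * (?G t / B powr q))" for t
    proof -
      have "norm (f t + g t) powr q \<le> (norm (f t) + norm (g t)) powr q"
        by (rule powr_mono2) (use assms norm_triangle_ineq in auto)
      also have "\<dots> = (A+B) powr q * ((norm (f t) + norm (g t)) / (A+B)) powr q"
        using pos by (simp add: powr_divide)
      also have "\<dots> \<le> (A+B) powr q *
        (A/(A+B) * (norm (f t) / A) powr q + B/(A+B) * (norm (g t) / B) powr q)"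
        by (intro mult_left_mono powr_add_le) (use assms pos in auto)
      finally show ?thesis using pos by (simp add: powr_divide)
    qed
    have "integral\<^sup>L MI (\<lambda>t. norm (f t + g t) powr q) \<le> integral\<^sup>L MI (\<lambda>t. (A+B) powr q *
        (A/(A+B) * (?F t / A powr q) + B/(A+B) * (?G t / B powr q)))"
      by (rule integral_mono') (use int pt pos in auto)
    also have "\<dots> = (A+B) powr q * (A/(A+B) * (integral\<^sup>L MI ?F / A powr q) + B/(A+B) * (integral\<^sup>L MI ?G / B powr q))"
      using int by simp
    also have "\<dots> \<le> (A+B) powr q * (A/(A+B) * 1 + B/(A+B) * 1)"
      by (intro mult_left_mono add_mono) (use pos FA in auto)
    also have "\<dots> = (A+B) powr q" using pos by (simp flip: add_divide_distrib)
    finally show ?thesis using Lq_norm_le_iff[of q "A+B"] assms pos by simp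
  qed
  show ?thesis
  proof (rule field_le_epsilon)
    fix e :: real assume "e > 0"
    then show "Lq_norm q (\<lambda>t. f t + g t) \<le> Lq_norm q f + Lq_norm q g + e"
      using *[of "Lq_norm q f + e/2" "Lq_norm q g + e/2"] by simp
  qed
qed

lemma Lq_norm_triangle_diff:
  assumes "q \<ge> 1" "Lq q f" "Lq q g"
  shows "Lq_norm q (\<lambda>t. f t - g t) \<le> Lq_norm q f + Lq_norm q g"
  using Lq_norm_triangle[OF assms(1,2) Lq_minus[OF assms(3)]] by (simp add: Lq_norm_minus)

lemma Lq_norm_le_add_diff:
  assumes "q \<ge> 1" "Lq q f" "Lq q g"
  shows "Lq_norm q f \<le> Lq_norm q g + Lq_norm q (\<lambda>t. f t - g t)"
  using Lq_norm_triangle[OF assms(1,3) Lq_diff[OF assms]] by simp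

lemma Lq_norm_sum:
  assumes "q \<ge> 1" "\<And>i. i \<in> A \<Longrightarrow> Lq q (f i)"
  shows "Lq_norm q (\<lambda>t. \<Sum>i\<in>A. f i t) \<le> (\<Sum>i\<in>A. Lq_norm q (f i))"
  using assms(2)
proof (induction A rule: infinite_finite_induct)
  case (insert x F)
  have "Lq_norm q (\<lambda>t. f x t + (\<Sum>i\<in>F. f i t)) \<le> Lq_norm q (f x) + Lq_norm q (\<lambda>t. \<Sum>i\<in>F. f i t)"
    by (intro Lq_norm_triangle assms Lq_sum insert) auto
  with insert show ?case by simp
qed auto

text \<open>Young's inequality for the factors divided by strict upper bounds of their norms, which
  then decrease to the norms. The choice \<open>A = B = 1\<close> already gives
  integrability.\<close>

lemma Holder_inequality:
  assumes "p > 0" "q > 0" "1/p + 1/q = 1" "Lq p f" "Lq q g"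
  shows "integrable MI (\<lambda>t. f t * g t)"
    and "integral\<^sup>L MI (\<lambda>t. norm (f t * g t)) \<le> Lq_norm p f * Lq_norm q g"
proof -
  have [measurable]: "f \<in> borel_measurable MI" "g \<in> borel_measurable MI" using assms by (auto simp: Lq_def)
  have "1/p > 0" "1/q > 0" using assms(1,2) by simp_all
  then have "1/p < 1" "1/q < 1" using assms(3) by linarith+
  then have p1: "p > 1" "q > 1" using assms(1,2) by (simp_all add: divide_less_eq_1)
  let ?F = "\<lambda>t. norm (f t) powr p" and ?G = "\<lambda>t. norm (g t) powr q"
  have int: "integrable MI ?F" "integrable MI ?G" using assms by (auto simp: Lq_def)
  have Y: "norm (f t * g t) \<le> A * B * (?F t / A powr p / p + ?G t / B powr q / q)" if "A > 0" "B > 0" for A B t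
  proof -
    have "(norm (f t)/A) * (norm (g t)/B) \<le> (norm (f t)/A) powr p / p + (norm (g t)/B) powr q / q"
      by (rule Youngs_inequality) (use p1 assms that in auto)
    then have "A * B * ((norm (f t)/A) * (norm (g t)/B)) \<le> A * B * ((norm (f t)/A) powr p / p + (norm (g t)/B) powr q / q)"
      by (rule mult_left_mono) (use that in auto)
    then show ?thesis using that by (simp add: norm_mult powr_divide)
  qed
  have "integrable MI (\<lambda>t. norm (f t * g t))"
    by (rule Bochner_Integration.integrable_bound[where f="\<lambda>t. 1 * 1 * (?F t / 1 powr p / p + ?G t / 1 powr q / q)"])
      (use int Y[of 1 1] in \<open>auto intro!: AE_I2 order.trans[OF _ abs_ge_self]\<close>)
  then show i: "integrable MI (\<lambda>t. f t * g t)"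
    by (subst (asm) integrable_norm_iff) auto
  have *: "integral\<^sup>L MI (\<lambda>t. norm (f t * g t)) \<le> A * B" if AB: "A > Lq_norm p f" "B > Lq_norm q g" for A B
  proof -
    have pos: "A > 0" "B > 0" using AB Lq_norm_nonneg[of p f] Lq_norm_nonneg[of q g] by linarith+
    have FA: "integral\<^sup>L MI ?F \<le> A powr p" "integral\<^sup>L MI ?G \<le> B powr q"
      using AB pos p1 Lq_norm_le_iff[of p A f] Lq_norm_le_iff[of q B g] by auto
    have "integral\<^sup>L MI (\<lambda>t. norm (f t * g t)) \<le> integral\<^sup>L MI (\<lambda>t. A * B * (?F t / A powr p / p + ?G t / B powr q / q))"
      by (rule integral_mono') (use int Y[OF pos] pos p1 in auto)
    also have "\<dots> = A * B * (integral\<^sup>L MI ?F / A powr p / p + integral\<^sup>L MI ?G / B powr q / q)"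
      using int by simp
    also have "\<dots> \<le> A * B * (1 / p + 1 / q)"
      by (intro mult_left_mono add_mono divide_right_mono) (use pos FA p1 in auto)
    finally show ?thesis using assms by simp
  qed
  have "((\<lambda>e. (Lq_norm p f + e) * (Lq_norm q g + e)) \<longlongrightarrow> (Lq_norm p f + 0) * (Lq_norm q g + 0)) (at_right 0)"
    by (intro tendsto_intros)
  then have "integral\<^sup>L MI (\<lambda>t. norm (f t * g t)) \<le> (Lq_norm p f + 0) * (Lq_norm q g + 0)"
    by (rule tendsto_lowerbound) (auto simp: eventually_at_right_less intro!: eventually_mono[OF eventually_at_right_less[of 0]] *)
  then show "integral\<^sup>L MI (\<lambda>t. norm (f t * g t)) \<le> Lq_norm p f * Lq_norm q g" by simp
qed

lemma Lq_integrable: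
  assumes "q > 1" "Lq q f"
  shows "integrable MI f" and "norm (integral\<^sup>L MI f) \<le> Lq_norm q f"
proof -
  define q' where "q' = q / (q - 1)"
  have q': "q' > 0" "1/q + 1/q' = 1" using assms by (auto simp: q'_def field_simps)
  have 1: "Lq q' (\<lambda>t. 1)" using q' by (auto intro: Lq_bounded)
  note H = Holder_inequality[OF _ q' assms(2) 1]
  show i: "integrable MI f" using H assms by simp
  have "norm (integral\<^sup>L MI f) \<le> integral\<^sup>L MI (\<lambda>t. norm (f t))" by (rule integral_norm_bound)
  also have "\<dots> \<le> Lq_norm q f" using H(2) assms by (simp add: Lq_norm_def)
  finally show "norm (integral\<^sup>L MI f) \<le> Lq_norm q f" .
qed

text \<open>Fatou's lemma. It reduces estimates of infinite sums to estimates of their finite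
  sections together with pointwise convergence.\<close>

lemma Lq_limit:
  assumes q: "q > 0" and F: "\<And>n. Lq q (F n)" and lim: "\<And>t. t \<in> I01 \<Longrightarrow> (\<lambda>n. F n t) \<longlonglongrightarrow> f t"
    and B: "\<And>n. Lq_norm q (F n) \<le> B"
  shows "Lq q f" and "Lq_norm q f \<le> B"
proof -
  have [measurable]: "F n \<in> borel_measurable MI" for n using F by (auto simp: Lq_def)
  have [measurable]: "f \<in> borel_measurable MI"
    by (rule borel_measurable_LIMSEQ_metric[where f=F]) (use lim in auto)
  have B0: "B \<ge> 0" using B[of 0] Lq_norm_nonneg order_trans by blast
  have *: "(\<integral>\<^sup>+t. ennreal (norm (F n t) powr q) \<partial>MI) \<le> ennreal (B powr q)" for n
    using F[of n] B[of n] Lq_norm_le_iff[OF q B0]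
    by (subst nn_integral_eq_integral) (auto simp: Lq_def)
  have "(\<integral>\<^sup>+t. ennreal (norm (f t) powr q) \<partial>MI) = (\<integral>\<^sup>+t. liminf (\<lambda>n. ennreal (norm (F n t) powr q)) \<partial>MI)"
  proof (rule nn_integral_cong)
    fix t assume t: "t \<in> space MI"
    have "(\<lambda>n. ennreal (norm (F n t) powr q)) \<longlonglongrightarrow> ennreal (norm (f t) powr q)"
      by (intro tendsto_ennrealI tendsto_powr2 tendsto_norm lim tendsto_const) (use t q in auto)
    then show "ennreal (norm (f t) powr q) = liminf (\<lambda>n. ennreal (norm (F n t) powr q))"
      by (intro lim_imp_Liminf[symmetric]) auto
  qed
  also have "\<dots> \<le> liminf (\<lambda>n. (\<integral>\<^sup>+t. ennreal (norm (F n t) powr q) \<partial>MI))"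
    by (rule nn_integral_liminf) auto
  also have "\<dots> \<le> liminf (\<lambda>n::nat. ennreal (B powr q))"
    by (rule Liminf_mono) (use * in auto)
  finally have le: "(\<integral>\<^sup>+t. ennreal (norm (f t) powr q) \<partial>MI) \<le> ennreal (B powr q)"
    by (simp add: Liminf_const)
  then have i: "integrable MI (\<lambda>t. norm (f t) powr q)"
    by (intro integrableI_bounded) (auto simp: le_less_trans)
  then show "Lq q f" by (auto simp: Lq_def)
  from le i have "integral\<^sup>L MI (\<lambda>t. norm (f t) powr q) \<le> B powr q"
    by (subst (asm) nn_integral_eq_integral) auto
  then show "Lq_norm q f \<le> B" using Lq_norm_le_iff[OF q B0] by simp
qed

subsection \<open>Dyadic intervals and Haar functions\<close>

lemma dlog_eqI: "2 ^ k \<le> n \<Longrightarrow> n < 2 ^ Suc k \<Longrightarrow> dlog n = k"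
  unfolding dlog_def
proof (rule Least_equality)
  fix l assume a: "2 ^ k \<le> n" "n < 2 ^ Suc l"
  then have "(2::nat) ^ k < 2 ^ Suc l" by simp
  then show "k \<le> l" by (simp only: power_strict_increasing_iff) 
qed

lemma dlog_bounds:
  assumes "n \<ge> 1" shows "2 ^ dlog n \<le> n" and "n < 2 ^ Suc (dlog n)"
proof -
  obtain k where k: "2 ^ k \<le> n" "n < 2 ^ (k + 1)"
    using ex_power_ivl1[of 2 n] assms by auto
  then have "dlog n = k" by (intro dlog_eqI) auto
  then show "2 ^ dlog n \<le> n" "n < 2 ^ Suc (dlog n)" using k by auto
qed

lemma dlog_eq_iff: "n \<ge> 1 \<Longrightarrow> dlog n = k \<longleftrightarrow> n \<in> {2 ^ k ..< 2 * 2 ^ k}"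
  using dlog_bounds[of n] dlog_eqI[of k n] by auto

lemma dlog_mult_pow2: "n \<ge> 1 \<Longrightarrow> dlog (2 ^ k * n) = k + dlog n"
  using dlog_bounds[of n] by (intro dlog_eqI) (auto simp: power_add)

lemma dlog_double [simp]: "n \<ge> 1 \<Longrightarrow> dlog (2 * n) = Suc (dlog n)"
  using dlog_mult_pow2[of n 1] by simp

lemma dlog_double_Suc [simp]: "n \<ge> 1 \<Longrightarrow> dlog (Suc (2 * n)) = Suc (dlog n)"
  using dlog_bounds[of n] by (intro dlog_eqI) auto

lemma dlog_mono:
  assumes "1 \<le> m" "m \<le> n" shows "dlog m \<le> dlog n"
proof -
  have "(2::nat) ^ dlog m < 2 ^ Suc (dlog n)"
    using dlog_bounds[of m] dlog_bounds[of n] assms by linarith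
  then show ?thesis by (simp only: power_strict_increasing_iff)
qed

text \<open>The support of \<open>h_n\<close>. Since \<open>n = 2^k + j\<close>, the interval \<open>(j/2^k, (j+1)/2^k]\<close> is
  \<open>(n/2^k - 1, (n+1)/2^k - 1]\<close>, and its halves have the indices \<open>2n\<close> and \<open>2n+1\<close>.\<close>

definition dyad :: "nat \<Rightarrow> real set" where
  "dyad n = {real n / 2 ^ dlog n - 1 <.. (real n + 1) / 2 ^ dlog n - 1}"

lemma dyad_sets [measurable]: "dyad n \<in> sets lebesgue"
  by (simp add: dyad_def)

lemma dyad_subset:
  assumes "n \<ge> 1" shows "dyad n \<subseteq> I01"
proof -
  have "real (2 ^ dlog n) \<le> real n" "real (n + 1) \<le> real (2 ^ Suc (dlog n))"
    using dlog_bounds[OF assms] by (simp_all only: of_nat_le_iff)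
  then have "1 \<le> real n / 2 ^ dlog n" "(real n + 1) / 2 ^ dlog n \<le> 2"
    by (simp_all add: divide_simps)
  then show ?thesis by (auto simp: dyad_def I01_def simp del: le_divide_eq_1_pos)
qed

lemma dyad_1: "dyad (Suc 0) = I01"
proof -
  have "dlog (Suc 0) = 0" by (rule dlog_eqI) auto
  then show ?thesis by (auto simp: dyad_def I01_def)
qed

lemma dyad_split: "n \<ge> 1 \<Longrightarrow> dyad n = dyad (2 * n) \<union> dyad (Suc (2 * n))"
  using dlog_double[of n] dlog_double_Suc[of n] unfolding dyad_def
  by (simp add: set_eq_iff divide_simps) (auto simp: field_simps)

lemma dyad_split_disjoint: "n \<ge> 1 \<Longrightarrow> dyad (2 * n) \<inter> dyad (Suc (2 * n)) = {}"
  using dlog_double[of n] dlog_double_Suc[of n] unfolding dyad_def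
  by (simp add: set_eq_iff divide_simps)

text \<open>Passing from \<open>N\<close> to \<open>Suc N\<close> replaces the interval
  \<open>N\<close> by its halves \<open>2 * N\<close> and \<open>Suc (2 * N)\<close>. Admitting
  every \<open>N\<close>, not only powers of two, is what later covers partial sums in the natural
  order.\<close>

lemma dyad_partition:
  assumes "t \<in> I01" "N \<ge> 1"
  shows "\<exists>!n. n \<in> {N..<2*N} \<and> t \<in> dyad n"
  using assms(2)
proof (induction N rule: nat_induct_at_least)
  case base
  then show ?case using assms(1) dyad_1 by (intro ex1I[of _ 1]) auto
next
  case (Suc N)
  then obtain n where n: "n \<in> {N..<2*N}" "t \<in> dyad n" 
    and u: "\<And>m. m \<in> {N..<2*N} \<Longrightarrow> t \<in> dyad m \<Longrightarrow> m = n" by blast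
  have sp: "t \<in> dyad N \<longleftrightarrow> t \<in> dyad (2*N) \<or> t \<in> dyad (Suc (2*N))"
      "\<not> (t \<in> dyad (2*N) \<and> t \<in> dyad (Suc (2*N)))"
    using dyad_split[of N] dyad_split_disjoint[of N] Suc.hyps by auto
  have mem: "m \<in> {Suc N..<2 * Suc N} \<longleftrightarrow> (m \<in> {N..<2*N} \<and> m \<noteq> N) \<or> m = 2*N \<or> m = Suc (2*N)" for m
    using Suc.hyps by auto
  have N: "N \<in> {N..<2*N}" using Suc.hyps by auto
  show ?case
  proof (cases "n = N")
    case True
    with sp n(2) consider "t \<in> dyad (2*N)" "t \<notin> dyad (Suc (2*N))" | "t \<notin> dyad (2*N)" "t \<in> dyad (Suc (2*N))" by auto
    then show ?thesis
    proof cases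
      case 1 then show ?thesis using u True unfolding mem by (intro ex1I[of _ "2*N"]) auto
    next
      case 2 then show ?thesis using u True unfolding mem by (intro ex1I[of _ "Suc (2*N)"]) auto
    qed
  next
    case False
    then have "t \<notin> dyad N" using u[OF N] by auto
    with sp(1) have *: "t \<notin> dyad (2*N)" "t \<notin> dyad (Suc (2*N))" by simp_all
    show ?thesis
    proof (rule ex1I[of _ n])
      fix m assume m: "m \<in> {Suc N..<2 * Suc N} \<and> t \<in> dyad m"
      then have "m \<in> {N..<2*N}" using * unfolding mem by metis
      then show "m = n" using u m by blast
    qed (use n False mem in blast)
  qed
qed

lemma dyad_disjoint_range:
  assumes "N \<ge> 1" "m \<in> {N..<2*N}" "n \<in> {N..<2*N}" "t \<in> dyad m" "t \<in> dyad n"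
  shows "m = n"
proof -
  have "t \<in> I01" using dyad_subset[of m] assms by auto
  from dyad_partition[OF this assms(1)] show ?thesis using assms by auto
qed

lemma dyad_disjoint_level:
  assumes "m \<ge> 1" "n \<ge> 1" "dlog m = dlog n" "t \<in> dyad m" "t \<in> dyad n"
  shows "m = n"
  by (rule dyad_disjoint_range[of "2 ^ dlog n"]) (use assms dlog_bounds[of m] dlog_bounds[of n] in auto)

lemma dyad_half: "n \<ge> 2 \<Longrightarrow> dyad n \<subseteq> dyad (n div 2)"
  using dyad_split[of "n div 2"] by (cases "even n") (auto elim!: evenE oddE)

lemma dlog_half: "n \<ge> 2 \<Longrightarrow> dlog n = Suc (dlog (n div 2))"
  using dlog_double[of "n div 2"] dlog_double_Suc[of "n div 2"] 
  by (cases "even n") (auto elim!: evenE oddE)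

text \<open>Induction on \<open>n\<close> through the parent \<open>n div 2\<close>, down to the
  case of equal levels, where intervals coincide or are disjoint.\<close>

lemma dyad_nested:
  assumes "m \<ge> 1" "n \<ge> 1" "dlog m \<le> dlog n"
  shows "dyad n \<subseteq> dyad m \<or> dyad n \<inter> dyad m = {}"
  using assms(2,3)
proof (induction n rule: less_induct)
  case (less n)
  show ?case
  proof (cases "dlog m = dlog n")
    case True
    then show ?thesis using dyad_disjoint_level[of m n] less.prems assms(1) by blast
  next
    case False
    have n2: "n \<ge> 2"
    proof (rule ccontr)
      assume "\<not> n \<ge> 2"
      then have "n = 1" using less.prems by auto
      then have "dlog n = 0" by (auto intro: dlog_eqI)
      then show False using False less.prems by auto
    qed
    have "dyad (n div 2) \<subseteq> dyad m \<or> dyad (n div 2) \<inter> dyad m = {}"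
      using less.IH[of "n div 2"] n2 dlog_half[OF n2] False less.prems by auto
    then show ?thesis using dyad_half[OF n2] by blast
  qed
qed

section \<open>Integrals of Haar functions and step functions\<close>

lemma indicator_dyad_measurable [measurable]: "(indicator (dyad n) :: real \<Rightarrow> real) \<in> borel_measurable MI"
  by (intro measurable_restrict_space1 borel_measurable_indicator dyad_sets)

lemma integrable_dyad: "n \<ge> 1 \<Longrightarrow> integrable MI (\<lambda>t. indicator (dyad n) t :: real)"
  by (rule MI.integrable_const_bound[where B=1]) (auto intro!: AE_I2)

lemma measure_dyad: 
  assumes "n \<ge> 1" shows "measure MI (dyad n \<inter> I01) = 1 / 2 ^ dlog n"
proof -
  have "dyad n \<inter> I01 = dyad n" using dyad_subset[OF assms] by auto
  then have "measure MI (dyad n \<inter> I01) = measure lebesgue (dyad n)"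
    using dyad_subset[OF assms] by (simp add: measure_restrict_space)
  also have "\<dots> = 1 / 2 ^ dlog n"
    by (simp add: dyad_def divide_simps)
  finally show ?thesis .
qed

lemma integral_dyad: "n \<ge> 1 \<Longrightarrow> integral\<^sup>L MI (\<lambda>t. indicator (dyad n) t :: real) = 1 / 2 ^ dlog n"
  using measure_dyad by simp

definition haar_real :: "nat \<Rightarrow> real \<Rightarrow> real" where
  "haar_real n t = indicator (dyad (2 * n)) t - indicator (dyad (Suc (2 * n))) t"

lemma haar_real_measurable [measurable]: "haar_real n \<in> borel_measurable MI"
  unfolding haar_real_def by measurable

lemma haar_sys_eq:
  assumes "n \<ge> 1" shows "haar_sys n t = of_real (haar_real n t)"
proof -
  define k where "k = dlog n"
  have n: "real (n - 2 ^ k) = real n - 2 ^ k" 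
    using dlog_bounds[OF assms] by (simp add: of_nat_diff k_def)
  have k: "dlog (2 * n) = Suc k" "dlog (Suc (2 * n)) = Suc k" using assms by (auto simp: k_def)
  have mem: "t \<in> dyad (2 * n) \<longleftrightarrow> 0 < 2 ^ k * t - (real n - 2 ^ k) \<and> 2 ^ k * t - (real n - 2 ^ k) \<le> 1/2"
    "t \<in> dyad (Suc (2 * n)) \<longleftrightarrow> 1/2 < 2 ^ k * t - (real n - 2 ^ k) \<and> 2 ^ k * t - (real n - 2 ^ k) \<le> 1"
    unfolding dyad_def k by (auto simp: field_simps)
  have c: "(real n - 2 ^ k) / 2 ^ k < t \<and> t \<le> ((real n - 2 ^ k) + 1) / 2 ^ k \<longleftrightarrow>
      0 < 2 ^ k * t - (real n - 2 ^ k) \<and> 2 ^ k * t - (real n - 2 ^ k) \<le> 1"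
    by (auto simp: field_simps)
  show ?thesis
    unfolding haar_sys_def dil_def Let_def haar_def k_def[symmetric] n c haar_real_def indicator_def mem
    by auto
qed

lemma haar_real_abs:
  assumes "n \<ge> 1" shows "\<bar>haar_real n t\<bar> = indicator (dyad n) t"
  using dyad_split[OF assms] dyad_split_disjoint[OF assms] by (auto simp: haar_real_def indicator_def)

lemma haar_real_constant:
  assumes "m \<ge> 1" "n \<ge> 1" "dlog m < dlog n"
  shows "haar_real m constant_on dyad n"
proof -
  have "dyad n \<subseteq> dyad (2*m) \<or> dyad n \<inter> dyad (2*m) = {}"
    "dyad n \<subseteq> dyad (Suc (2*m)) \<or> dyad n \<inter> dyad (Suc (2*m)) = {}"
    using assms by (intro dyad_nested; simp)+
  then consider "dyad n \<subseteq> dyad (2*m)" | "dyad n \<subseteq> dyad (Suc (2*m))"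
    | "dyad n \<inter> dyad (2*m) = {}" "dyad n \<inter> dyad (Suc (2*m)) = {}" by blast
  then show ?thesis
  proof cases
    case 1
    then have "\<forall>t\<in>dyad n. haar_real m t = 1"
      using dyad_split_disjoint[OF assms(1)] by (auto simp: haar_real_def indicator_def)
    then show ?thesis by (auto simp: constant_on_def)
  next
    case 2
    then have "\<forall>t\<in>dyad n. haar_real m t = -1"
      using dyad_split_disjoint[OF assms(1)] by (auto simp: haar_real_def indicator_def)
    then show ?thesis by (auto simp: constant_on_def)
  next
    case 3
    then have "\<forall>t\<in>dyad n. haar_real m t = 0" by (auto simp: haar_real_def indicator_def)
    then show ?thesis by (auto simp: constant_on_def)
  qed
qed

text \<open>The two halves of \<open>dyad n\<close> have equal length. The weight
  \<open>\<phi>\<close> is carried for the moment estimates, where it is an exponential of the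
  earlier layers; \<open>\<phi> = 1\<close> gives the usual mean-zero property.\<close>

lemma integral_step_haar:
  fixes \<phi> :: "real \<Rightarrow> real"
  assumes "n \<ge> 1" "\<phi> constant_on dyad n"
  shows "integral\<^sup>L MI (\<lambda>t. \<phi> t * haar_real n t) = 0"
proof -
  obtain v where v: "\<And>t. t \<in> dyad n \<Longrightarrow> \<phi> t = v" using assms(2) by (auto simp: constant_on_def)
  have "(\<lambda>t. \<phi> t * haar_real n t) = (\<lambda>t. v * (indicator (dyad (2*n)) t - indicator (dyad (Suc (2*n))) t))"
    using v dyad_split[OF assms(1)] by (auto simp: haar_real_def indicator_def fun_eq_iff)
  then show ?thesis using assms integrable_dyad[of "2*n"] integrable_dyad[of "Suc (2*n)"]
    by (simp add: measure_dyad)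
qed

lemma integral_haar: "n \<ge> 1 \<Longrightarrow> integral\<^sup>L MI (haar_real n) = 0"
  using integral_step_haar[of n "\<lambda>t. 1"] by (auto simp: constant_on_def)

lemma integral_step_haar_sq:
  fixes \<phi> :: "real \<Rightarrow> real"
  assumes "n \<ge> 1" "\<And>t. t \<in> dyad n \<Longrightarrow> \<phi> t = v"
  shows "integral\<^sup>L MI (\<lambda>t. \<phi> t * haar_real n t * haar_real n t) = v / 2 ^ dlog n"
proof -
  have "haar_real n t * haar_real n t = \<bar>haar_real n t\<bar> * \<bar>haar_real n t\<bar>" for t by simp
  then have "\<phi> t * haar_real n t * haar_real n t = v * indicator (dyad n) t" for t
    unfolding mult.assoc using haar_real_abs[OF assms(1)] assms(2)[of t] by (auto simp: indicator_def)
  then show ?thesis using assms(1) by (simp add: measure_dyad)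
qed

lemma integral_step_haar_haar:
  fixes \<phi> :: "real \<Rightarrow> real"
  assumes "m \<ge> 1" "n \<ge> 1" "m \<noteq> n" "\<phi> constant_on dyad m" "\<phi> constant_on dyad n"
  shows "integral\<^sup>L MI (\<lambda>t. \<phi> t * haar_real m t * haar_real n t) = 0"
proof -
  have *: "integral\<^sup>L MI (\<lambda>t. \<phi> t * haar_real m t * haar_real n t) = 0" 
    if "m \<ge> 1" "n \<ge> 1" "dlog m < dlog n" "\<phi> constant_on dyad n" for m n
  proof (rule integral_step_haar)
    show "(\<lambda>t. \<phi> t * haar_real m t) constant_on dyad n"
      using haar_real_constant[of m n] that unfolding constant_on_def by metis
  qed (use that in auto)
  consider "dlog m < dlog n" | "dlog n < dlog m" | "dlog m = dlog n" by linarith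
  then show ?thesis
  proof cases
    case 1 then show ?thesis using * assms by auto
  next
    case 2
    have "(\<lambda>t. \<phi> t * haar_real m t * haar_real n t) = (\<lambda>t. \<phi> t * haar_real n t * haar_real m t)"
      by (simp add: mult_ac)
    with 2 show ?thesis using *[of n m] assms by auto
  next
    case 3
    have 0: "haar_real m t * haar_real n t = 0" for t
      using dyad_disjoint_level[OF assms(1,2) 3, of t] haar_real_abs[of m t] haar_real_abs[of n t] assms
      by (cases "t \<in> dyad m"; cases "t \<in> dyad n") auto
    show ?thesis unfolding mult.assoc 0 by simp
  qed
qed

lemma integral_haar_haar:
  assumes "m \<ge> 1" "n \<ge> 1"
  shows "integral\<^sup>L MI (\<lambda>t. haar_real m t * haar_real n t) = (if m = n then 1 / 2 ^ dlog n else 0)"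
  using integral_step_haar_haar[of m n "\<lambda>_. 1"] integral_step_haar_sq[of n "\<lambda>_. 1" 1] assms
  by (auto simp: constant_on_def)

lemma sum_indicator_partition:
  assumes "N \<ge> 1" "t \<in> I01"
  shows "(\<Sum>n\<in>{N..<2*N}. indicator (dyad n) t) = (1::real)"
proof -
  obtain n where n: "n \<in> {N..<2*N}" "t \<in> dyad n" 
    using dyad_partition[OF assms(2,1)] by blast
  have "(\<Sum>m\<in>{N..<2*N}. indicator (dyad m) t) = (\<Sum>m\<in>{N..<2*N}. if m = n then 1 else (0::real))"
    using n dyad_disjoint_range[OF assms(1)] by (intro sum.cong) (auto simp: indicator_def)
  then show ?thesis using n by simp
qed

lemma dyad_sets_MI: "n \<ge> 1 \<Longrightarrow> dyad n \<in> sets MI"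
  using dyad_subset[of n] by (simp add: sets_restrict_space_iff)

lemma integrable_indicator_dyad:
  fixes f :: "real \<Rightarrow> 'a::{banach, second_countable_topology}"
  assumes "n \<ge> 1" "integrable MI f"
  shows "integrable MI (\<lambda>t. indicator (dyad n) t *\<^sub>R f t)"
  by (intro integrable_mult_indicator dyad_sets_MI assms)

lemma integral_partition:
  fixes f :: "real \<Rightarrow> 'a::{banach, second_countable_topology}"
  assumes "integrable MI f" "N \<ge> 1"
  shows "integral\<^sup>L MI f = (\<Sum>n\<in>{N..<2*N}. integral\<^sup>L MI (\<lambda>t. indicator (dyad n) t *\<^sub>R f t))"
proof -
  have "integral\<^sup>L MI f = integral\<^sup>L MI (\<lambda>t. \<Sum>n\<in>{N..<2*N}. indicator (dyad n) t *\<^sub>R f t)"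
    by (rule Bochner_Integration.integral_cong)
       (auto simp: sum_indicator_partition[OF assms(2)] simp flip: scaleR_sum_left)
  also have "\<dots> = (\<Sum>n\<in>{N..<2*N}. integral\<^sup>L MI (\<lambda>t. indicator (dyad n) t *\<^sub>R f t))"
    by (intro Bochner_Integration.integral_sum integrable_indicator_dyad assms) (use assms in auto)
  finally show ?thesis .
qed

text \<open>On each dyadic level the translates have disjoint supports.\<close>

lemma Lq_norm_level:
  assumes q: "q > 0" and E: "\<And>n. n \<in> E \<Longrightarrow> n \<ge> 1 \<and> dlog n = i" and fin: "finite E"
  shows "Lq_norm q (\<lambda>t. \<Sum>n\<in>E. a n * of_real (haar_real (2 ^ m * n) t))
    = (1 / 2 ^ (m + i) * (\<Sum>n\<in>E. norm (a n) powr q)) powr (1 / q)"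
proof -
  have pt: "norm (\<Sum>n\<in>E. a n * of_real (haar_real (2 ^ m * n) t)) powr q
     = (\<Sum>n\<in>E. norm (a n) powr q * indicator (dyad (2 ^ m * n)) t)" for t
  proof (cases "\<exists>n\<in>E. t \<in> dyad (2 ^ m * n)")
    case True
    then obtain n where n: "n \<in> E" "t \<in> dyad (2 ^ m * n)" by auto
    have *: "indicator (dyad (2 ^ m * k)) t = (if k = n then 1 else (0::real))" if "k \<in> E" for k
    proof -
      have "dlog (2^m*k) = dlog (2^m*n)" "2^m*k \<ge> 1" "2^m*n \<ge> 1"
        using E[OF that] E[OF n(1)] by (simp_all add: dlog_mult_pow2)
      then have "t \<in> dyad (2^m*k) \<Longrightarrow> k = n" using dyad_disjoint_level[of "2^m*k" "2^m*n" t] n(2) by simp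
      then show ?thesis using n(2) by (cases "k = n") (auto simp: indicator_def)
    qed
    have "(\<Sum>k\<in>E. a k * of_real (haar_real (2 ^ m * k) t)) = 
          (\<Sum>k\<in>E. if k = n then a n * of_real (haar_real (2 ^ m * n) t) else 0)"
    proof (rule sum.cong)
      fix k assume "k \<in> E"
      then have "2^m*k \<ge> 1" "indicator (dyad (2 ^ m * k)) t = (if k = n then 1 else (0::real))" using * E[of k] by auto
      then show "a k * complex_of_real (haar_real (2 ^ m * k) t) =
         (if k = n then a n * complex_of_real (haar_real (2 ^ m * n) t) else 0)"
        using haar_real_abs[of "2^m*k" t] by (cases "k = n") auto
    qed simp
    also have "\<dots> = a n * of_real (haar_real (2 ^ m * n) t)" using n fin by simp
    finally have 1: "norm (\<Sum>k\<in>E. a k * of_real (haar_real (2 ^ m * k) t)) = norm (a n)"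
      using haar_real_abs[of "2^m*n" t] E[OF n(1)] n(2) by (simp add: norm_mult)
    have "(\<Sum>k\<in>E. norm (a k) powr q * indicator (dyad (2 ^ m * k)) t) = (\<Sum>k\<in>E. if k = n then norm (a n) powr q else 0)"
      by (rule sum.cong) (auto simp: *)
    with 1 show ?thesis using n fin by simp
  next
    case False
    have "haar_real (2 ^ m * k) t = 0" if "k \<in> E" for k
      using haar_real_abs[of "2^m*k" t] False E[OF that] that by auto
    then show ?thesis using False q by (simp add: sum.neutral)
  qed
  have "integral\<^sup>L MI (\<lambda>t. \<Sum>n\<in>E. norm (a n) powr q * indicator (dyad (2 ^ m * n)) t)
     = (\<Sum>n\<in>E. norm (a n) powr q * (1 / 2 ^ (m + i)))"
  proof (subst Bochner_Integration.integral_sum)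
    fix n assume n: "n \<in> E"
    show "integrable MI (\<lambda>t. norm (a n) powr q * indicator (dyad (2 ^ m * n)) t)"
      using integrable_dyad[of "2^m*n"] E[OF n] by auto
  next
    show "(\<Sum>n\<in>E. integral\<^sup>L MI (\<lambda>t. norm (a n) powr q * indicator (dyad (2 ^ m * n)) t))
       = (\<Sum>n\<in>E. norm (a n) powr q * (1 / 2 ^ (m + i)))"
    proof (rule sum.cong)
      fix n assume n: "n \<in> E"
      then have "dlog (2^m*n) = m + i" using E[OF n] dlog_mult_pow2[of n m] by auto
      then show "integral\<^sup>L MI (\<lambda>t. norm (a n) powr q * indicator (dyad (2 ^ m * n)) t) = norm (a n) powr q * (1 / 2 ^ (m + i))"
        using integral_dyad[of "2^m*n"] E[OF n] by simp
    qed simp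
  qed
  then show ?thesis
    unfolding Lq_norm_def pt by (simp add: mult.commute sum_divide_distrib)
qed


subsection \<open>Convergence of Haar series\<close>

definition dyad_mean :: "(real \<Rightarrow> complex) \<Rightarrow> nat \<Rightarrow> complex" where
  "dyad_mean g n = 2 ^ dlog n * integral\<^sup>L MI (\<lambda>t. indicator (dyad n) t *\<^sub>R g t)"

text \<open>The conditional expectation of \<open>g\<close> with respect to the partition of the
  unit interval into \<open>dyad N, ..., dyad (2 * N - 1)\<close>.\<close>

definition avg :: "nat \<Rightarrow> (real \<Rightarrow> complex) \<Rightarrow> real \<Rightarrow> complex" where
  "avg N g t = (\<Sum>n\<in>{N..<2*N}. dyad_mean g n * of_real (indicator (dyad n) t))"

definition haar_coeff :: "(real \<Rightarrow> complex) \<Rightarrow> nat \<Rightarrow> complex" where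
  "haar_coeff g n = 2 ^ dlog n * integral\<^sup>L MI (\<lambda>t. g t * of_real (haar_real n t))"

lemma integral_dyad_split:
  assumes "n \<ge> 1" "integrable MI g"
  defines "I \<equiv> \<lambda>k. integral\<^sup>L MI (\<lambda>t. indicator (dyad k) t *\<^sub>R (g t :: complex))"
  shows "I n = I (2 * n) + I (Suc (2 * n))"
    and "integral\<^sup>L MI (\<lambda>t. g t * of_real (haar_real n t)) = I (2 * n) - I (Suc (2 * n))"
proof -
  have i: "integrable MI (\<lambda>t. indicator (dyad k) t *\<^sub>R g t)" if "k \<ge> 1" for k
    using that assms by (intro integrable_indicator_dyad)
  have "indicator (dyad n) t *\<^sub>R g t = indicator (dyad (2*n)) t *\<^sub>R g t + indicator (dyad (Suc (2*n))) t *\<^sub>R g t" for t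
    using dyad_split[OF assms(1)] dyad_split_disjoint[OF assms(1)] by (auto simp: indicator_def)
  then show "I n = I (2 * n) + I (Suc (2 * n))"
    unfolding I_def using i[of "2*n"] i[of "Suc (2*n)"] assms(1) by simp
  have "g t * of_real (haar_real n t) = indicator (dyad (2*n)) t *\<^sub>R g t - indicator (dyad (Suc (2*n))) t *\<^sub>R g t" for t
    by (auto simp: indicator_def haar_real_def)
  then show "integral\<^sup>L MI (\<lambda>t. g t * of_real (haar_real n t)) = I (2 * n) - I (Suc (2 * n))"
    unfolding I_def using i[of "2*n"] i[of "Suc (2*n)"] assms(1) by simp
qed

text \<open>Splitting the intervals one after the other in the order of their index shows that a partial sum
  of the Haar series of \<open>g\<close> is an average of \<open>g\<close> over a dyadic partition.\<close>

lemma haar_partial_sum_eq_avg: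
  assumes "integrable MI g" "integral\<^sup>L MI g = 0" "N \<ge> 1" "t \<in> I01"
  shows "(\<Sum>n\<in>{1..<N}. haar_coeff g n * of_real (haar_real n t)) = avg N g t"
  using assms(3)
proof (induction N rule: nat_induct_at_least)
  case base
  have "integral\<^sup>L MI (\<lambda>t. indicator (dyad (Suc 0)) t *\<^sub>R g t) = integral\<^sup>L MI g"
    by (rule Bochner_Integration.integral_cong) (auto simp: dyad_1)
  then show ?case using assms by (simp add: avg_def dyad_mean_def numeral_2_eq_2)
next
  case (Suc N)
  let ?f = "\<lambda>n. dyad_mean g n * of_real (indicator (dyad n) t)"
  have "{Suc N..<2 * Suc N} = insert (2*N) (insert (Suc (2*N)) ({N..<2*N} - {N}))" using Suc.hyps by auto
  then have "avg (Suc N) g t = ?f (2*N) + ?f (Suc (2*N)) + (\<Sum>n\<in>{N..<2*N} - {N}. ?f n)"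
    by (simp add: avg_def add.assoc)
  also have "(\<Sum>n\<in>{N..<2*N} - {N}. ?f n) = avg N g t - ?f N"
    unfolding avg_def using Suc.hyps by (subst sum_diff1) auto
  also have "?f (2*N) + ?f (Suc (2*N)) + (avg N g t - ?f N) = avg N g t + haar_coeff g N * of_real (haar_real N t)"
  proof -
    define A B where "A = integral\<^sup>L MI (\<lambda>t. indicator (dyad (2*N)) t *\<^sub>R g t)"
      and "B = integral\<^sup>L MI (\<lambda>t. indicator (dyad (Suc (2*N))) t *\<^sub>R g t)"
    have m: "dyad_mean g (2*N) = 2 * 2 ^ dlog N * A" "dyad_mean g (Suc (2*N)) = 2 * 2 ^ dlog N * B"
      "dyad_mean g N = 2 ^ dlog N * (A + B)" "haar_coeff g N = 2 ^ dlog N * (A - B)"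
      using Suc.hyps integral_dyad_split[OF Suc.hyps assms(1)] by (simp_all add: dyad_mean_def haar_coeff_def A_def B_def)
    have i: "indicator (dyad N) t = indicator (dyad (2*N)) t + (indicator (dyad (Suc (2*N))) t :: real)"
      using dyad_split[OF Suc.hyps] dyad_split_disjoint[OF Suc.hyps] by (auto simp: indicator_def)
    show ?thesis unfolding m haar_real_def i by (simp add: algebra_simps)
  qed
  finally show ?case using Suc by simp
qed

lemma avg_bounded_measurable: "avg N g \<in> borel_measurable MI"
  unfolding avg_def by measurable

lemma avg_at:
  assumes "N \<ge> 1" "n \<in> {N..<2*N}" "t \<in> dyad n"
  shows "avg N g t = dyad_mean g n"
proof -
  have "avg N g t = (\<Sum>m\<in>{N..<2*N}. if m = n then dyad_mean g n else 0)"
    unfolding avg_def using assms dyad_disjoint_range[OF assms(1)]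
    by (intro sum.cong) (auto simp: indicator_def)
  then show ?thesis using assms by simp
qed

text \<open>Jensen's inequality on one interval, obtained from Hoelder: the indicator is idempotent,
  so one copy of it can serve as the second factor, and its \<open>q'\<close>-norm supplies the
  power of the length.\<close>

lemma dyad_mean_powr_le:
  assumes q: "q > 1" and g: "Lq q g" and n: "n \<ge> 1"
  shows "norm (dyad_mean g n) powr q / 2 ^ dlog n \<le> integral\<^sup>L MI (\<lambda>t. indicator (dyad n) t *\<^sub>R norm (g t) powr q)"
proof -
  define q' where "q' = q / (q - 1)"
  have q': "q' > 0" "1/q + 1/q' = 1" using q by (auto simp: q'_def field_simps)
  have [measurable]: "g \<in> borel_measurable MI" using g by (auto simp: Lq_def)
  let ?i = "\<lambda>t. complex_of_real (indicator (dyad n) t)"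
  let ?P = "integral\<^sup>L MI (\<lambda>t. indicator (dyad n) t *\<^sub>R norm (g t) powr q)"
  let ?k = "2 ^ dlog n :: real"
  have eq: "norm (?i t * g t) powr q = indicator (dyad n) t *\<^sub>R norm (g t) powr q" for t
    using q by (auto simp: indicator_def)
  have Li: "Lq q (\<lambda>t. ?i t * g t)"
    unfolding Lq_def eq using g integrable_indicator_dyad[OF n, of "\<lambda>t. norm (g t) powr q"] by (auto simp: Lq_def)
  have im: "?i \<in> borel_measurable MI" by measurable
  have Li': "Lq q' ?i" by (rule Lq_bounded[where B=1]) (use q' im in \<open>auto simp: indicator_def\<close>)
  have ni: "Lq_norm q' ?i = (1 / ?k) powr (1/q')"
  proof -
    have "norm (?i t) powr q' = indicator (dyad n) t" for t using q' by (auto simp: indicator_def)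
    then show ?thesis unfolding Lq_norm_def using integral_dyad[OF n] by simp
  qed
  have nP: "Lq_norm q (\<lambda>t. ?i t * g t) = ?P powr (1/q)" by (simp add: Lq_norm_def eq)
  have "norm (integral\<^sup>L MI (\<lambda>t. indicator (dyad n) t *\<^sub>R g t)) \<le> integral\<^sup>L MI (\<lambda>t. norm (indicator (dyad n) t *\<^sub>R g t))"
    by (rule integral_norm_bound)
  also have "\<dots> = integral\<^sup>L MI (\<lambda>t. norm (?i t * g t * ?i t))"
    by (rule Bochner_Integration.integral_cong) (auto simp: indicator_def)
  also have "\<dots> \<le> ?P powr (1/q) * (1 / ?k) powr (1/q')"
    using Holder_inequality(2)[OF _ q' Li Li'] q unfolding ni nP by simp
  finally have "norm (dyad_mean g n) \<le> ?k * (?P powr (1/q) * (1 / ?k) powr (1/q'))"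
    unfolding dyad_mean_def norm_mult by (simp add: norm_power)
  also have "\<dots> = ?P powr (1/q) * ?k powr (1/q)"
  proof -
    have "?k * (1 / ?k) powr (1/q') = ?k powr 1 * ?k powr (-(1/q'))"
      by (simp add: powr_divide powr_minus_divide)
    also have "\<dots> = ?k powr (1/q)"
    proof -
      have "1 + - (1/q') = 1/q" using q' by linarith
      then show ?thesis by (simp only: powr_add[symmetric])
    qed
    finally show ?thesis by (simp add: mult_ac)
  qed
  finally have "norm (dyad_mean g n) powr q \<le> (?P powr (1/q) * ?k powr (1/q)) powr q"
    using q by (intro powr_mono2) auto
  also have "\<dots> = ?P * ?k" using q by (simp add: powr_mult powr_powr)
  finally show ?thesis by (simp add: field_simps)
qed

text \<open>Summing Jensen's inequality over the partition. Contractivity means that convergence of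
  the averages only has to be checked on a dense set.\<close>

lemma Lq_avg:
  assumes q: "q > 1" and g: "Lq q g" and N: "N \<ge> 1"
  shows "Lq q (avg N g)" and "Lq_norm q (avg N g) \<le> Lq_norm q g"
proof -
  show "Lq q (avg N g)"
  proof (rule Lq_bounded)
    show "norm (avg N g t) \<le> (\<Sum>n\<in>{N..<2*N}. norm (dyad_mean g n))" for t
      unfolding avg_def by (rule order.trans[OF norm_sum sum_mono]) (auto simp: norm_mult indicator_def)
  qed (use q avg_bounded_measurable in auto)
  then have i: "integrable MI (\<lambda>t. norm (avg N g t) powr q)" "integrable MI (\<lambda>t. norm (g t) powr q)"
    using g by (auto simp: Lq_def)
  have "integral\<^sup>L MI (\<lambda>t. norm (avg N g t) powr q) = (\<Sum>n\<in>{N..<2*N}. norm (dyad_mean g n) powr q / 2 ^ dlog n)"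
    unfolding integral_partition[OF i(1) N]
  proof (rule sum.cong)
    fix n assume n: "n \<in> {N..<2*N}"
    have eq: "indicator (dyad n) t *\<^sub>R norm (avg N g t) powr q = norm (dyad_mean g n) powr q * indicator (dyad n) t" for t
      using avg_at[OF N n, of t g] by (auto simp: indicator_def)
    show "integral\<^sup>L MI (\<lambda>t. indicator (dyad n) t *\<^sub>R norm (avg N g t) powr q) = norm (dyad_mean g n) powr q / 2 ^ dlog n"
      unfolding eq using integral_dyad[of n] n N by simp
  qed simp
  also have "\<dots> \<le> (\<Sum>n\<in>{N..<2*N}. integral\<^sup>L MI (\<lambda>t. indicator (dyad n) t *\<^sub>R norm (g t) powr q))"
    using N by (intro sum_mono dyad_mean_powr_le q g) auto
  also have "\<dots> = integral\<^sup>L MI (\<lambda>t. norm (g t) powr q)"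
    using integral_partition[OF i(2) N] by simp
  finally show "Lq_norm q (avg N g) \<le> Lq_norm q g"
    unfolding Lq_norm_def using q by (intro powr_mono2) auto
qed

lemma avg_diff:
  assumes "integrable MI f" "integrable MI g" "N \<ge> 1"
  shows "avg N (\<lambda>t. f t - g t) t = avg N f t - avg N g t"
proof -
  have "dyad_mean (\<lambda>t. f t - g t) n = dyad_mean f n - dyad_mean g n" if "n \<ge> 1" for n
    unfolding dyad_mean_def using integrable_indicator_dyad[OF that assms(1)] integrable_indicator_dyad[OF that assms(2)]
    by (simp add: scaleR_diff_right right_diff_distrib)
  then show ?thesis unfolding avg_def using assms(3)
    by (simp add: sum_subtractf[symmetric] left_diff_distrib)
qed

text \<open>Uniform continuity: for \<open>N \<ge> 2^K\<close> every interval of the partition has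
  length at most \<open>2^(-K)\<close>, so \<open>\<phi>\<close> differs little from its mean
  there.\<close>

lemma avg_continuous_close:
  assumes cont: "continuous_on UNIV (\<phi> :: real \<Rightarrow> complex)" and e: "e > 0"
  shows "\<exists>N0. \<forall>N\<ge>N0. \<forall>t\<in>I01. norm (\<phi> t - avg N \<phi> t) \<le> e"
proof -
  have "uniformly_continuous_on {0..1} \<phi>"
    by (rule compact_uniformly_continuous) (use cont continuous_on_subset in auto)
  then obtain d where d: "d > 0" "\<And>s t. s \<in> {0..1} \<Longrightarrow> t \<in> {0..1} \<Longrightarrow> dist s t < d \<Longrightarrow> dist (\<phi> s) (\<phi> t) < e"
    using e unfolding uniformly_continuous_on_def by metis
  obtain K where K: "(1/2::real) ^ K < d" using real_arch_pow_inv[of d "1/2"] d by auto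
  obtain B where B: "\<And>s. s \<in> {0..1} \<Longrightarrow> norm (\<phi> s) \<le> B"
    using compact_imp_bounded[OF compact_continuous_image[OF continuous_on_subset[OF cont subset_UNIV] compact_Icc[of 0 1]]]
    unfolding bounded_iff by (metis imageI)
  have "\<phi> \<in> borel_measurable lborel" using borel_measurable_continuous_onI[OF cont] by simp
  then have m\<phi>: "\<phi> \<in> borel_measurable MI"
    by (intro measurable_restrict_space1 measurable_completion)
  have i\<phi>: "integrable MI \<phi>"
    by (rule MI.integrable_const_bound[where B=B, OF AE_I2 m\<phi>]) (use B in \<open>auto simp: I01_def\<close>)
  show ?thesis
  proof (intro exI[of _ "2 ^ K"] allI impI ballI)
    fix N :: nat and t assume N: "2 ^ K \<le> N" and t: "t \<in> I01"
    have N1: "N \<ge> 1" using N one_le_power[of "2::nat" K] by linarith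
    obtain n where n: "n \<in> {N..<2*N}" "t \<in> dyad n" using dyad_partition[OF t N1] by blast
    have n1: "n \<ge> 1" using n N1 by auto
    have "K \<le> dlog n" using dlog_mono[of "2^K" n] dlog_eqI[of K "2^K"] N n by auto
    then have small: "1 / 2 ^ dlog n < d"
      using K power_decreasing[of K "dlog n" "1/2::real"] by (simp add: power_one_over)
    have close: "norm (\<phi> t - \<phi> s) \<le> e" if s: "s \<in> dyad n" for s
    proof -
      have "dist t s \<le> 1 / 2 ^ dlog n"
        using s n(2) unfolding dyad_def by (auto simp: dist_real_def add_divide_distrib)
      then have "dist t s < d" using small by auto
      moreover have "t \<in> I01" "s \<in> I01" using s n(2) dyad_subset[OF n1] by auto
      then have "t \<in> {0..1}" "s \<in> {0..1}" by (auto simp: I01_def)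
      ultimately have "dist (\<phi> t) (\<phi> s) < e" using d(2) by blast
      then show ?thesis by (simp add: dist_norm)
    qed
    have "\<phi> t = 2 ^ dlog n * integral\<^sup>L MI (\<lambda>s. of_real (indicator (dyad n) s) * \<phi> t)"
    proof -
      have "integral\<^sup>L MI (\<lambda>s. of_real (indicator (dyad n) s) * \<phi> t) = integral\<^sup>L MI (\<lambda>s. of_real (indicator (dyad n) s)) * \<phi> t"
        by simp
      also have "integral\<^sup>L MI (\<lambda>s. complex_of_real (indicator (dyad n) s)) = of_real (1 / 2 ^ dlog n)"
        unfolding integral_complex_of_real integral_dyad[OF n1] ..
      finally show ?thesis by simp
    qed
    moreover have "avg N \<phi> t = dyad_mean \<phi> n" by (rule avg_at[OF N1 n])
    ultimately have "\<phi> t - avg N \<phi> t = 2 ^ dlog n * (integral\<^sup>L MI (\<lambda>s. of_real (indicator (dyad n) s) * \<phi> t)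
        - integral\<^sup>L MI (\<lambda>s. indicator (dyad n) s *\<^sub>R \<phi> s))"
      by (simp add: dyad_mean_def right_diff_distrib)
    also have "integral\<^sup>L MI (\<lambda>s. of_real (indicator (dyad n) s) * \<phi> t) - integral\<^sup>L MI (\<lambda>s. indicator (dyad n) s *\<^sub>R \<phi> s)
      = integral\<^sup>L MI (\<lambda>s. indicator (dyad n) s *\<^sub>R (\<phi> t - \<phi> s))"
    proof -
      have "integrable MI (\<lambda>s. complex_of_real (indicator (dyad n) s) * \<phi> t)"
        by (intro integrable_mult_left integrable_of_real integrable_dyad n1)
      note i = this
      have eq: "(\<lambda>s. indicator (dyad n) s *\<^sub>R (\<phi> t - \<phi> s)) = (\<lambda>s. of_real (indicator (dyad n) s) * \<phi> t - indicator (dyad n) s *\<^sub>R \<phi> s)"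
        by (simp add: scaleR_conv_of_real algebra_simps)
      show ?thesis unfolding eq
        by (rule Bochner_Integration.integral_diff[symmetric, OF i integrable_indicator_dyad[OF n1 i\<phi>]])
    qed
    finally have "norm (\<phi> t - avg N \<phi> t) = 2 ^ dlog n * norm (integral\<^sup>L MI (\<lambda>s. indicator (dyad n) s *\<^sub>R (\<phi> t - \<phi> s)))"
      by (simp add: norm_mult norm_power)
    also have "\<dots> \<le> 2 ^ dlog n * integral\<^sup>L MI (\<lambda>s. e * indicator (dyad n) s)"
    proof (rule mult_left_mono[OF Bochner_Integration.integral_norm_bound_integral])
      show "integrable MI (\<lambda>s. indicator (dyad n) s *\<^sub>R (\<phi> t - \<phi> s))"
        by (intro integrable_indicator_dyad n1 Bochner_Integration.integrable_diff i\<phi>) auto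
    qed (use integrable_dyad[OF n1] close e in \<open>auto simp: indicator_def\<close>)
    also have "\<dots> = e" using integral_dyad[OF n1] by simp
    finally show "norm (\<phi> t - avg N \<phi> t) \<le> e" .
  qed
qed

lemma Lq_norm_dominated:
  assumes q: "q > 0" and G: "\<And>n. G n \<in> borel_measurable MI"
    and lim: "AE t in MI. (\<lambda>n. G n t) \<longlonglongrightarrow> 0"
    and w: "\<And>n t. norm (G n t) \<le> w t" "integrable MI (\<lambda>t. w t powr q)"
  shows "(\<lambda>n. Lq_norm q (G n)) \<longlonglongrightarrow> 0"
proof -
  note [measurable] = G
  have "(\<lambda>n. integral\<^sup>L MI (\<lambda>t. norm (G n t) powr q)) \<longlonglongrightarrow> integral\<^sup>L MI (\<lambda>t. 0)"
  proof (rule integral_dominated_convergence)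
    show "AE t in MI. (\<lambda>n. norm (G n t) powr q) \<longlonglongrightarrow> 0"
      using lim
    proof eventually_elim
      fix t assume "(\<lambda>n. G n t) \<longlonglongrightarrow> 0"
      then have "(\<lambda>n. norm (G n t)) \<longlonglongrightarrow> 0" by (rule tendsto_norm_zero)
      then have "(\<lambda>n. norm (G n t) powr q) \<longlonglongrightarrow> 0 powr q"
        by (rule tendsto_powr2) (use q in auto)
      then show "(\<lambda>n. norm (G n t) powr q) \<longlonglongrightarrow> 0" by simp
    qed
    show "AE t in MI. norm (norm (G n t) powr q) \<le> w t powr q" for n
      using w q by (intro AE_I2) (auto intro!: powr_mono2)
  qed (use w in auto)
  then have "(\<lambda>n. integral\<^sup>L MI (\<lambda>t. norm (G n t) powr q) powr (1/q)) \<longlonglongrightarrow> 0 powr (1/q)"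
    by (intro tendsto_powr2) (use q in auto)
  then show ?thesis by (simp add: Lq_norm_def)
qed

lemma Lq_continuous_dense:
  assumes q: "q \<ge> 1" and g: "Lq q g" and e: "e > 0"
  shows "\<exists>\<phi>. continuous_on UNIV \<phi> \<and> Lq q \<phi> \<and> Lq_norm q (\<lambda>t. g t - \<phi> t) < e"
proof -
  have [measurable]: "g \<in> borel_measurable MI" using g by (auto simp: Lq_def)
  define gB where "gB n t = (if norm (g t) \<le> real n then g t else 0)" for n :: nat and t
  have gB_meas [measurable]: "gB n \<in> borel_measurable MI" for n unfolding gB_def by measurable
  have "(\<lambda>n. Lq_norm q (\<lambda>t. g t - gB n t)) \<longlonglongrightarrow> 0"
  proof (rule Lq_norm_dominated)
    show "AE t in MI. (\<lambda>n. g t - gB n t) \<longlonglongrightarrow> 0"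
    proof (rule AE_I2)
      fix t
      have "eventually (\<lambda>n. g t - gB n t = 0) sequentially"
        using eventually_ge_at_top[of "nat \<lceil>norm (g t)\<rceil>"]
        by eventually_elim (auto simp: gB_def nat_le_iff ceiling_le_iff)
      then show "(\<lambda>n. g t - gB n t) \<longlonglongrightarrow> 0" by (rule tendsto_eventually)
    qed
    show "norm (g t - gB n t) \<le> norm (g t)" for n t by (auto simp: gB_def)
  qed (use q g in \<open>auto simp: Lq_def\<close>)
  then have "eventually (\<lambda>n. Lq_norm q (\<lambda>t. g t - gB n t) < e/2) sequentially"
    using e by (intro order_tendstoD) auto
  then obtain B where B: "Lq_norm q (\<lambda>t. g t - gB B t) < e/2" by (auto simp: eventually_sequentially)
  have LB: "Lq q (gB B)" by (rule Lq_bounded[where B="real B"]) (use q in \<open>auto simp: gB_def\<close>)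
  \<comment> \<open>Projection onto the ball of radius \<open>B\<close>. It is continuous and fixes
    the values of \<open>gB B\<close>, so it makes the approximating continuous functions
    \<open>\<psi> n\<close> a dominated sequence without changing their limit.\<close>
  define clip where "clip = closest_point (cball 0 (real B) :: complex set)"
  have clip_cont: "continuous_on UNIV clip"
    unfolding clip_def by (rule continuous_on_closest_point) auto
  have clip_le: "norm (clip x) \<le> real B" for x
    using closest_point_in_set[of "cball 0 (real B) :: complex set" x] by (auto simp: clip_def)
  have clip_id: "clip x = x" if "norm x \<le> real B" for x
    unfolding clip_def by (rule closest_point_self) (use that in auto)
  have "gB B measurable_on I01"
    by (simp add: measurable_on_iff_borel_measurable)
  then obtain N \<psi> where N: "negligible N" and \<psi>: "\<And>n. continuous_on UNIV (\<psi> n)"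
    and lim: "\<And>t. t \<notin> N \<Longrightarrow> (\<lambda>n. \<psi> n t) \<longlonglongrightarrow> (if t \<in> I01 then gB B t else 0)"
    unfolding measurable_on_def by blast
  define \<phi> where "\<phi> n t = clip (\<psi> n t)" for n :: nat and t
  have \<phi>c: "continuous_on UNIV (\<phi> n)" for n
    unfolding \<phi>_def by (rule continuous_on_compose2[OF clip_cont \<psi>]) auto
  have [measurable]: "\<phi> n \<in> borel_measurable MI" for n
  proof -
    have "\<phi> n \<in> borel_measurable lborel" using borel_measurable_continuous_onI[OF \<phi>c] by simp
    then show ?thesis by (intro measurable_restrict_space1 measurable_completion)
  qed
  have L\<phi>: "Lq q (\<phi> n)" for n
    by (rule Lq_bounded[where B="real B"]) (use q clip_le in \<open>auto simp: \<phi>_def\<close>)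
  have "(\<lambda>n. Lq_norm q (\<lambda>t. gB B t - \<phi> n t)) \<longlonglongrightarrow> 0"
  proof (rule Lq_norm_dominated)
    have "AE t in lebesgue. t \<notin> N" using N by (intro AE_not_in) (simp add: negligible_iff_null_sets)
    then have "AE t in MI. t \<notin> N" by (subst AE_restrict_space_iff) auto
    then show "AE t in MI. (\<lambda>n. gB B t - \<phi> n t) \<longlonglongrightarrow> 0"
    proof (rule AE_mp, intro AE_I2 impI)
      fix t assume t: "t \<in> space MI" "t \<notin> N"
      then have "(\<lambda>n. \<psi> n t) \<longlonglongrightarrow> gB B t" using lim[of t] by auto
      then have "(\<lambda>n. \<phi> n t) \<longlonglongrightarrow> clip (gB B t)" unfolding \<phi>_def
        by (intro continuous_on_tendsto_compose[OF clip_cont]) auto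
      moreover have "clip (gB B t) = gB B t" by (rule clip_id) (auto simp: gB_def)
      ultimately show "(\<lambda>n. gB B t - \<phi> n t) \<longlonglongrightarrow> 0" 
        using tendsto_diff[OF tendsto_const[of "gB B t"]] by fastforce
    qed
    show "norm (gB B t - \<phi> n t) \<le> 2 * real B" for n t
    proof -
      have "norm (gB B t) \<le> real B" by (auto simp: gB_def)
      then show ?thesis using norm_triangle_ineq4[of "gB B t" "\<phi> n t"] clip_le[of "\<psi> n t"] by (simp add: \<phi>_def)
    qed
  qed (use q in auto)
  then have "eventually (\<lambda>n. Lq_norm q (\<lambda>t. gB B t - \<phi> n t) < e/2) sequentially"
    using e by (intro order_tendstoD) auto
  then obtain n where n: "Lq_norm q (\<lambda>t. gB B t - \<phi> n t) < e/2" by (auto simp: eventually_sequentially)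
  have "Lq_norm q (\<lambda>t. g t - \<phi> n t) < e"
    using Lq_norm_triangle[OF q Lq_diff[OF q g LB] Lq_diff[OF q LB L\<phi>[of n]]] B n by simp
  then show ?thesis using \<phi>c L\<phi> by blast
qed

theorem haar_series_converges:
  assumes q: "q > 1" and g: "Lq0 q g"
  shows "(\<lambda>N. Lq_norm q (\<lambda>t. g t - (\<Sum>n\<in>{1..<N}. haar_coeff g n * of_real (haar_real n t)))) \<longlonglongrightarrow> 0"
proof (rule LIMSEQ_I)
  fix e :: real assume e: "e > 0"
  have Lg: "Lq q g" and g0: "integral\<^sup>L MI g = 0" using g by (auto simp: Lq0_def)
  have q1: "q \<ge> 1" using q by simp
  obtain \<phi> where c: "continuous_on UNIV \<phi>" and L\<phi>: "Lq q \<phi>" and d: "Lq_norm q (\<lambda>t. g t - \<phi> t) < e/4"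
    using Lq_continuous_dense[OF q1 Lg, of "e/4"] e by auto
  obtain N0 where N0: "\<And>N t. N \<ge> N0 \<Longrightarrow> t \<in> I01 \<Longrightarrow> norm (\<phi> t - avg N \<phi> t) \<le> e/4"
    using avg_continuous_close[OF c, of "e/4"] e by auto
  show "\<exists>no. \<forall>N\<ge>no. norm (Lq_norm q (\<lambda>t. g t - (\<Sum>n\<in>{1..<N}. haar_coeff g n * of_real (haar_real n t))) - 0) < e"
  proof (intro exI[of _ "max 1 N0"] allI impI)
    fix N assume "max 1 N0 \<le> N"
    then have N: "N \<ge> 1" "N \<ge> N0" by auto
    have "Lq_norm q (\<lambda>t. g t - (\<Sum>n\<in>{1..<N}. haar_coeff g n * of_real (haar_real n t))) = Lq_norm q (\<lambda>t. g t - avg N g t)"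
      by (rule Lq_norm_cong) (subst haar_partial_sum_eq_avg[OF Lq_integrable(1)[OF q Lg] g0 N(1)]; simp)
    \<comment> \<open>Three errors: the approximation of \<open>g\<close> by \<open>\<phi>\<close>,
      the oscillation of \<open>\<phi>\<close>, and the average of \<open>g - \<phi>\<close>. Each
      is at most \<open>e/4\<close>, the last one by contractivity.\<close>
    also have "\<dots> = Lq_norm q (\<lambda>t. (g t - \<phi> t) + ((\<phi> t - avg N \<phi> t) - avg N (\<lambda>t. g t - \<phi> t) t))"
      by (subst avg_diff[OF Lq_integrable(1)[OF q Lg] Lq_integrable(1)[OF q L\<phi>] N(1)]) (simp add: algebra_simps)
    also have "\<dots> \<le> Lq_norm q (\<lambda>t. g t - \<phi> t) + (Lq_norm q (\<lambda>t. \<phi> t - avg N \<phi> t) + Lq_norm q (avg N (\<lambda>t. g t - \<phi> t)))"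
      by (intro order.trans[OF Lq_norm_triangle] add_left_mono Lq_norm_triangle_diff q1 Lq_diff Lg L\<phi> Lq_avg q N)
    also have "Lq_norm q (avg N (\<lambda>t. g t - \<phi> t)) \<le> Lq_norm q (\<lambda>t. g t - \<phi> t)"
      by (intro Lq_avg q N Lq_diff q1 Lg L\<phi>)
    also have "Lq_norm q (\<lambda>t. \<phi> t - avg N \<phi> t) \<le> Lq_norm q (\<lambda>t. of_real (e/4))"
      by (rule Lq_norm_mono) (use q e N0[OF N(2)] in \<open>auto intro!: Lq_bounded\<close>)
    also have "Lq_norm q (\<lambda>t. of_real (e/4)) = e/4"
      using q e by (simp add: Lq_norm_def powr_powr)
    finally show "norm (Lq_norm q (\<lambda>t. g t - (\<Sum>n\<in>{1..<N}. haar_coeff g n * of_real (haar_real n t))) - 0) < e"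
      using d e by simp
  qed
qed

subsection \<open>First-order chaoses\<close>

abbreviation haarC :: "nat \<Rightarrow> real \<Rightarrow> complex" where
  "haarC n \<equiv> \<lambda>t. of_real (haar_real n t)"

text \<open>In terms of \<open>V h_n = h_(2n)\<close> this is the series of \<open>y_k V^k\<close>
  applied to \<open>h_n\<close>; the indices \<open>2^k * n\<close> are the leftmost descendants of
  \<open>n\<close>. One notation serves both \<open>f_n\<close> (with \<open>y = c\<close>) and the
  finite test chaoses.\<close>

definition chaos :: "(nat \<Rightarrow> complex) \<Rightarrow> nat \<Rightarrow> real \<Rightarrow> complex" where
  "chaos y n t = (\<Sum>k. y k * haarC (2 ^ k * n) t)"

lemma dyad_iff: "t \<in> dyad n \<longleftrightarrow> real n < 2 ^ dlog n * (t + 1) \<and> 2 ^ dlog n * (t + 1) \<le> real n + 1"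
  by (auto simp: dyad_def field_simps)

text \<open>With \<open>l = dlog n\<close>, the argument is the affine map
  \<open>2^l t - (n - 2^l)\<close> of the dilation system, rewritten without subtraction of natural
  numbers. It carries \<open>dyad n\<close> onto the unit interval.\<close>

lemma haar_real_dilate:
  assumes "n \<ge> 1"
  shows "haar_real (2 ^ k) (2 ^ dlog n * (t + 1) - real n) = haar_real (2 ^ k * n) t"
proof -
  have "dlog (Suc 0) = 0" by (rule dlog_eqI) auto
  then have [simp]: "dlog (2 ^ k) = k" using dlog_mult_pow2[of 1 k] by simp
  have p: "2 ^ k \<ge> (1::nat)" "2 ^ k * n \<ge> 1" using assms by auto
  have d: "dlog (2 * 2 ^ k) = Suc k" "dlog (Suc (2 * 2 ^ k)) = Suc k" 
     "dlog (2 * (2 ^ k * n)) = Suc (k + dlog n)" "dlog (Suc (2 * (2 ^ k * n))) = Suc (k + dlog n)"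
    using p assms by (simp_all only: dlog_double dlog_double_Suc dlog_mult_pow2) simp_all
  have "2 ^ dlog n * (t + 1) - real n \<in> dyad (2 * 2 ^ k) \<longleftrightarrow> t \<in> dyad (2 * (2 ^ k * n))"
    unfolding dyad_iff d by (simp add: power_add algebra_simps)
  moreover have "2 ^ dlog n * (t + 1) - real n \<in> dyad (Suc (2 * 2 ^ k)) \<longleftrightarrow> t \<in> dyad (Suc (2 * (2 ^ k * n)))"
    unfolding dyad_iff d by (simp add: power_add algebra_simps)
  ultimately show ?thesis by (simp add: haar_real_def indicator_def)
qed

lemma dyad_chain_subset:
  assumes "n \<ge> 1" shows "dyad (2 ^ k * n) \<subseteq> dyad n"
proof (induction k)
  case (Suc k)
  have "dyad (2 ^ Suc k * n) \<subseteq> dyad (2 ^ k * n)"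
    using dyad_split[of "2 ^ k * n"] assms by (auto simp: mult.assoc)
  with Suc show ?case by blast
qed simp

lemma haar_real_chain_support:
  assumes "n \<ge> 1" "t \<notin> dyad n" shows "haar_real (2 ^ k * n) t = 0"
proof -
  have "t \<notin> dyad (2 ^ k * n)" using dyad_chain_subset[OF assms(1), of k] assms by blast
  then show ?thesis using haar_real_abs[of "2 ^ k * n" t] assms by (auto simp: indicator_def)
qed

lemma dil_haar_chaos:
  assumes "n \<ge> 1" shows "dil (haar_chaos c) n = chaos c n"
proof
  fix t
  define k where "k = dlog n"
  have n: "real (n - 2 ^ k) = real n - 2 ^ k" 
    using dlog_bounds[OF assms] by (simp add: of_nat_diff k_def)
  have e: "2 ^ k * t - (real n - 2 ^ k) = 2 ^ dlog n * (t + 1) - real n" by (simp add: k_def algebra_simps)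
  have m: "(real n - 2 ^ k) / 2 ^ k < t \<and> t \<le> ((real n - 2 ^ k) + 1) / 2 ^ k \<longleftrightarrow> t \<in> dyad n"
    unfolding dyad_iff k_def by (auto simp: field_simps)
  show "dil (haar_chaos c) n t = chaos c n t"
  proof (cases "t \<in> dyad n")
    case True
    then have "dil (haar_chaos c) n t = haar_chaos c (2 ^ dlog n * (t + 1) - real n)"
      unfolding dil_def Let_def k_def[symmetric] n m e by simp
    also have "\<dots> = chaos c n t"
      unfolding haar_chaos_def chaos_def by (simp add: haar_sys_eq haar_real_dilate[OF assms])
    finally show ?thesis .
  next
    case False
    then show ?thesis
      unfolding dil_def Let_def k_def[symmetric] n m e chaos_def
      by (simp add: haar_real_chain_support[OF assms False])
  qed
qed

text \<open>The intervals of the chain shrink to the left endpoint of \<open>dyad n\<close>, which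
  belongs to none of them because they are open on the left. Hence the pointwise series of a chaos
  is a finite sum for arbitrary coefficients.\<close>

lemma haar_real_chain_eventually_zero:
  assumes "n \<ge> 1" shows "\<exists>K. \<forall>k\<ge>K. haar_real (2 ^ k * n) t = 0"
proof -
  have z: "haar_real (2 ^ k * n) t = 0" if "t \<notin> dyad (2 ^ k * n)" for k
    using haar_real_abs[of "2 ^ k * n" t] that assms by (auto simp: indicator_def)
  show ?thesis
  proof (cases "2 ^ dlog n * (t + 1) - real n > 0")
    case True
    define d where "d = 2 ^ dlog n * (t + 1) - real n"
    obtain K where K: "(1/2::real) ^ K < d" using real_arch_pow_inv[of d "1/2"] True by (auto simp: d_def)
    show ?thesis
    proof (intro exI[of _ K] allI impI z notI)
      fix k assume k: "K \<le> k" "t \<in> dyad (2 ^ k * n)"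
      have "(1/2::real) ^ k \<le> (1/2) ^ K" by (rule power_decreasing) (use k in auto)
      then have "(1/2) ^ k < d" using K by linarith
      then have "1 < 2 ^ k * d" by (simp add: power_one_over pos_divide_less_eq mult.commute)
      moreover have "2 ^ k * d \<le> 1"
        using k(2) unfolding dyad_iff d_def dlog_mult_pow2[OF assms] by (simp add: power_add algebra_simps)
      ultimately show False by simp
    qed
  next
    case False
    have "t \<notin> dyad (2 ^ k * n)" for k
    proof
      assume "t \<in> dyad (2 ^ k * n)"
      then have "0 < 2 ^ k * (2 ^ dlog n * (t + 1) - real n)"
        unfolding dyad_iff dlog_mult_pow2[OF assms] by (simp add: power_add algebra_simps)
      with False show False by (simp add: zero_less_mult_iff)
    qed
    with z show ?thesis by blast
  qed
qed

lemma chaos_sums: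
  assumes "n \<ge> 1" shows "(\<lambda>k. y k * haarC (2 ^ k * n) t) sums chaos y n t"
proof -
  obtain K where "\<And>k. k \<ge> K \<Longrightarrow> haar_real (2 ^ k * n) t = 0"
    using haar_real_chain_eventually_zero[OF assms] by blast
  then have "summable (\<lambda>k. y k * haarC (2 ^ k * n) t)"
    by (intro summable_finite[of "{..<K}"]) (auto simp: not_less)
  then show ?thesis unfolding chaos_def by (rule summable_sums)
qed

lemma haarC_measurable [measurable]: "haarC n \<in> borel_measurable MI"
  by measurable

lemma norm_haarC_le: "n \<ge> 1 \<Longrightarrow> norm (haarC n t) \<le> 1"
  using haar_real_abs[of n t] by (simp add: indicator_def)

lemma Lq_haarC: "q > 0 \<Longrightarrow> n \<ge> 1 \<Longrightarrow> Lq q (haarC n)"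
  by (rule Lq_bounded[OF _ haarC_measurable, where B=1]) (use norm_haarC_le in auto)

lemma half_powr_power: "(1 / 2 ^ k) powr (1 / q) = (2 powr (-1/q)) ^ k" for q :: real
proof -
  have "(2 powr (-1/q)) ^ k = (2 powr (-1/q) :: real) powr real k" by (simp add: powr_realpow)
  also have "\<dots> = (2 powr (real k)) powr (-1/q)" by (simp add: powr_powr mult.commute)
  finally show ?thesis by (simp add: powr_realpow powr_minus_divide powr_divide)
qed

lemma Lq_norm_haarC:
  assumes "q > 0" "n \<ge> 1" shows "Lq_norm q (haarC n) = (2 powr (-1/q)) ^ dlog n"
proof -
  have "norm (haarC n t) powr q = indicator (dyad n) t" for t
    using haar_real_abs[OF assms(2), of t] assms(1) by (simp add: indicator_def)
  then have "Lq_norm q (haarC n) = (1 / 2 ^ dlog n) powr (1/q)"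
    using integral_dyad[OF assms(2)] by (simp add: Lq_norm_def)
  then show ?thesis by (simp add: half_powr_power)
qed

lemma Lq_norm_haarC_chain_le:
  assumes "q > 0" "n \<ge> 1" shows "Lq_norm q (haarC (2 ^ k * n)) \<le> (2 powr (-1/q)) ^ k"
proof -
  have "2 powr (-1/q) \<le> 2 powr (0::real)"
    using assms by (intro powr_mono) auto
  then have "(2 powr (-1/q)) ^ dlog n \<le> (1::real)"
    by (intro power_le_one) auto
  then have "(2 powr (-1/q)) ^ k * (2 powr (-1/q)) ^ dlog n \<le> (2 powr (-1/q)) ^ k"
    by (intro mult_left_le) auto
  then show ?thesis using assms by (simp add: Lq_norm_haarC dlog_mult_pow2 power_add)
qed

text \<open>The triangle inequality on finite sections, then Fatou. The bound is uniform in
  \<open>n\<close> because the factor coming from the level of \<open>n\<close> is at most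
  1.\<close>

lemma Lq_chaos:
  assumes q: "q \<ge> 1" and n: "n \<ge> 1" and y: "summable (\<lambda>k. norm (y k) * (2 powr (-1/q)) ^ k)"
  shows "Lq q (chaos y n)"
    and "Lq_norm q (chaos y n) \<le> (\<Sum>k. norm (y k) * (2 powr (-1/q)) ^ k)"
proof -
  have L: "Lq q (\<lambda>t. \<Sum>k<K. y k * haarC (2 ^ k * n) t)" for K
    using q n by (intro Lq_sum Lq_cmult Lq_haarC) auto
  have B: "Lq_norm q (\<lambda>t. \<Sum>k<K. y k * haarC (2 ^ k * n) t) \<le> (\<Sum>k. norm (y k) * (2 powr (-1/q)) ^ k)" for K
  proof -
    have "Lq_norm q (\<lambda>t. \<Sum>k<K. y k * haarC (2 ^ k * n) t) \<le> (\<Sum>k<K. Lq_norm q (\<lambda>t. y k * haarC (2 ^ k * n) t))"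
      using q n by (intro Lq_norm_sum Lq_cmult Lq_haarC) auto
    also have "\<dots> \<le> (\<Sum>k<K. norm (y k) * (2 powr (-1/q)) ^ k)"
    proof (rule sum_mono)
      fix k
      have "Lq_norm q (\<lambda>t. y k * haarC (2 ^ k * n) t) = norm (y k) * Lq_norm q (haarC (2 ^ k * n))"
        using q by (intro Lq_norm_cmult) auto
      also have "\<dots> \<le> norm (y k) * (2 powr (-1/q)) ^ k"
        using q n by (intro mult_left_mono Lq_norm_haarC_chain_le) auto
      finally show "Lq_norm q (\<lambda>t. y k * haarC (2 ^ k * n) t) \<le> norm (y k) * (2 powr (-1/q)) ^ k" .
    qed
    also have "\<dots> \<le> (\<Sum>k. norm (y k) * (2 powr (-1/q)) ^ k)"
      by (rule sum_le_suminf[OF y]) auto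
    finally show ?thesis .
  qed
  have lim: "(\<lambda>K. \<Sum>k<K. y k * haarC (2 ^ k * n) t) \<longlonglongrightarrow> chaos y n t" for t
    using chaos_sums[OF n] by (simp add: sums_def)
  note R = Lq_limit[where F="\<lambda>K t. \<Sum>k<K. y k * haarC (2 ^ k * n) t", OF _ L lim B]
  show "Lq q (chaos y n)" "Lq_norm q (chaos y n) \<le> (\<Sum>k. norm (y k) * (2 powr (-1/q)) ^ k)"
    using R q by auto
qed

lemma chaos_truncate:
  assumes "n \<ge> 1"
  shows "chaos y n t - (\<Sum>k<K. y k * haarC (2 ^ k * n) t) = chaos (\<lambda>k. if k < K then 0 else y k) n t"
proof -
  have "(\<lambda>k. y k * haarC (2 ^ k * n) t - (if k \<in> {..<K} then y k * haarC (2 ^ k * n) t else 0)) sums 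
      (chaos y n t - (\<Sum>k<K. y k * haarC (2 ^ k * n) t))"
    by (intro sums_diff chaos_sums assms sums_If_finite_set) auto
  also have "(\<lambda>k. y k * haarC (2 ^ k * n) t - (if k \<in> {..<K} then y k * haarC (2 ^ k * n) t else 0))
      = (\<lambda>k. (if k < K then 0 else y k) * haarC (2 ^ k * n) t)" by auto
  finally show ?thesis unfolding chaos_def[of "\<lambda>k. if k < K then 0 else y k"] by (simp add: sums_iff)
qed

lemma suminf_tail_tendsto_0:
  fixes a :: "nat \<Rightarrow> real"
  assumes "summable a"
  shows "(\<lambda>K. \<Sum>k. if k < K then 0 else a k) \<longlonglongrightarrow> 0"
proof -
  have "(\<Sum>k. if k < K then 0 else a k) = suminf a - (\<Sum>k<K. a k)" for K
  proof -
    have "(\<lambda>k. a k - (if k \<in> {..<K} then a k else 0)) sums (suminf a - (\<Sum>k<K. a k))"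
      by (intro sums_diff summable_sums assms sums_If_finite_set) auto
    also have "(\<lambda>k. a k - (if k \<in> {..<K} then a k else 0)) = (\<lambda>k. if k < K then 0 else a k)" by auto
    finally show ?thesis by (simp add: sums_iff)
  qed
  moreover have "(\<lambda>K. suminf a - (\<Sum>k<K. a k)) \<longlonglongrightarrow> suminf a - suminf a"
    by (intro tendsto_diff tendsto_const summable_LIMSEQ assms)
  ultimately show ?thesis by simp
qed

lemma chaos_truncate_tendsto:
  assumes q: "q \<ge> 1" and n: "n \<ge> 1" and y: "summable (\<lambda>k. norm (y k) * (2 powr (-1/q)) ^ k)"
  shows "(\<lambda>K. Lq_norm q (\<lambda>t. chaos y n t - (\<Sum>k<K. y k * haarC (2 ^ k * n) t))) \<longlonglongrightarrow> 0"
proof (rule tendsto_sandwich[OF _ _ tendsto_const suminf_tail_tendsto_0[OF y]])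
  have "Lq_norm q (\<lambda>t. chaos y n t - (\<Sum>k<K. y k * haarC (2 ^ k * n) t)) \<le> 
      (\<Sum>k. if k < K then 0 else norm (y k) * (2 powr (-1/q)) ^ k)" for K
  proof -
    have e: "(\<lambda>k. norm (if k < K then 0 else y k) * (2 powr (-1/q)) ^ k) = (\<lambda>k. if k < K then 0 else norm (y k) * (2 powr (-1/q)) ^ k)"
      by auto
    have "summable (\<lambda>k. norm (if k < K then 0 else y k) * (2 powr (-1/q)) ^ k)"
      by (rule summable_comparison_test'[OF y]) auto
    from Lq_chaos(2)[OF q n this] show ?thesis unfolding chaos_truncate[OF n] e .
  qed
  then show "\<forall>\<^sub>F K in sequentially. Lq_norm q (\<lambda>t. chaos y n t - (\<Sum>k<K. y k * haarC (2 ^ k * n) t)) \<le> 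
      (\<Sum>k. if k < K then 0 else norm (y k) * (2 powr (-1/q)) ^ k)" by simp
qed simp

section \<open>Pairing with bounded functions\<close>

lemma Lq_pairing_le:
  assumes q: "q > 1" and f: "Lq q f" and u: "u \<in> borel_measurable MI" "\<And>t. norm (u t) \<le> B"
  shows "integrable MI (\<lambda>t. f t * u t)" and "norm (integral\<^sup>L MI (\<lambda>t. f t * u t)) \<le> B * Lq_norm q f"
proof -
  note [measurable] = u(1)
  have [measurable]: "f \<in> borel_measurable MI" using f by (auto simp: Lq_def)
  have le: "norm (f t * u t) powr q \<le> (B * norm (f t)) powr q" for t
    using mult_right_mono[OF u(2)[of t], of "norm (f t)"] q
    by (intro powr_mono2) (auto simp: norm_mult mult.commute)
  have B: "B \<ge> 0" using u(2) norm_ge_zero order_trans by blast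
  have i: "integrable MI (\<lambda>t. (B * norm (f t)) powr q)"
    using f B by (auto simp: Lq_def powr_mult)
  have "integrable MI (\<lambda>t. norm (f t * u t) powr q)"
    by (rule Bochner_Integration.integrable_bound[OF i]) (use le in auto)
  then have L: "Lq q (\<lambda>t. f t * u t)" by (simp add: Lq_def)
  show "integrable MI (\<lambda>t. f t * u t)" by (rule Lq_integrable(1)[OF q L])
  have "norm (integral\<^sup>L MI (\<lambda>t. f t * u t)) \<le> Lq_norm q (\<lambda>t. f t * u t)" by (rule Lq_integrable(2)[OF q L])
  also have "\<dots> \<le> Lq_norm q (\<lambda>t. of_real B * f t)"
  proof (rule Lq_norm_mono)
    show "norm (f t * u t) \<le> norm (of_real B * f t)" for t
      using mult_right_mono[OF u(2)[of t], of "norm (f t)"] B by (simp add: norm_mult mult.commute)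
  qed (use q f in \<open>auto intro: Lq_cmult\<close>)
  also have "\<dots> = B * Lq_norm q f" using q B by (subst Lq_norm_cmult) auto
  finally show "norm (integral\<^sup>L MI (\<lambda>t. f t * u t)) \<le> B * Lq_norm q f" .
qed

lemma Lq_pairing_tendsto:
  assumes q: "q > 1" and f: "Lq q f" "\<And>N. Lq q (F N)" and u: "u \<in> borel_measurable MI" "\<And>t. norm (u t) \<le> B"
    and lim: "(\<lambda>N. Lq_norm q (\<lambda>t. f t - F N t)) \<longlonglongrightarrow> 0"
  shows "(\<lambda>N. integral\<^sup>L MI (\<lambda>t. F N t * u t)) \<longlonglongrightarrow> integral\<^sup>L MI (\<lambda>t. f t * u t)"
proof -
  have "(\<lambda>N. integral\<^sup>L MI (\<lambda>t. f t * u t) - integral\<^sup>L MI (\<lambda>t. F N t * u t)) \<longlonglongrightarrow> 0"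
  proof (rule Lim_null_comparison)
    show "\<forall>\<^sub>F N in sequentially. norm (integral\<^sup>L MI (\<lambda>t. f t * u t) - integral\<^sup>L MI (\<lambda>t. F N t * u t)) \<le> B * Lq_norm q (\<lambda>t. f t - F N t)"
    proof (rule always_eventually, rule allI)
      fix N
      have "integral\<^sup>L MI (\<lambda>t. f t * u t) - integral\<^sup>L MI (\<lambda>t. F N t * u t) = integral\<^sup>L MI (\<lambda>t. (f t - F N t) * u t)"
        unfolding left_diff_distrib
        by (rule Bochner_Integration.integral_diff[symmetric, OF Lq_pairing_le(1)[OF q f(1) u] Lq_pairing_le(1)[OF q f(2) u]])
      then show "norm (integral\<^sup>L MI (\<lambda>t. f t * u t) - integral\<^sup>L MI (\<lambda>t. F N t * u t)) \<le> B * Lq_norm q (\<lambda>t. f t - F N t)"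
        using Lq_pairing_le(2)[OF q Lq_diff[OF _ f(1) f(2)[of N]] u] q by simp
    qed
    show "(\<lambda>N. B * Lq_norm q (\<lambda>t. f t - F N t)) \<longlonglongrightarrow> 0"
      using tendsto_mult_right[OF lim, of B] by (simp add: mult.commute)
  qed
  then have "(\<lambda>N. integral\<^sup>L MI (\<lambda>t. f t * u t) - (integral\<^sup>L MI (\<lambda>t. f t * u t) - integral\<^sup>L MI (\<lambda>t. F N t * u t))) \<longlonglongrightarrow> integral\<^sup>L MI (\<lambda>t. f t * u t) - 0"
    by (intro tendsto_diff tendsto_const)
  then show ?thesis by simp
qed

lemma integral_haarC_haarC:
  assumes "m \<ge> 1" "n \<ge> 1"
  shows "integral\<^sup>L MI (\<lambda>t. haarC m t * haarC n t) = (if m = n then 1 / 2 ^ dlog n else 0)"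
  unfolding of_real_mult[symmetric] integral_complex_of_real integral_haar_haar[OF assms] by simp

text \<open>By orthogonality only a \<open>k\<close> with \<open>2^k * n = m\<close> contributes.
  There is at most one, and it satisfies \<open>k < 2^k \<le> m\<close>; summing a conditional over
  \<open>k < m\<close> avoids naming it.\<close>

lemma integral_chaos_haar:
  assumes q: "q > 1" and n: "n \<ge> 1" and y: "summable (\<lambda>k. norm (y k) * (2 powr (-1/q)) ^ k)" and m: "m \<ge> 1"
  shows "integral\<^sup>L MI (\<lambda>t. chaos y n t * haarC m t) = (\<Sum>k<m. if 2 ^ k * n = m then y k else 0) / 2 ^ dlog m"
proof -
  have L: "Lq q (\<lambda>t. \<Sum>k<K. y k * haarC (2 ^ k * n) t)" for K
    using q n by (intro Lq_sum Lq_cmult Lq_haarC) auto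
  have eq: "integral\<^sup>L MI (\<lambda>t. (\<Sum>k<K. y k * haarC (2 ^ k * n) t) * haarC m t) = (\<Sum>k<m. if 2 ^ k * n = m then y k else 0) / 2 ^ dlog m"
    if "K \<ge> m" for K
  proof -
    have i: "integrable MI (\<lambda>t. y k * haarC (2 ^ k * n) t * haarC m t)" for k
      by (rule Lq_pairing_le(1)[OF q Lq_cmult[OF Lq_haarC]]) (use q n norm_haarC_le[OF m] in auto)
    have "integral\<^sup>L MI (\<lambda>t. (\<Sum>k<K. y k * haarC (2 ^ k * n) t) * haarC m t)
        = (\<Sum>k<K. integral\<^sup>L MI (\<lambda>t. y k * haarC (2 ^ k * n) t * haarC m t))"
      unfolding sum_distrib_right by (rule Bochner_Integration.integral_sum) (rule i)
    also have "\<dots> = (\<Sum>k<K. if 2 ^ k * n = m then y k / 2 ^ dlog m else 0)"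
    proof (rule sum.cong)
      fix k
      have "integral\<^sup>L MI (\<lambda>t. y k * haarC (2 ^ k * n) t * haarC m t) = y k * integral\<^sup>L MI (\<lambda>t. haarC (2 ^ k * n) t * haarC m t)"
        unfolding mult.assoc by simp
      then show "integral\<^sup>L MI (\<lambda>t. y k * haarC (2 ^ k * n) t * haarC m t) = (if 2 ^ k * n = m then y k / 2 ^ dlog m else 0)"
        using integral_haarC_haarC[of "2^k*n" m] n m by auto
    qed simp
    also have "\<dots> = (\<Sum>k<m. if 2 ^ k * n = m then y k / 2 ^ dlog m else 0)"
    proof (rule sum.mono_neutral_right)
      show "\<forall>k\<in>{..<K} - {..<m}. (if 2 ^ k * n = m then y k / 2 ^ dlog m else 0) = 0"
      proof
        fix k assume k: "k \<in> {..<K} - {..<m}"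
        have "m < 2 ^ m" by (rule less_exp)
        also have "(2::nat) ^ m \<le> 2 ^ k" using k by (intro power_increasing) auto
        also have "\<dots> \<le> 2 ^ k * n" using n by simp
        finally show "(if 2 ^ k * n = m then y k / 2 ^ dlog m else 0) = 0" by simp
      qed
    qed (use that in auto)
    also have "\<dots> = (\<Sum>k<m. if 2 ^ k * n = m then y k else 0) / 2 ^ dlog m"
      unfolding sum_divide_distrib by (intro sum.cong) auto
    finally show ?thesis .
  qed
  have "(\<lambda>K. integral\<^sup>L MI (\<lambda>t. (\<Sum>k<K. y k * haarC (2 ^ k * n) t) * haarC m t)) \<longlonglongrightarrow> integral\<^sup>L MI (\<lambda>t. chaos y n t * haarC m t)"
    by (rule Lq_pairing_tendsto[OF q _ L haarC_measurable, where B=1])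
       (use q n m y norm_haarC_le in \<open>auto intro!: Lq_chaos chaos_truncate_tendsto\<close>)
  moreover have "(\<lambda>K. integral\<^sup>L MI (\<lambda>t. (\<Sum>k<K. y k * haarC (2 ^ k * n) t) * haarC m t)) \<longlonglongrightarrow> (\<Sum>k<m. if 2 ^ k * n = m then y k else 0) / 2 ^ dlog m"
    by (rule tendsto_eventually, rule eventually_mono[OF eventually_ge_at_top[of m]], rule eq)
  ultimately show ?thesis by (rule LIMSEQ_unique)
qed

lemma Lq0_chaos:
  assumes q: "q > 1" and n: "n \<ge> 1" and y: "summable (\<lambda>k. norm (y k) * (2 powr (-1/q)) ^ k)"
  shows "Lq0 q (chaos y n)"
proof -
  have L: "Lq q (\<lambda>t. \<Sum>k<K. y k * haarC (2 ^ k * n) t)" for K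
    using q n by (intro Lq_sum Lq_cmult Lq_haarC) auto
  have i: "integrable MI (haarC k)" if "k \<ge> 1" for k
    using Lq_integrable(1)[OF q Lq_haarC] q that by simp
  \<comment> \<open>The redundant factor \<open>1\<close> presents the mean value as a pairing with
    a bounded function, so that it passes to the limit.\<close>
  have z: "integral\<^sup>L MI (\<lambda>t. (\<Sum>k<K. y k * haarC (2 ^ k * n) t) * 1) = 0" for K
  proof -
    have "integral\<^sup>L MI (\<lambda>t. (\<Sum>k<K. y k * haarC (2 ^ k * n) t) * 1) = (\<Sum>k<K. integral\<^sup>L MI (\<lambda>t. y k * haarC (2 ^ k * n) t))"
      using i n by (subst Bochner_Integration.integral_sum[symmetric]) auto
    also have "\<dots> = 0" using n integral_haar by (intro sum.neutral) (auto simp: integral_complex_of_real)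
    finally show ?thesis .
  qed
  have "(\<lambda>K. integral\<^sup>L MI (\<lambda>t. (\<Sum>k<K. y k * haarC (2 ^ k * n) t) * 1)) \<longlonglongrightarrow> integral\<^sup>L MI (\<lambda>t. chaos y n t * 1)"
    by (rule Lq_pairing_tendsto[OF q _ L, where B=1])
       (use q n y in \<open>auto intro!: Lq_chaos chaos_truncate_tendsto\<close>)
  then have "integral\<^sup>L MI (chaos y n) = 0" unfolding z by (simp add: LIMSEQ_const_iff)
  then show ?thesis using Lq_chaos(1)[OF _ n y] q by (simp add: Lq0_def)
qed

subsection \<open>The basis property\<close>

text \<open>The coefficients of \<open>\<Sum>m. d m V^m\<close> applied to \<open>\<Sum>n. u n h_n\<close>, where \<open>V h_n = h_(2n)\<close>.\<close>

definition dconv :: "(nat \<Rightarrow> complex) \<Rightarrow> (nat \<Rightarrow> complex) \<Rightarrow> nat \<Rightarrow> complex" where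
  "dconv d u n = (\<Sum>m\<le>dlog n. if 2 ^ m dvd n then d m * u (n div 2 ^ m) else 0)"

lemma pow2_dvd_le_dlog: "2 ^ m dvd n \<Longrightarrow> n \<ge> 1 \<Longrightarrow> m \<le> dlog n"
  using dlog_mult_pow2[of "n div 2 ^ m" m] by (auto elim!: dvdE)

lemma less_pow2_dlog: "n \<ge> 1 \<Longrightarrow> dlog n < n"
  using dlog_bounds(1)[of n] less_exp[of "dlog n"] by linarith

lemma dconv_range:
  assumes "n \<ge> 1" "finite M" "{..dlog n} \<subseteq> M"
  shows "dconv d u n = (\<Sum>m\<in>M. if 2 ^ m dvd n then d m * u (n div 2 ^ m) else 0)"
  unfolding dconv_def
  by (rule sum.mono_neutral_left) (use assms pow2_dvd_le_dlog in auto)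

lemma dconv_cong:
  assumes "n \<ge> 1" "\<And>k. k \<ge> 1 \<Longrightarrow> u k = v k"
  shows "dconv d u n = dconv d v n"
proof -
  have "n div 2 ^ m \<ge> 1" if "2 ^ m dvd n" for m using that assms(1) by (auto elim!: dvdE)
  then show ?thesis unfolding dconv_def by (intro sum.cong) (auto simp: assms(2))
qed

text \<open>The sequence of positive integers splits into the chains \<open>b, 2b, 4b, ...\<close>
  with \<open>b\<close> odd. On each of them \<open>dconv d\<close> is an ordinary Cauchy product
  with \<open>d\<close>.\<close>

lemma dconv_chain:
  assumes "odd b"
  shows "dconv d u (2 ^ v * b) = (\<Sum>m\<le>v. d m * u (2 ^ (v - m) * b))"
proof -
  have b: "b \<ge> 1" using assms by (cases b) auto
  have dv: "2 ^ m dvd 2 ^ v * b \<longleftrightarrow> m \<le> v" for m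
  proof
    assume "2 ^ m dvd 2 ^ v * b"
    moreover have "coprime (2 ^ m) b" using assms by simp
    ultimately have "2 ^ m dvd (2::nat) ^ v" by (simp add: coprime_dvd_mult_left_iff)
    then show "m \<le> v" by (simp add: dvd_power_iff_le)
  qed (simp add: le_imp_power_dvd dvd_mult2)
  have "dconv d u (2 ^ v * b) = (\<Sum>m\<le>dlog (2 ^ v * b). if m \<le> v then d m * u (2 ^ (v - m) * b) else 0)"
    unfolding dconv_def dv
  proof (rule sum.cong)
    fix m
    have "2 ^ v * b div 2 ^ m = 2 ^ (v - m) * b" if "m \<le> v"
    proof -
      have p: "(2::nat) ^ v = 2 ^ m * 2 ^ (v - m)" using that by (simp flip: power_add)
      show ?thesis unfolding p by (simp add: mult.assoc)
    qed
    then show "(if m \<le> v then d m * u (2 ^ v * b div 2 ^ m) else 0) = (if m \<le> v then d m * u (2 ^ (v - m) * b) else 0)"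
      by simp
  qed simp
  also have "\<dots> = (\<Sum>m\<le>v. if m \<le> v then d m * u (2 ^ (v - m) * b) else 0)"
    using b by (intro sum.mono_neutral_right) (auto simp: dlog_mult_pow2)
  finally show ?thesis by simp
qed

lemma pow2_times_odd:
  assumes "n \<ge> 1" obtains v b where "n = 2 ^ v * b" "odd (b::nat)"
  using assms
proof (induction n arbitrary: thesis rule: less_induct)
  case (less n)
  show ?case
  proof (cases "odd n")
    case True
    then show ?thesis using less.prems(1)[of 0 n] by simp
  next
    case False
    then obtain k where k: "n = 2 * k" by (auto elim: evenE)
    then obtain v b where "k = 2 ^ v * b" "odd b" using less.IH[of k] less.prems(2) by auto
    then show ?thesis using less.prems(1)[of "Suc v" b] k by simp
  qed
qed

text \<open>Chain by chain this is multiplication of formal power series, so no convergence is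
  involved and \<open>u\<close> may be any sequence.\<close>

lemma dconv_inverse:
  assumes inv: "Abs_fps c * Abs_fps d = 1" and n: "n \<ge> 1"
  shows "dconv c (dconv d u) n = u n"
proof -
  obtain v b where vb: "n = 2 ^ v * b" "odd b" using pow2_times_odd[OF n] .
  define U where "U = Abs_fps (\<lambda>j. u (2 ^ j * b))"
  have 1: "dconv d u (2 ^ j * b) = fps_nth (Abs_fps d * U) j" for j
    by (simp add: dconv_chain[OF vb(2)] fps_mult_nth U_def atMost_atLeast0)
  have "dconv c (dconv d u) n = fps_nth (Abs_fps c * (Abs_fps d * U)) v"
    unfolding vb(1) dconv_chain[OF vb(2), of c] 1 by (simp add: fps_mult_nth[of "Abs_fps c"] atMost_atLeast0)
  also have "\<dots> = u n" by (simp add: mult.assoc[symmetric] inv U_def vb(1))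
  finally show ?thesis .
qed

section \<open>Estimates level by level\<close>

definition lev :: "nat \<Rightarrow> nat set" where
  "lev i = {2 ^ i ..< 2 * 2 ^ i}"

lemma lev_iff: "n \<in> lev i \<longleftrightarrow> n \<ge> 1 \<and> dlog n = i"
proof -
  have "n \<in> lev i \<Longrightarrow> n \<ge> 1" unfolding lev_def using one_le_power[of "2::nat" i] by (simp del: one_le_power)
  then show ?thesis using dlog_eq_iff[of n i] by (auto simp: lev_def)
qed

lemma finite_lev [simp]: "finite (lev i)" by (simp add: lev_def)

lemma sum_multiples_reindex:
  fixes G :: "nat \<Rightarrow> 'a::comm_monoid_add"
  assumes "finite A"
  shows "(\<Sum>k\<in>A. if 2 ^ m dvd k then G (k div 2 ^ m) else 0) = (\<Sum>n\<in>{n. 2 ^ m * n \<in> A}. G n)"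
proof -
  have "(\<Sum>k\<in>A. if 2 ^ m dvd k then G (k div 2 ^ m) else 0) = (\<Sum>k\<in>{k\<in>A. 2 ^ m dvd k}. G (k div 2 ^ m))"
    using assms by (intro sum.mono_neutral_cong_right) auto
  also have "\<dots> = (\<Sum>n\<in>{n. 2 ^ m * n \<in> A}. G n)"
    by (rule sum.reindex_bij_witness[of _ "\<lambda>n. 2 ^ m * n" "\<lambda>k. k div 2 ^ m"]) auto
  finally show ?thesis .
qed

text \<open>\<open>V^m\<close> raises levels by \<open>m\<close>, so what it puts on level
  \<open>i\<close> comes from level \<open>i - m\<close> of \<open>u\<close>.\<close>

lemma dconv_level_sum:
  "(\<Sum>n\<in>lev i. dconv d u n * haarC n t) = (\<Sum>m\<le>i. d m * (\<Sum>n\<in>lev (i - m). u n * haarC (2 ^ m * n) t))"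
proof -
  have "(\<Sum>n\<in>lev i. dconv d u n * haarC n t) = 
      (\<Sum>n\<in>lev i. \<Sum>m\<le>i. if 2 ^ m dvd n then d m * u (n div 2 ^ m) * haarC (2 ^ m * (n div 2 ^ m)) t else 0)"
  proof (rule sum.cong)
    fix n assume n: "n \<in> lev i"
    then show "dconv d u n * haarC n t = (\<Sum>m\<le>i. if 2 ^ m dvd n then d m * u (n div 2 ^ m) * haarC (2 ^ m * (n div 2 ^ m)) t else 0)"
      unfolding dconv_def sum_distrib_right lev_iff by (intro sum.cong) auto
  qed simp
  also have "\<dots> = (\<Sum>m\<le>i. \<Sum>n\<in>lev i. if 2 ^ m dvd n then d m * u (n div 2 ^ m) * haarC (2 ^ m * (n div 2 ^ m)) t else 0)"
    by (rule sum.swap)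
  also have "\<dots> = (\<Sum>m\<le>i. d m * (\<Sum>n\<in>lev (i - m). u n * haarC (2 ^ m * n) t))"
  proof (rule sum.cong)
    fix m assume m: "m \<in> {..i}"
    have "{n. 2 ^ m * n \<in> lev i} = lev (i - m)"
    proof (rule set_eqI)
      fix n
      show "n \<in> {n. 2 ^ m * n \<in> lev i} \<longleftrightarrow> n \<in> lev (i - m)"
        using dlog_mult_pow2[of n m] m by (cases "n = 0") (auto simp: lev_iff)
    qed
    then show "(\<Sum>n\<in>lev i. if 2 ^ m dvd n then d m * u (n div 2 ^ m) * haarC (2 ^ m * (n div 2 ^ m)) t else 0) = 
        d m * (\<Sum>n\<in>lev (i - m). u n * haarC (2 ^ m * n) t)"
      unfolding sum_multiples_reindex[OF finite_lev, of m "\<lambda>n. d m * u n * haarC (2 ^ m * n) t" i] sum_distrib_left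
      by (simp add: mult.assoc)
  qed simp
  finally show ?thesis .
qed

definition lnorm :: "real \<Rightarrow> (nat \<Rightarrow> complex) \<Rightarrow> nat \<Rightarrow> real" where
  "lnorm q a i = Lq_norm q (\<lambda>t. \<Sum>n\<in>lev i. a n * haarC n t)"

lemma lnorm_nonneg [simp]: "0 \<le> lnorm q a i" by (simp add: lnorm_def)

text \<open>Supports within a level are disjoint, so the norm is a weighted \<open>l^q\<close> norm
  of the coefficients: dropping indices cannot increase it, and \<open>V^m\<close> contributes the
  factor \<open>2^(-m/q)\<close>. Subsets of a level are needed because the cut at \<open>N\<close>
  does not respect levels.\<close>

lemma Lq_norm_level_le:
  assumes q: "q > 0" and E: "E \<subseteq> lev i"
  shows "Lq_norm q (\<lambda>t. \<Sum>n\<in>E. a n * haarC (2 ^ m * n) t) \<le> (2 powr (-1/q)) ^ m * lnorm q a i"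
proof -
  have fin: "finite E" by (rule finite_subset[OF E finite_lev])
  have "Lq_norm q (\<lambda>t. \<Sum>n\<in>E. a n * haarC (2 ^ m * n) t) = (1 / 2 ^ (m + i) * (\<Sum>n\<in>E. norm (a n) powr q)) powr (1 / q)"
    by (rule Lq_norm_level[OF q]) (use E fin in \<open>auto simp: lev_iff subset_eq\<close>)
  also have "\<dots> \<le> (1 / 2 ^ m * (1 / 2 ^ (0 + i) * (\<Sum>n\<in>lev i. norm (a n) powr q))) powr (1 / q)"
    using q E by (intro powr_mono2) (auto simp: power_add intro!: divide_right_mono divide_nonneg_nonneg sum_mono2 sum_nonneg)
  also have "\<dots> = (1 / 2 ^ m) powr (1/q) * (1 / 2 ^ (0 + i) * (\<Sum>n\<in>lev i. norm (a n) powr q)) powr (1 / q)"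
    by (rule powr_mult)
  also have "(1 / 2 ^ (0 + i) * (\<Sum>n\<in>lev i. norm (a n) powr q)) powr (1 / q) = lnorm q a i"
    unfolding lnorm_def using Lq_norm_level[OF q, of "lev i" i a 0] by (simp add: lev_iff)
  finally show ?thesis by (simp only: half_powr_power)
qed

lemma lnorm_dconv_le:
  assumes q: "q \<ge> 1"
  shows "lnorm q (dconv d u) i \<le> (\<Sum>m\<le>i. norm (d m) * (2 powr (-1/q)) ^ m * lnorm q u (i - m))"
proof -
  have L: "Lq q (\<lambda>t. d m * (\<Sum>n\<in>lev (i - m). u n * haarC (2 ^ m * n) t))" for m
    using q by (intro Lq_cmult Lq_sum Lq_haarC) (auto simp: lev_iff)
  have "lnorm q (dconv d u) i \<le> (\<Sum>m\<le>i. Lq_norm q (\<lambda>t. d m * (\<Sum>n\<in>lev (i - m). u n * haarC (2 ^ m * n) t)))"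
    unfolding lnorm_def dconv_level_sum by (rule Lq_norm_sum[OF q L])
  also have "\<dots> \<le> (\<Sum>m\<le>i. norm (d m) * (2 powr (-1/q)) ^ m * lnorm q u (i - m))"
  proof (rule sum_mono)
    fix m
    have "Lq_norm q (\<lambda>t. d m * (\<Sum>n\<in>lev (i - m). u n * haarC (2 ^ m * n) t)) = norm (d m) * Lq_norm q (\<lambda>t. \<Sum>n\<in>lev (i - m). u n * haarC (2 ^ m * n) t)"
      using q by (intro Lq_norm_cmult) auto
    also have "\<dots> \<le> norm (d m) * ((2 powr (-1/q)) ^ m * lnorm q u (i - m))"
      using q by (intro mult_left_mono Lq_norm_level_le) auto
    finally show "Lq_norm q (\<lambda>t. d m * (\<Sum>n\<in>lev (i - m). u n * haarC (2 ^ m * n) t)) \<le> norm (d m) * (2 powr (-1/q)) ^ m * lnorm q u (i - m)"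
      by (simp add: mult.assoc)
  qed
  finally show ?thesis .
qed

text \<open>Tannery's theorem: each term tends to zero, and \<open>w m\<close> times a bound of
  \<open>\<mu>\<close> dominates.\<close>

lemma convolution_tendsto_0:
  fixes w \<mu> :: "nat \<Rightarrow> real"
  assumes w: "summable w" "\<And>m. w m \<ge> 0" and \<mu>: "\<mu> \<longlonglongrightarrow> 0"
  shows "(\<lambda>i. \<Sum>m\<le>i. w m * \<mu> (i - m)) \<longlonglongrightarrow> 0"
proof -
  obtain B where B: "\<And>i. norm (\<mu> i) \<le> B"
    using convergent_imp_bounded[OF \<mu>] by (auto simp: bounded_iff)
  let ?a = "\<lambda>m i. if m \<le> i then w m * \<mu> (i - m) else 0"
  have "(\<lambda>i. suminf (\<lambda>m. ?a m i)) \<longlonglongrightarrow> suminf (\<lambda>m. 0::real)"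
  proof (rule tannerys_theorem[THEN conjunct2, THEN conjunct2])
    fix m
    have "(\<lambda>i. w m * \<mu> (i - m)) \<longlonglongrightarrow> w m * 0"
      using \<mu> by (intro tendsto_mult tendsto_const) (rule LIMSEQ_offset[of _ m], simp)
    then have l: "(\<lambda>i. w m * \<mu> (i - m)) \<longlonglongrightarrow> 0" by simp
    show "((\<lambda>i. ?a m i) \<longlongrightarrow> 0) sequentially"
      by (rule Lim_transform_eventually[OF l], rule eventually_mono[OF eventually_ge_at_top[of m]]) simp
  next
    have "norm (?a m i) \<le> w m * B" for m i
      using B[of "i - m"] B[of 0] norm_ge_zero[of "\<mu> 0"] w(2)[of m]
      by (auto simp: abs_mult intro!: mult_left_mono mult_nonneg_nonneg)
    then show "eventually (\<lambda>(m, i). norm (?a m i) \<le> w m * B) (at_top \<times>\<^sub>F sequentially)"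
      by (intro always_eventually) auto
  qed (use w in \<open>auto intro: summable_mult2\<close>)
  moreover have "suminf (\<lambda>m. ?a m i) = (\<Sum>m\<le>i. w m * \<mu> (i - m))" for i
    by (subst suminf_finite[of "{..i}"]) auto
  ultimately show ?thesis by simp
qed

text \<open>Tannery's theorem again. The window \<open>{K-m..K}\<close> has at most
  \<open>Suc m\<close> elements, which explains the stronger summability hypothesis on
  \<open>w\<close>; for \<open>K < m\<close> truncated subtraction lets it start at 0.\<close>

lemma window_tendsto_0:
  fixes w \<alpha> :: "nat \<Rightarrow> real"
  assumes w: "summable (\<lambda>m. w m * real (Suc m))" "\<And>m. w m \<ge> 0" and \<alpha>: "\<alpha> \<longlonglongrightarrow> 0" "\<And>i. \<alpha> i \<ge> 0"
  shows "(\<lambda>K. \<Sum>m. w m * (\<Sum>i\<in>{K-m..K}. \<alpha> i)) \<longlonglongrightarrow> 0"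
    and "summable (\<lambda>m. w m * (\<Sum>i\<in>{K-m..K}. \<alpha> i))"
proof -
  obtain B where B: "\<And>i. norm (\<alpha> i) \<le> B"
    using convergent_imp_bounded[OF \<alpha>(1)] by (auto simp: bounded_iff)
  let ?a = "\<lambda>m K. w m * (\<Sum>i\<in>{K-m..K}. \<alpha> i)"
  have B0: "B \<ge> 0" using B[of 0] norm_ge_zero order_trans by blast
  have bd: "norm (?a m K) \<le> w m * real (Suc m) * B" for m K
  proof -
    have "(\<Sum>i\<in>{K-m..K}. \<alpha> i) \<le> (\<Sum>i\<in>{K-m..K}. B)"
      using B by (intro sum_mono) (use abs_le_D1 in auto)
    also have "\<dots> = real (card {K-m..K}) * B" by simp
    also have "\<dots> \<le> real (Suc m) * B" using B0 by (intro mult_right_mono) auto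
    finally have "w m * (\<Sum>i\<in>{K-m..K}. \<alpha> i) \<le> w m * (real (Suc m) * B)" by (rule mult_left_mono[OF _ w(2)])
    then show ?thesis using w(2)[of m] \<alpha>(2) by (simp add: abs_mult sum_nonneg mult.assoc)
  qed
  have sM: "summable (\<lambda>m. w m * real (Suc m) * B)" by (rule summable_mult2[OF w(1)])
  show "summable (\<lambda>m. ?a m K)"
    by (rule summable_comparison_test'[OF sM]) (use bd in auto)
  have "(\<lambda>K. suminf (\<lambda>m. ?a m K)) \<longlonglongrightarrow> suminf (\<lambda>m. 0::real)"
  proof (rule tannerys_theorem[THEN conjunct2, THEN conjunct2])
    fix m
    have "(\<lambda>K. \<alpha> (K - j)) \<longlonglongrightarrow> 0" for j
      by (rule LIMSEQ_offset[of _ j]) (use \<alpha>(1) in simp)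
    then have "(\<lambda>K. \<Sum>j\<le>m. \<alpha> (K - j)) \<longlonglongrightarrow> (\<Sum>j\<le>m. 0)"
      by (intro tendsto_sum)
    then have l: "(\<lambda>K. w m * (\<Sum>j\<le>m. \<alpha> (K - j))) \<longlonglongrightarrow> w m * 0" 
      by (intro tendsto_mult tendsto_const) simp
    show "((\<lambda>K. ?a m K) \<longlongrightarrow> 0) sequentially"
    proof (rule tendsto_sandwich[OF _ _ tendsto_const l[unfolded mult_zero_right]])
      show "\<forall>\<^sub>F K in sequentially. 0 \<le> ?a m K" using w \<alpha> by (intro always_eventually) (auto intro!: mult_nonneg_nonneg sum_nonneg)
      have "(\<Sum>i\<in>{K-m..K}. \<alpha> i) \<le> (\<Sum>j\<le>m. \<alpha> (K - j))" if "K \<ge> m" for K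
        by (rule eq_refl, rule sum.reindex_bij_witness[of _ "\<lambda>j. K - j" "\<lambda>i. K - i"]) (use that in auto)
      then show "\<forall>\<^sub>F K in sequentially. ?a m K \<le> w m * (\<Sum>j\<le>m. \<alpha> (K - j))"
        by (intro eventually_mono[OF eventually_ge_at_top[of m]] mult_left_mono w(2))
    qed
  next
    show "eventually (\<lambda>(m, K). norm (?a m K) \<le> w m * real (Suc m) * B) (at_top \<times>\<^sub>F sequentially)"
      using bd by (intro always_eventually) auto
  qed (use sM in auto)
  then show "(\<lambda>K. \<Sum>m. ?a m K) \<longlonglongrightarrow> 0" by simp
qed

text \<open>A level is the difference of the partial sums at \<open>2^i\<close> and
  \<open>2^(i+1)\<close>, both of which approach \<open>g\<close>.\<close>

lemma lnorm_haar_coeff_tendsto_0: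
  assumes q: "q > 1" and g: "Lq0 q g"
  shows "(\<lambda>i. lnorm q (haar_coeff g) i) \<longlonglongrightarrow> 0"
proof -
  define P where "P N t = (\<Sum>n\<in>{1..<N}. haar_coeff g n * haarC n t)" for N t
  define e where "e N = Lq_norm q (\<lambda>t. g t - P N t)" for N
  have e0: "e \<longlonglongrightarrow> 0" unfolding e_def P_def by (rule haar_series_converges[OF q g])
  have LP: "Lq q (P N)" for N unfolding P_def using q by (intro Lq_sum Lq_cmult Lq_haarC) auto
  have Lg: "Lq q g" using g by (simp add: Lq0_def)
  have le: "lnorm q (haar_coeff g) i \<le> e (2 ^ i) + e (2 ^ Suc i)" for i
  proof -
    have "{1..<2 ^ Suc i} = {1..<2 ^ i} \<union> lev i" "{1..<2 ^ i} \<inter> lev i = {}" by (auto simp: lev_def)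
    then have "(\<Sum>n\<in>lev i. haar_coeff g n * haarC n t) = (g t - P (2 ^ i) t) - (g t - P (2 ^ Suc i) t)" for t
      unfolding P_def by (simp add: sum.union_disjoint)
    then have "lnorm q (haar_coeff g) i = Lq_norm q (\<lambda>t. (g t - P (2 ^ i) t) - (g t - P (2 ^ Suc i) t))"
      by (simp add: lnorm_def)
    also have "\<dots> \<le> e (2 ^ i) + e (2 ^ Suc i)"
      unfolding e_def using q by (intro Lq_norm_triangle_diff Lq_diff Lg LP) auto
    finally show ?thesis .
  qed
  have s: "strict_mono (\<lambda>i::nat. (2::nat) ^ i)" by (simp add: strict_mono_def)
  have e2: "(\<lambda>i. e (2 ^ i)) \<longlonglongrightarrow> 0" using LIMSEQ_subseq_LIMSEQ[OF e0 s] by (simp add: o_def)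
  have "(\<lambda>i. e (2 ^ i) + e (2 ^ Suc i)) \<longlonglongrightarrow> 0 + 0"
    by (rule tendsto_add[OF e2 LIMSEQ_Suc[OF e2]])
  then have l: "(\<lambda>i. e (2 ^ i) + e (2 ^ Suc i)) \<longlonglongrightarrow> 0" by simp
  show ?thesis
    by (rule tendsto_sandwich[OF always_eventually always_eventually tendsto_const l]) (use le in simp_all)
qed

text \<open>The partial sums of \<open>\<Sum>n. a n f_n\<close> and of its Haar expansion differ only in the terms \<open>h_(2^m n)\<close>
  with \<open>n < N \<le> 2^m n\<close>.\<close>

lemma partial_sum_diff_sums:
  assumes N: "N \<ge> 1"
  shows "(\<lambda>m. c m * (\<Sum>n\<in>{n\<in>{1..<N}. N \<le> 2 ^ m * n}. a n * haarC (2 ^ m * n) t)) sums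
    ((\<Sum>n\<in>{1..<N}. a n * chaos c n t) - (\<Sum>k\<in>{1..<N}. dconv c a k * haarC k t))"
proof -
  have 1: "(\<lambda>m. \<Sum>n\<in>{1..<N}. a n * (c m * haarC (2 ^ m * n) t)) sums (\<Sum>n\<in>{1..<N}. a n * chaos c n t)"
    by (intro sums_sum sums_mult chaos_sums) auto
  \<comment> \<open>The contribution of \<open>V^m\<close> to the Haar partial sum, that is, the
    terms with \<open>2^m * n < N\<close>. It vanishes for \<open>m \<ge> N\<close> because
    \<open>N < 2^N\<close>, so the sum over \<open>m < N\<close> is a complete series and can be
    subtracted termwise.\<close>
  define Q where "Q m = (\<Sum>n\<in>{n. 2 ^ m * n \<in> {1..<N}}. c m * a n * haarC (2 ^ m * n) t)" for m
  have "(\<Sum>k\<in>{1..<N}. dconv c a k * haarC k t) = 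
     (\<Sum>k\<in>{1..<N}. \<Sum>m<N. if 2 ^ m dvd k then c m * a (k div 2 ^ m) * haarC (2 ^ m * (k div 2 ^ m)) t else 0)"
  proof (rule sum.cong)
    fix k assume k: "k \<in> {1..<N}"
    have "dconv c a k = (\<Sum>m<N. if 2 ^ m dvd k then c m * a (k div 2 ^ m) else 0)"
      using less_pow2_dlog[of k] k by (intro dconv_range) auto
    then show "dconv c a k * haarC k t = (\<Sum>m<N. if 2 ^ m dvd k then c m * a (k div 2 ^ m) * haarC (2 ^ m * (k div 2 ^ m)) t else 0)"
      by (simp only: sum_distrib_right) (intro sum.cong, auto)
  qed simp
  also have "\<dots> = (\<Sum>m<N. \<Sum>k\<in>{1..<N}. if 2 ^ m dvd k then c m * a (k div 2 ^ m) * haarC (2 ^ m * (k div 2 ^ m)) t else 0)"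
    by (rule sum.swap)
  also have "\<dots> = (\<Sum>m<N. Q m)"
    unfolding Q_def by (intro sum.cong refl sum_multiples_reindex[of "{1..<N}" _ "\<lambda>n. c _ * a n * haarC (2 ^ _ * n) t"]) auto
  finally have P: "(\<Sum>k\<in>{1..<N}. dconv c a k * haarC k t) = (\<Sum>m<N. Q m)" .
  have "Q m = 0" if "m \<notin> {..<N}" for m
  proof -
    have "N < 2 ^ N" by (rule less_exp)
    also have "(2::nat) ^ N \<le> 2 ^ m" using that by (intro power_increasing) auto
    finally have h: "N \<le> 2 ^ m * n" if "n \<ge> 1" for n
      using that by (metis less_imp_le_nat mult.right_neutral mult_le_mono)
    have "2 ^ m * n \<notin> {1..<N}" for n
    proof (cases "n = 0")
      case False
      then have "N \<le> 2 ^ m * n" by (intro h) simp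
      then show ?thesis by (simp add: not_less)
    qed simp
    then have E: "{n. 2 ^ m * n \<in> {1..<N}} = {}" by blast
    show ?thesis unfolding Q_def E by simp
  qed
  then have 2: "Q sums (\<Sum>m<N. Q m)" by (intro sums_finite) auto
  have "(\<Sum>n\<in>{1..<N}. a n * (c m * haarC (2 ^ m * n) t)) - Q m = c m * (\<Sum>n\<in>{n\<in>{1..<N}. N \<le> 2 ^ m * n}. a n * haarC (2 ^ m * n) t)" for m
  proof -
    have "{n. 2 ^ m * n \<in> {1..<N}} = {n\<in>{1..<N}. 2 ^ m * n < N}"
    proof (rule set_eqI)
      fix n :: nat
      have "n \<le> 2 ^ m * n" by simp
      then show "n \<in> {n. 2 ^ m * n \<in> {1..<N}} \<longleftrightarrow> n \<in> {n\<in>{1..<N}. 2 ^ m * n < N}" 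
        unfolding mem_Collect_eq atLeastLessThan_iff by (cases "n = 0") (simp, linarith)
    qed
    moreover have "{1..<N} - {n\<in>{1..<N}. 2 ^ m * n < N} = {n\<in>{1..<N}. N \<le> 2 ^ m * n}" by auto
    moreover have "(\<Sum>n\<in>{1..<N}. a n * (c m * haarC (2 ^ m * n) t)) - (\<Sum>n\<in>{n\<in>{1..<N}. 2 ^ m * n < N}. a n * (c m * haarC (2 ^ m * n) t)) =
      (\<Sum>n\<in>{1..<N} - {n\<in>{1..<N}. 2 ^ m * n < N}. a n * (c m * haarC (2 ^ m * n) t))"
      by (rule sum_diff[symmetric]) auto
    ultimately show ?thesis unfolding Q_def by (simp add: sum_distrib_left mult_ac)
  qed
  then show ?thesis using sums_diff[OF 1 2] unfolding P by simp
qed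

text \<open>The condition \<open>n < N \<le> 2^m * n\<close> confines the level of \<open>n\<close>
  to the \<open>m + 1\<close> levels ending at that of \<open>N\<close>. Grouping by level and the
  one-level estimate give the bound.\<close>

lemma Lq_norm_window_le:
  assumes q: "q \<ge> 1" and N: "N \<ge> 1"
  shows "Lq_norm q (\<lambda>t. \<Sum>n\<in>{n\<in>{1..<N}. N \<le> 2 ^ m * n}. a n * haarC (2 ^ m * n) t)
    \<le> (2 powr (-1/q)) ^ m * (\<Sum>i\<in>{dlog N - m..dlog N}. lnorm q a i)"
proof -
  define E where "E = {n\<in>{1..<N}. N \<le> 2 ^ m * n}"
  define T where "T = {dlog N - m..dlog N}"
  have "dlog n \<in> T" if "n \<in> E" for n
  proof -
    have n: "n \<ge> 1" "n \<le> N" "N \<le> 2 ^ m * n" using that by (auto simp: E_def)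
    have "dlog N \<le> m + dlog n" using dlog_mono[OF N n(3)] n by (simp add: dlog_mult_pow2)
    then show ?thesis using dlog_mono[OF n(1,2)] by (auto simp: T_def)
  qed
  then have g: "(\<Sum>n\<in>E. a n * haarC (2 ^ m * n) t) = (\<Sum>i\<in>T. \<Sum>n\<in>{n\<in>E. dlog n = i}. a n * haarC (2 ^ m * n) t)" for t
    by (intro sum.group[symmetric]) (auto simp: E_def T_def)
  have E1: "n \<ge> 1" if "n \<in> E" for n using that by (auto simp: E_def)
  have "Lq_norm q (\<lambda>t. \<Sum>n\<in>E. a n * haarC (2 ^ m * n) t) \<le> (\<Sum>i\<in>T. Lq_norm q (\<lambda>t. \<Sum>n\<in>{n\<in>E. dlog n = i}. a n * haarC (2 ^ m * n) t))"
    unfolding g using q E1 by (intro Lq_norm_sum Lq_sum Lq_cmult Lq_haarC) auto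
  also have "\<dots> \<le> (\<Sum>i\<in>T. (2 powr (-1/q)) ^ m * lnorm q a i)"
    using q E1 by (intro sum_mono Lq_norm_level_le) (auto simp: lev_iff)
  finally show ?thesis unfolding E_def T_def sum_distrib_left .
qed

lemma Lq_norm_partial_sum_diff_le:
  assumes q: "q \<ge> 1" and N: "N \<ge> 1"
    and s: "summable (\<lambda>m. norm (c m) * (2 powr (-1/q)) ^ m * (\<Sum>i\<in>{dlog N - m..dlog N}. lnorm q a i))"
  shows "Lq_norm q (\<lambda>t. (\<Sum>n\<in>{1..<N}. a n * chaos c n t) - (\<Sum>k\<in>{1..<N}. dconv c a k * haarC k t))
    \<le> (\<Sum>m. norm (c m) * (2 powr (-1/q)) ^ m * (\<Sum>i\<in>{dlog N - m..dlog N}. lnorm q a i))"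
proof -
  define B where "B m t = (\<Sum>n\<in>{n\<in>{1..<N}. N \<le> 2 ^ m * n}. a n * haarC (2 ^ m * n) t)" for m t
  have LB: "Lq q (B m)" for m unfolding B_def using q by (intro Lq_sum Lq_cmult Lq_haarC) auto
  have L: "Lq q (\<lambda>t. \<Sum>m<M. c m * B m t)" for M using q by (intro Lq_sum Lq_cmult LB) auto
  have bd: "Lq_norm q (\<lambda>t. \<Sum>m<M. c m * B m t) \<le> (\<Sum>m. norm (c m) * (2 powr (-1/q)) ^ m * (\<Sum>i\<in>{dlog N - m..dlog N}. lnorm q a i))" for M
  proof -
    have "Lq_norm q (\<lambda>t. \<Sum>m<M. c m * B m t) \<le> (\<Sum>m<M. Lq_norm q (\<lambda>t. c m * B m t))"
      using q by (intro Lq_norm_sum Lq_cmult LB) auto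
    also have "\<dots> = (\<Sum>m<M. norm (c m) * Lq_norm q (B m))"
      using q by (intro sum.cong refl Lq_norm_cmult) auto
    also have "\<dots> \<le> (\<Sum>m<M. norm (c m) * ((2 powr (-1/q)) ^ m * (\<Sum>i\<in>{dlog N - m..dlog N}. lnorm q a i)))"
      unfolding B_def by (intro sum_mono mult_left_mono Lq_norm_window_le q N) auto
    also have "\<dots> \<le> (\<Sum>m. norm (c m) * (2 powr (-1/q)) ^ m * (\<Sum>i\<in>{dlog N - m..dlog N}. lnorm q a i))"
      unfolding mult.assoc[symmetric] by (rule sum_le_suminf[OF s]) (auto intro!: mult_nonneg_nonneg sum_nonneg)
    finally show ?thesis .
  qed
  have lim: "(\<lambda>M. \<Sum>m<M. c m * B m t) \<longlonglongrightarrow> (\<Sum>n\<in>{1..<N}. a n * chaos c n t) - (\<Sum>k\<in>{1..<N}. dconv c a k * haarC k t)" for t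
    using partial_sum_diff_sums[OF N, of c a t] unfolding sums_def B_def .
  show ?thesis
    by (rule Lq_limit(2)[where F="\<lambda>M t. \<Sum>m<M. c m * B m t", OF _ L lim bd]) (use q in auto)
qed

lemma summable_of_summable_mult_Suc:
  fixes w :: "nat \<Rightarrow> real"
  assumes "summable (\<lambda>m. w m * real (Suc m))" "\<And>m. w m \<ge> 0"
  shows "summable w"
proof (rule summable_comparison_test'[OF assms(1), of 0])
  fix m
  show "norm (w m) \<le> w m * real (Suc m)"
    using mult_left_mono[of 1 "real (Suc m)" "w m"] assms(2)[of m] by simp
qed

text \<open>The coefficients \<open>a\<close> satisfy \<open>dconv c a = haar_coeff g\<close>, so
  the partial sums of the new expansion are Haar partial sums of \<open>g\<close> plus boundary
  terms. The bound for the latter depends on \<open>N\<close> only through \<open>dlog N\<close> and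
  tends to zero because the level norms of \<open>a\<close> do.\<close>

lemma chaos_expansion_converges:
  assumes q: "q > 1" and g: "Lq0 q g" and inv: "Abs_fps c * Abs_fps d = 1"
    and sc: "summable (\<lambda>m. norm (c m) * (2 powr (-1/q)) ^ m * real (Suc m))"
    and sd: "summable (\<lambda>m. norm (d m) * (2 powr (-1/q)) ^ m)"
  shows "(\<lambda>N. Lq_norm q (\<lambda>t. g t - (\<Sum>n\<in>{1..<N}. dconv d (haar_coeff g) n * chaos c n t))) \<longlonglongrightarrow> 0"
proof -
  define a where "a = dconv d (haar_coeff g)"
  have q1: "q \<ge> 1" using q by simp
  have Lg: "Lq q g" using g by (simp add: Lq0_def)
  have ca: "dconv c a k = haar_coeff g k" if "k \<ge> 1" for k
    unfolding a_def by (rule dconv_inverse[OF inv that])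
  have "(\<lambda>i. \<Sum>m\<le>i. norm (d m) * (2 powr (-1/q)) ^ m * lnorm q (haar_coeff g) (i - m)) \<longlonglongrightarrow> 0"
    by (rule convolution_tendsto_0[OF sd _ lnorm_haar_coeff_tendsto_0[OF q g]]) auto
  note l = this
  have a0: "lnorm q a \<longlonglongrightarrow> 0"
    by (rule tendsto_sandwich[OF always_eventually always_eventually tendsto_const l])
       (use lnorm_dconv_le[OF q1] in \<open>simp_all add: a_def\<close>)
  note W = window_tendsto_0[OF sc _ a0 lnorm_nonneg]
  define \<delta> where "\<delta> K = (\<Sum>m. norm (c m) * (2 powr (-1/q)) ^ m * (\<Sum>i\<in>{K - m..K}. lnorm q a i))" for K
  have \<delta>0: "\<delta> \<longlonglongrightarrow> 0" unfolding \<delta>_def by (rule W(1)) auto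
  have "filterlim dlog at_top sequentially"
    unfolding filterlim_at_top
  proof
    fix Z
    show "\<forall>\<^sub>F N in sequentially. Z \<le> dlog N"
      using eventually_ge_at_top[of "2 ^ Z"]
    proof eventually_elim
      case (elim N)
      then show ?case using dlog_mono[of "2 ^ Z" N] dlog_eqI[of Z "2 ^ Z"] by simp
    qed
  qed
  then have \<delta>1: "(\<lambda>N. \<delta> (dlog N)) \<longlonglongrightarrow> 0" by (rule filterlim_compose[OF \<delta>0])
  define P where "P N t = (\<Sum>n\<in>{1..<N}. haar_coeff g n * haarC n t)" for N t
  define S where "S N t = (\<Sum>n\<in>{1..<N}. a n * chaos c n t)" for N t
  have sc': "summable (\<lambda>k. norm (c k) * (2 powr (-1/q)) ^ k)"
    by (rule summable_of_summable_mult_Suc[OF sc]) simp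
  have LP: "Lq q (P N)" for N unfolding P_def using q by (intro Lq_sum Lq_cmult Lq_haarC) auto
  have LS: "Lq q (S N)" for N unfolding S_def using q sc' by (intro Lq_sum Lq_cmult Lq_chaos) auto
  have PS: "P N t = (\<Sum>k\<in>{1..<N}. dconv c a k * haarC k t)" for N t
    unfolding P_def by (intro sum.cong) (auto simp: ca)
  have le: "Lq_norm q (\<lambda>t. g t - S N t) \<le> Lq_norm q (\<lambda>t. g t - P N t) + \<delta> (dlog N)" if "N \<ge> 1" for N
  proof -
    have "Lq_norm q (\<lambda>t. S N t - P N t) \<le> \<delta> (dlog N)"
      unfolding S_def PS \<delta>_def by (rule Lq_norm_partial_sum_diff_le[OF q1 that W(2)]) auto
    moreover have "Lq_norm q (\<lambda>t. (g t - P N t) - (S N t - P N t)) \<le> Lq_norm q (\<lambda>t. g t - P N t) + Lq_norm q (\<lambda>t. S N t - P N t)"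
      by (intro Lq_norm_triangle_diff Lq_diff q1 Lg LP LS)
    ultimately show ?thesis by simp
  qed
  have "(\<lambda>N. Lq_norm q (\<lambda>t. g t - P N t) + \<delta> (dlog N)) \<longlonglongrightarrow> 0 + 0"
    unfolding P_def by (intro tendsto_add haar_series_converges q g \<delta>1)
  then have l: "(\<lambda>N. Lq_norm q (\<lambda>t. g t - P N t) + \<delta> (dlog N)) \<longlonglongrightarrow> 0" by simp
  have "(\<lambda>N. Lq_norm q (\<lambda>t. g t - S N t)) \<longlonglongrightarrow> 0"
    by (rule tendsto_sandwich[OF _ eventually_mono[OF eventually_ge_at_top[of 1] le] tendsto_const l]) simp
  then show ?thesis by (simp add: S_def a_def)
qed

text \<open>Pairing with \<open>h_k\<close> only sees the finitely many \<open>n\<close> with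
  \<open>2^j * n = k\<close>, so the pairings of the partial sums are constant for
  \<open>N > k\<close>. In the limit \<open>dconv c a\<close> is the Haar coefficient sequence of
  \<open>g\<close>, and \<open>dconv d\<close> inverts this.\<close>

lemma chaos_coefficients_unique:
  assumes q: "q > 1" and Lg: "Lq q g" and inv: "Abs_fps c * Abs_fps d = 1"
    and sc: "summable (\<lambda>k. norm (c k) * (2 powr (-1/q)) ^ k)"
    and lim: "(\<lambda>N. Lq_norm q (\<lambda>t. g t - (\<Sum>n\<in>{1..<N}. a n * chaos c n t))) \<longlonglongrightarrow> 0"
    and k: "k \<ge> 1"
  shows "a k = dconv d (haar_coeff g) k"
proof -
  have "dconv c a k = haar_coeff g k" if k: "k \<ge> 1" for k
  proof -
    have LS: "Lq q (\<lambda>t. \<Sum>n\<in>{1..<N}. a n * chaos c n t)" for N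
      using q sc by (intro Lq_sum Lq_cmult Lq_chaos) auto
    have i: "integrable MI (\<lambda>t. chaos c n t * haarC k t)" if "n \<ge> 1" for n
      by (rule Lq_pairing_le(1)[OF q Lq_chaos(1) haarC_measurable norm_haarC_le[OF k]]) (use q sc that k norm_haarC_le in auto)
    have eq: "integral\<^sup>L MI (\<lambda>t. (\<Sum>n\<in>{1..<N}. a n * chaos c n t) * haarC k t) = dconv c a k / 2 ^ dlog k" if N: "N > k" for N
    proof -
      have "integral\<^sup>L MI (\<lambda>t. (\<Sum>n\<in>{1..<N}. a n * chaos c n t) * haarC k t) = (\<Sum>n\<in>{1..<N}. integral\<^sup>L MI (\<lambda>t. a n * (chaos c n t * haarC k t)))"
        unfolding sum_distrib_right mult.assoc by (rule Bochner_Integration.integral_sum) (auto intro!: i)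
      also have "\<dots> = (\<Sum>n\<in>{1..<N}. \<Sum>j<k. if 2 ^ j * n = k then c j * a n / 2 ^ dlog k else 0)"
      proof (rule sum.cong)
        fix n assume "n \<in> {1..<N}"
        then have "integral\<^sup>L MI (\<lambda>t. chaos c n t * haarC k t) = (\<Sum>j<k. if 2 ^ j * n = k then c j else 0) / 2 ^ dlog k"
          using sc k q by (intro integral_chaos_haar) auto
        then show "integral\<^sup>L MI (\<lambda>t. a n * (chaos c n t * haarC k t)) = (\<Sum>j<k. if 2 ^ j * n = k then c j * a n / 2 ^ dlog k else 0)"
          by (simp add: sum_distrib_left sum_divide_distrib) (intro sum.cong, auto)
      qed simp
      also have "\<dots> = (\<Sum>j<k. \<Sum>n\<in>{1..<N}. if 2 ^ j * n = k then c j * a n / 2 ^ dlog k else 0)"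
        by (rule sum.swap)
      also have "\<dots> = (\<Sum>j<k. if 2 ^ j dvd k then c j * a (k div 2 ^ j) / 2 ^ dlog k else 0)"
      proof (rule sum.cong)
        fix j
        show "(\<Sum>n\<in>{1..<N}. if 2 ^ j * n = k then c j * a n / 2 ^ dlog k else 0) = (if 2 ^ j dvd k then c j * a (k div 2 ^ j) / 2 ^ dlog k else 0)"
        proof (cases "2 ^ j dvd k")
          case True
          then obtain n where n: "k = 2 ^ j * n" by (auto elim: dvdE)
          have "n \<le> k" using n by simp
          then have "n \<in> {1..<N}" using n k N by (cases n) auto
          then show ?thesis using n by simp
        next
          case False
          then have "2 ^ j * n \<noteq> k" for n by auto
          then show ?thesis using False by simp
        qed
      qed simp
      also have "\<dots> = (\<Sum>j<k. if 2 ^ j dvd k then c j * a (k div 2 ^ j) else 0) / 2 ^ dlog k"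
        unfolding sum_divide_distrib by (intro sum.cong) auto
      also have "(\<Sum>j<k. if 2 ^ j dvd k then c j * a (k div 2 ^ j) else 0) = dconv c a k"
        using k less_pow2_dlog[OF k] by (intro dconv_range[symmetric]) auto
      finally show ?thesis .
    qed
    have "(\<lambda>N. integral\<^sup>L MI (\<lambda>t. (\<Sum>n\<in>{1..<N}. a n * chaos c n t) * haarC k t)) \<longlonglongrightarrow> integral\<^sup>L MI (\<lambda>t. g t * haarC k t)"
      by (rule Lq_pairing_tendsto[OF q Lg LS haarC_measurable norm_haarC_le[OF k] lim])
    moreover have "(\<lambda>N. integral\<^sup>L MI (\<lambda>t. (\<Sum>n\<in>{1..<N}. a n * chaos c n t) * haarC k t)) \<longlonglongrightarrow> dconv c a k / 2 ^ dlog k"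
      by (rule tendsto_eventually, rule eventually_mono[OF eventually_gt_at_top[of k]], rule eq)
    ultimately have "integral\<^sup>L MI (\<lambda>t. g t * haarC k t) = dconv c a k / 2 ^ dlog k" by (rule LIMSEQ_unique)
    then show ?thesis by (simp add: haar_coeff_def)
  qed
  then have "dconv d (dconv c a) k = dconv d (haar_coeff g) k" by (intro dconv_cong k)
  moreover have "dconv d (dconv c a) k = a k"
    by (rule dconv_inverse[OF _ k]) (simp add: mult.commute inv)
  ultimately show ?thesis by simp
qed

theorem schauder_basis_chaos:
  assumes q: "q > 1" and inv: "Abs_fps c * Abs_fps d = 1"
    and sc: "summable (\<lambda>m. norm (c m) * (2 powr (-1/q)) ^ m * real (Suc m))"
    and sd: "summable (\<lambda>m. norm (d m) * (2 powr (-1/q)) ^ m)"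
  shows "schauder_basis_Lq0 q (dil (haar_chaos c))"
  unfolding schauder_basis_Lq0_def
proof (intro conjI allI impI)
  have sc': "summable (\<lambda>k. norm (c k) * (2 powr (-1/q)) ^ k)"
    by (rule summable_of_summable_mult_Suc[OF sc]) simp
  show "Lq0 q (dil (haar_chaos c) n)" if "n \<ge> 1" for n
    using Lq0_chaos[OF q that sc'] by (simp add: dil_haar_chaos[OF that])
  fix g assume g: "Lq0 q g"
  \<comment> \<open>The definition of a basis numbers coefficients from 0, the Haar system starts at
    1.\<close>
  have shift: "(\<Sum>m<N. a m * dil (haar_chaos c) (Suc m) t) = (\<Sum>n\<in>{1..<Suc N}. a (n - 1) * chaos c n t)" for a N t
    by (rule sum.reindex_bij_witness[of _ "\<lambda>n. n - 1" Suc]) (auto simp: dil_haar_chaos)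
  let ?a = "\<lambda>m. dconv d (haar_coeff g) (Suc m)"
  show "\<exists>!a. (\<lambda>N. Lq_norm q (\<lambda>t. g t - (\<Sum>m<N. a m * dil (haar_chaos c) (Suc m) t))) \<longlonglongrightarrow> 0"
  proof (rule ex1I[of _ ?a])
    have "(\<Sum>n\<in>{1..<Suc N}. ?a (n - 1) * chaos c n t) = (\<Sum>n\<in>{1..<Suc N}. dconv d (haar_coeff g) n * chaos c n t)" for N t
      by (intro sum.cong) auto
    then show "(\<lambda>N. Lq_norm q (\<lambda>t. g t - (\<Sum>m<N. ?a m * dil (haar_chaos c) (Suc m) t))) \<longlonglongrightarrow> 0"
      unfolding shift using LIMSEQ_Suc[OF chaos_expansion_converges[OF q g inv sc sd]] by simp
  next
    fix a assume "(\<lambda>N. Lq_norm q (\<lambda>t. g t - (\<Sum>m<N. a m * dil (haar_chaos c) (Suc m) t))) \<longlonglongrightarrow> 0"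
    then have "(\<lambda>N. Lq_norm q (\<lambda>t. g t - (\<Sum>n\<in>{1..<N}. a (n - 1) * chaos c n t))) \<longlonglongrightarrow> 0"
      unfolding shift by (rule LIMSEQ_imp_Suc)
    from chaos_coefficients_unique[OF q _ inv sc' this] 
    have "a (k - 1) = dconv d (haar_coeff g) k" if "k \<ge> 1" for k using that g by (simp add: Lq0_def)
    from this[of "Suc _"] show "a = ?a" by (auto simp: fun_eq_iff)
  qed
qed

subsection \<open>Moments of independent copies\<close>

text \<open>For the exponential moments: the linear term integrates to zero against a layer, and the
  quadratic term is computed exactly.\<close>

lemma exp_le_quadratic:
  fixes u :: real assumes "\<bar>u\<bar> \<le> 1" shows "exp u \<le> 1 + u + u\<^sup>2"
proof (cases "u \<ge> 0")
  case True
  then show ?thesis using exp_bound[of u] assms by simp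
next
  case False
  define x where "x = - u"
  have x: "x \<ge> 0" using False by (simp add: x_def)
  \<comment> \<open>For \<open>x = -u\<close> the claim is
    \<open>1 \<le> (1 - x + x^2) exp x\<close>; it already holds with the quadratic Taylor
    polynomial in place of \<open>exp x\<close>.\<close>
  have "1 \<le> (1 - x + x\<^sup>2) * (1 + x + x\<^sup>2 / 2)"
  proof -
    have "(1 - x + x\<^sup>2) * (1 + x + x\<^sup>2 / 2) = 1 + (x\<^sup>2 + x ^ 3 + x ^ 4) / 2"
      by (simp add: field_simps power2_eq_square power3_eq_cube power4_eq_xxxx)
    then show ?thesis using x by simp
  qed
  also have "\<dots> \<le> (1 - x + x\<^sup>2) * exp x"
  proof (rule mult_left_mono)
    show "1 + x + x\<^sup>2 / 2 \<le> exp x" using exp_lower_Taylor_quadratic[OF x] .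
    have "0 \<le> (1 - x)\<^sup>2 + x" using x by simp
    then show "0 \<le> 1 - x + x\<^sup>2" by (simp add: power2_eq_square algebra_simps)
  qed
  finally have "exp (- x) \<le> 1 - x + x\<^sup>2" by (simp add: exp_minus field_simps)
  then show ?thesis by (simp add: x_def)
qed

lemma integrable_bounded_mult:
  fixes f g :: "real \<Rightarrow> real"
  assumes "f \<in> borel_measurable MI" "g \<in> borel_measurable MI"
    and "\<And>t. t \<in> I01 \<Longrightarrow> \<bar>f t\<bar> \<le> A" "\<And>t. t \<in> I01 \<Longrightarrow> \<bar>g t\<bar> \<le> B"
  shows "integrable MI (\<lambda>t. f t * g t)"
proof (rule MI.integrable_const_bound[where B="A * B"])
  show "AE t in MI. norm (f t * g t) \<le> A * B"
  proof (rule AE_I2)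
    fix t assume "t \<in> space MI"
    then have "\<bar>f t\<bar> \<le> A" "\<bar>g t\<bar> \<le> B" using assms by auto
    then show "norm (f t * g t) \<le> A * B"
      using mult_mono[of "\<bar>f t\<bar>" A "\<bar>g t\<bar>" B] by (simp add: abs_mult)
  qed
qed (use assms in measurable)

lemma haar_real_le_1: "n \<ge> 1 \<Longrightarrow> \<bar>haar_real n t\<bar> \<le> 1"
  using haar_real_abs[of n t] by (simp add: indicator_def)

text \<open>One layer of independent copies of the chaos with coefficients \<open>y\<close>: one copy on the right half of
  each dyadic interval of level \<open>L\<close>.\<close>

definition layer :: "(nat \<Rightarrow> real) \<Rightarrow> nat \<Rightarrow> nat \<Rightarrow> real \<Rightarrow> real" where
  "layer y X L t = (\<Sum>n\<in>lev L. \<Sum>k<X. y k * haar_real (2 ^ k * Suc (2 * n)) t)"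

lemma chain_ge_1: "1 \<le> 2 ^ k * Suc (2 * n)"
  by (simp add: Suc_le_eq del: mult_Suc_right)

lemma layer_measurable [measurable]: "layer y X L \<in> borel_measurable MI"
  unfolding layer_def by measurable

lemma dlog_layer: "n \<in> lev L \<Longrightarrow> dlog (2 ^ k * Suc (2 * n)) = k + Suc L"
  using dlog_mult_pow2[of "Suc (2 * n)" k] by (simp add: lev_iff)

text \<open>Intervals of one level are disjoint, so at most one copy is nonzero at \<open>t\<close>.
  The bound is therefore independent of \<open>L\<close>.\<close>

lemma layer_abs_le: "\<bar>layer y X L t\<bar> \<le> (\<Sum>k<X. \<bar>y k\<bar>)"
proof (cases "\<exists>n\<in>lev L. t \<in> dyad n")
  case True
  then obtain n where n: "n \<in> lev L" "t \<in> dyad n" by auto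
  have z: "(\<Sum>k<X. y k * haar_real (2 ^ k * Suc (2 * m)) t) = 0" if "m \<in> lev L - {n}" for m
  proof -
    have "t \<notin> dyad m" using dyad_disjoint_level[of m n t] that n by (auto simp: lev_iff)
    then have "t \<notin> dyad (Suc (2 * m))" using dyad_split[of m] that by (auto simp: lev_iff)
    then show ?thesis by (simp add: haar_real_chain_support del: mult_Suc_right)
  qed
  have "layer y X L t = (\<Sum>m\<in>{n}. \<Sum>k<X. y k * haar_real (2 ^ k * Suc (2 * m)) t)"
    unfolding layer_def by (rule sum.mono_neutral_right) (use n z in auto)
  also have "\<bar>\<dots>\<bar> \<le> (\<Sum>k<X. \<bar>y k * haar_real (2 ^ k * Suc (2 * n)) t\<bar>)" by simp
  also have "\<dots> \<le> (\<Sum>k<X. \<bar>y k\<bar>)"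
  proof (rule sum_mono)
    fix k
    have "\<bar>haar_real (2 ^ k * Suc (2 * n)) t\<bar> \<le> 1" by (rule haar_real_le_1[OF chain_ge_1])
    then show "\<bar>y k * haar_real (2 ^ k * Suc (2 * n)) t\<bar> \<le> \<bar>y k\<bar>"
      unfolding abs_mult by (rule mult_left_le) simp
  qed
  finally show ?thesis .
next
  case False
  have "(\<Sum>k<X. y k * haar_real (2 ^ k * Suc (2 * m)) t) = 0" if "m \<in> lev L" for m
  proof -
    have "t \<notin> dyad (Suc (2 * m))" using dyad_split[of m] that False by (auto simp: lev_iff)
    then show ?thesis by (simp add: haar_real_chain_support del: mult_Suc_right)
  qed
  then have "layer y X L t = 0" by (simp add: layer_def)
  then show ?thesis by (simp add: sum_nonneg)
qed

lemma inj_pow2_odd: "2 ^ k * Suc (2 * m) = 2 ^ l * Suc (2 * n) \<longleftrightarrow> k = l \<and> m = n"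
proof
  have *: "k = l \<and> m = n" if e: "2 ^ k * Suc (2 * m) = 2 ^ l * Suc (2 * n)" and "k \<le> l" for k l m n :: nat
  proof -
    have "(2::nat) ^ l = 2 ^ k * 2 ^ (l - k)" using that by (simp flip: power_add)
    then have e': "Suc (2 * m) = 2 ^ (l - k) * Suc (2 * n)"
      using e by (simp add: mult.assoc del: mult_Suc_right)
    have "odd (2 ^ (l - k) * Suc (2 * n))" unfolding e'[symmetric] by simp
    then have "l - k = 0" by (cases "l - k") auto
    then show ?thesis using e' that by simp
  qed
  assume e: "2 ^ k * Suc (2 * m) = 2 ^ l * Suc (2 * n)"
  show "k = l \<and> m = n" using *[OF e] *[OF e[symmetric]] by (cases "k \<le> l") auto
qed auto

text \<open>The weight \<open>\<phi>\<close> depends only on the interval of level \<open>L\<close>;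
  it will be the exponential of all preceding layers. Relative to such weights the layer at
  \<open>L\<close> has mean zero and constant conditional variance, and this replaces an appeal to
  independence.\<close>

context
  fixes \<phi> :: "real \<Rightarrow> real" and L :: nat and v :: "nat \<Rightarrow> real"
  assumes meas: "\<phi> \<in> borel_measurable MI"
    and v: "\<And>n t. n \<in> lev L \<Longrightarrow> t \<in> dyad n \<Longrightarrow> \<phi> t = v n"
begin

lemma step_abs_le: "t \<in> I01 \<Longrightarrow> \<bar>\<phi> t\<bar> \<le> (\<Sum>n\<in>lev L. \<bar>v n\<bar>)"
proof -
  assume "t \<in> I01"
  then obtain n where n: "n \<in> lev L" "t \<in> dyad n" using dyad_partition[of t "2 ^ L"] by (auto simp: lev_def)
  have "\<bar>v n\<bar> \<le> (\<Sum>n\<in>lev L. \<bar>v n\<bar>)" using n by (intro member_le_sum) auto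
  then show ?thesis using v[OF n] by simp
qed

lemma step_deeper:
  assumes "m \<ge> 1" "L \<le> dlog m"
  shows "\<exists>n\<in>lev L. dyad m \<subseteq> dyad n"
proof -
  define n where "n = m div 2 ^ (dlog m - L)"
  have "2 ^ dlog m \<le> m" "m < 2 ^ Suc (dlog m)" using dlog_bounds[OF assms(1)] by auto
  have p: "(2::nat) ^ dlog m = 2 ^ L * 2 ^ (dlog m - L)" using assms by (simp flip: power_add)
  have n: "n \<in> lev L"
    unfolding lev_def n_def using dlog_bounds[OF assms(1)]
    by (auto simp: p less_mult_imp_div_less less_eq_div_iff_mult_less_eq)
  have "dyad m \<subseteq> dyad (m div 2 ^ i)" if "i \<le> dlog m" for i
    using that
  proof (induction i)
    case (Suc i)
    have "2 * 2 ^ i \<le> (2::nat) ^ dlog m" using Suc.prems by (simp add: power_increasing flip: power_Suc)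
    then have "m div 2 ^ i \<ge> 2" using dlog_bounds[OF assms(1)] by (simp add: less_eq_div_iff_mult_less_eq)
    then have "dyad (m div 2 ^ i) \<subseteq> dyad (m div 2 ^ Suc i)" using dyad_half[of "m div 2 ^ i"]
      by (simp only: power_Suc2 div_mult2_eq)
    then show ?case using Suc by auto
  qed simp
  from this[of "dlog m - L"] show ?thesis using n unfolding n_def by auto
qed

lemma step_constant: "m \<ge> 1 \<Longrightarrow> L \<le> dlog m \<Longrightarrow> \<phi> constant_on dyad m"
  using step_deeper[of m] v unfolding constant_on_def by blast

lemma integral_step: "integral\<^sup>L MI \<phi> = (\<Sum>n\<in>lev L. v n / 2 ^ L)"
proof -
  have i: "integrable MI \<phi>" using integrable_bounded_mult[OF meas _ step_abs_le, of "\<lambda>_. 1" 1] by simp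
  have "integral\<^sup>L MI (\<lambda>t. indicator (dyad n) t *\<^sub>R \<phi> t) = v n / 2 ^ L" if n: "n \<in> lev L" for n
  proof -
    have "(\<lambda>t. indicator (dyad n) t *\<^sub>R \<phi> t) = (\<lambda>t. v n * indicator (dyad n) t)"
      using v[OF n] by (auto simp: indicator_def)
    then show ?thesis using integral_dyad[of n] n by (simp add: lev_iff)
  qed
  then show ?thesis using integral_partition[OF i, of "2 ^ L"] by (simp add: lev_def)
qed

lemma integral_step_layer: "integral\<^sup>L MI (\<lambda>t. \<phi> t * layer y X L t) = 0"
proof -
  have "integrable MI (\<lambda>t. \<phi> t * (y k * haar_real (2 ^ k * Suc (2 * n)) t))" for n k
    unfolding mult.left_commute[of "\<phi> _"]
    by (intro integrable_mult_right integrable_bounded_mult[OF meas haar_real_measurable step_abs_le haar_real_le_1[OF chain_ge_1]])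
  then have "integral\<^sup>L MI (\<lambda>t. \<phi> t * layer y X L t) = (\<Sum>n\<in>lev L. \<Sum>k<X. integral\<^sup>L MI (\<lambda>t. \<phi> t * (y k * haar_real (2 ^ k * Suc (2 * n)) t)))"
    unfolding layer_def sum_distrib_left by (subst Bochner_Integration.integral_sum | simp)+
  also have "\<dots> = 0"
  proof (intro sum.neutral ballI)
    fix n k assume n: "n \<in> lev L"
    have "integral\<^sup>L MI (\<lambda>t. \<phi> t * haar_real (2 ^ k * Suc (2 * n)) t) = 0"
      by (intro integral_step_haar step_constant chain_ge_1) (simp add: dlog_layer[OF n] del: mult_Suc_right)
    then show "integral\<^sup>L MI (\<lambda>t. \<phi> t * (y k * haar_real (2 ^ k * Suc (2 * n)) t)) = 0"
      unfolding mult.left_commute[of "\<phi> _"] by simp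
  qed
  finally show ?thesis .
qed

text \<open>Orthogonality leaves the diagonal. The index \<open>2^k * Suc (2 * n)\<close> lies on
  level \<open>k + L + 1\<close>, and the extra 1 is the factor \<open>1/2\<close>: a copy lives on
  the right half of its interval only.\<close>

lemma integral_step_layer_sq:
  "integral\<^sup>L MI (\<lambda>t. \<phi> t * (layer y X L t)\<^sup>2) = (\<Sum>k<X. (y k)\<^sup>2 / 2 ^ k) / 2 * integral\<^sup>L MI \<phi>"
proof -
  define C where "C = lev L \<times> {..<X}"
  define e where "e p = 2 ^ snd p * Suc (2 * fst p)" for p :: "nat \<times> nat"
  have fC: "finite C" by (simp add: C_def)
  have e1: "e p \<ge> 1" for p unfolding e_def by (rule chain_ge_1)
  have de: "dlog (e p) = snd p + Suc L" if "p \<in> C" for p using dlog_layer that by (auto simp: C_def e_def)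
  have inj: "e p = e p' \<longleftrightarrow> p = p'" for p p' unfolding e_def inj_pow2_odd by (auto simp: prod_eq_iff)
  have lay: "layer y X L t = (\<Sum>p\<in>C. y (snd p) * haar_real (e p) t)" for t
    unfolding layer_def C_def e_def by (subst sum.cartesian_product) (auto intro!: sum.cong simp del: mult_Suc_right)
  have ex: "\<phi> t * (layer y X L t)\<^sup>2 = (\<Sum>p\<in>C. \<Sum>p'\<in>C. (y (snd p) * y (snd p')) * (\<phi> t * (haar_real (e p) t * haar_real (e p') t)))" for t
    unfolding lay power2_eq_square sum_product by (simp add: sum_distrib_left mult_ac)
  have ii: "integrable MI (\<lambda>t. \<phi> t * (haar_real (e p) t * haar_real (e p') t))" for p p'
  proof (rule integrable_bounded_mult[OF meas _ step_abs_le])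
    show "\<bar>haar_real (e p) t * haar_real (e p') t\<bar> \<le> 1" for t
      using haar_real_le_1[OF e1[of p], of t] haar_real_le_1[OF e1[of p'], of t] by (simp add: abs_mult mult_le_one)
  qed measurable
  have ort: "integral\<^sup>L MI (\<lambda>t. \<phi> t * (haar_real (e p) t * haar_real (e p') t)) = (if p = p' then v (fst p) / 2 ^ (snd p + Suc L) else 0)"
    if p: "p \<in> C" "p' \<in> C" for p p'
  proof (cases "p = p'")
    case True
    have n: "fst p \<in> lev L" using p by (auto simp: C_def)
    have "dyad (e p) \<subseteq> dyad (Suc (2 * fst p))"
      unfolding e_def by (rule dyad_chain_subset) simp
    then have "dyad (e p) \<subseteq> dyad (fst p)" using dyad_split[of "fst p"] n by (auto simp: lev_iff)
    then have "integral\<^sup>L MI (\<lambda>t. \<phi> t * haar_real (e p) t * haar_real (e p) t) = v (fst p) / 2 ^ dlog (e p)"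
      by (intro integral_step_haar_sq e1) (use v[OF n] in auto)
    then show ?thesis using True de[OF p(1)] by (simp add: mult.assoc)
  next
    case False
    have "integral\<^sup>L MI (\<lambda>t. \<phi> t * haar_real (e p) t * haar_real (e p') t) = 0"
      by (intro integral_step_haar_haar step_constant e1) (use False inj de[OF p(1)] de[OF p(2)] in simp_all)
    then show ?thesis using False by (simp add: mult.assoc)
  qed
  have "integral\<^sup>L MI (\<lambda>t. \<phi> t * (layer y X L t)\<^sup>2) = (\<Sum>p\<in>C. \<Sum>p'\<in>C. (y (snd p) * y (snd p')) * integral\<^sup>L MI (\<lambda>t. \<phi> t * (haar_real (e p) t * haar_real (e p') t)))"
    unfolding ex using ii by (simp add: Bochner_Integration.integral_sum)
  also have "\<dots> = (\<Sum>p\<in>C. \<Sum>p'\<in>C. if p = p' then (y (snd p))\<^sup>2 * (v (fst p) / 2 ^ (snd p + Suc L)) else 0)"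
    by (intro sum.cong refl) (simp add: ort power2_eq_square)
  also have "\<dots> = (\<Sum>p\<in>C. (y (snd p))\<^sup>2 * (v (fst p) / 2 ^ (snd p + Suc L)))"
    using fC by simp
  also have "\<dots> = (\<Sum>n\<in>lev L. \<Sum>k<X. ((y k)\<^sup>2 / 2 ^ k) * (v n / 2 ^ L) / 2)"
    unfolding C_def by (subst sum.cartesian_product) (intro sum.cong refl, simp add: power_add case_prod_beta mult_ac)
  also have "\<dots> = (\<Sum>k<X. (y k)\<^sup>2 / 2 ^ k) / 2 * (\<Sum>n\<in>lev L. v n / 2 ^ L)"
    unfolding sum_divide_distrib[of _ _ 2] sum_distrib_left sum_distrib_right by (simp add: mult_ac)
  finally show ?thesis by (simp add: integral_step)
qed

text \<open>Since \<open>r\<close> times the layer is at most 1 in absolute value, the quadratic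
  bound for \<open>exp\<close> applies pointwise; after integration its linear term
  disappears.\<close>

lemma integral_step_exp_layer_le:
  assumes nonneg: "\<And>t. \<phi> t \<ge> 0" and small: "\<bar>r\<bar> * (\<Sum>k<X. \<bar>y k\<bar>) \<le> 1"
  shows "integral\<^sup>L MI (\<lambda>t. \<phi> t * exp (r * layer y X L t))
    \<le> (1 + r\<^sup>2 * (\<Sum>k<X. (y k)\<^sup>2 / 2 ^ k) / 2) * integral\<^sup>L MI \<phi>"
proof -
  let ?Y = "layer y X L"
  define B where "B = (\<Sum>k<X. \<bar>y k\<bar>)"
  have Y: "\<bar>?Y t\<bar> \<le> B" for t unfolding B_def by (rule layer_abs_le)
  have rY: "\<bar>r * ?Y t\<bar> \<le> 1" for t
    using mult_left_mono[OF Y[of t], of "\<bar>r\<bar>"] small by (simp add: abs_mult B_def)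
  have i1: "integrable MI \<phi>" using integrable_bounded_mult[OF meas _ step_abs_le, of "\<lambda>_. 1" 1] by simp
  have i2: "integrable MI (\<lambda>t. \<phi> t * ?Y t)"
    by (rule integrable_bounded_mult[OF meas layer_measurable step_abs_le Y])
  have i3: "integrable MI (\<lambda>t. \<phi> t * (?Y t)\<^sup>2)"
    by (rule integrable_bounded_mult[OF meas _ step_abs_le, of _ "B\<^sup>2"])
       (use Y in \<open>auto simp: power2_le_iff_abs_le abs_le_square_iff[symmetric] intro: order.trans[OF _ abs_ge_self]\<close>)
  have i4: "integrable MI (\<lambda>t. \<phi> t * exp (r * ?Y t))"
  proof (rule integrable_bounded_mult[OF meas _ step_abs_le])
    show "\<bar>exp (r * ?Y t)\<bar> \<le> exp 1" for t using rY[of t] by simp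
  qed measurable
  have "integral\<^sup>L MI (\<lambda>t. \<phi> t * exp (r * ?Y t)) \<le> integral\<^sup>L MI (\<lambda>t. \<phi> t + r * (\<phi> t * ?Y t) + r\<^sup>2 * (\<phi> t * (?Y t)\<^sup>2))"
  proof (rule integral_mono)
    fix t
    have "\<phi> t * exp (r * ?Y t) \<le> \<phi> t * (1 + r * ?Y t + (r * ?Y t)\<^sup>2)"
      by (intro mult_left_mono exp_le_quadratic rY nonneg)
    then show "\<phi> t * exp (r * ?Y t) \<le> \<phi> t + r * (\<phi> t * ?Y t) + r\<^sup>2 * (\<phi> t * (?Y t)\<^sup>2)"
      by (simp add: algebra_simps power_mult_distrib)
  qed (use i1 i2 i3 i4 in auto)
  also have "\<dots> = integral\<^sup>L MI \<phi> + r * integral\<^sup>L MI (\<lambda>t. \<phi> t * ?Y t) + r\<^sup>2 * integral\<^sup>L MI (\<lambda>t. \<phi> t * (?Y t)\<^sup>2)"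
    using i1 i2 i3 by simp
  also have "\<dots> = (1 + r\<^sup>2 * (\<Sum>k<X. (y k)\<^sup>2 / 2 ^ k) / 2) * integral\<^sup>L MI \<phi>"
    unfolding integral_step_layer integral_step_layer_sq by (simp add: algebra_simps)
  finally show ?thesis .
qed

end

text \<open>The indices of the copies: block \<open>b\<close> consists of one odd index below each interval of level \<open>b W\<close>.
  Oddness keeps the chains \<open>2^k n\<close> of different copies disjoint.\<close>

definition copies :: "nat \<Rightarrow> nat \<Rightarrow> nat set" where
  "copies W M = (\<Union>b<M. (\<lambda>n. Suc (2 * n)) ` lev (b * W))"

lemma finite_copies [simp]: "finite (copies W M)"
  by (simp add: copies_def)

lemma copies_E:
  assumes "n \<in> copies W M" obtains b m where "b < M" "m \<in> lev (b * W)" "n = Suc (2 * m)" "dlog n = Suc (b * W)"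
  using assms by (auto simp: copies_def lev_iff)

lemma copies_ge_1: "n \<in> copies W M \<Longrightarrow> n \<ge> 1"
  by (auto simp: copies_def)

lemma sum_copies_Suc:
  fixes f :: "nat \<Rightarrow> 'a::comm_monoid_add"
  assumes "W \<ge> 1"
  shows "sum f (copies W (Suc M)) = sum f (copies W M) + (\<Sum>n\<in>lev (M * W). f (Suc (2 * n)))"
proof -
  have "copies W (Suc M) = copies W M \<union> (\<lambda>n. Suc (2 * n)) ` lev (M * W)"
    unfolding copies_def lessThan_Suc by (simp add: Un_commute)
  moreover have "copies W M \<inter> (\<lambda>n. Suc (2 * n)) ` lev (M * W) = {}"
    using assms by (auto simp: lev_iff elim!: copies_E)
  ultimately have "sum f (copies W (Suc M)) = sum f (copies W M) + sum f ((\<lambda>n. Suc (2 * n)) ` lev (M * W))"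
    by (simp add: sum.union_disjoint)
  then show ?thesis by (subst (asm) sum.reindex) (auto simp: inj_on_def)
qed

lemma copies_0 [simp]: "copies W 0 = {}" by (simp add: copies_def)

lemma copies_weight: "W \<ge> 1 \<Longrightarrow> (\<Sum>n\<in>copies W M. 1 / 2 ^ dlog n) = real M / 2"
proof (induction M)
  case (Suc M)
  have "(\<Sum>n\<in>lev (M * W). 1 / 2 ^ dlog (Suc (2 * n))) = (\<Sum>n\<in>lev (M * W). (1::real) / 2 ^ Suc (M * W))"
    by (intro sum.cong) (auto simp: lev_iff)
  also have "\<dots> = 1 / 2" by (simp add: lev_def)
  finally show ?case using Suc by (simp add: sum_copies_Suc add_divide_distrib)
qed simp

definition csum :: "(nat \<Rightarrow> real) \<Rightarrow> nat \<Rightarrow> nat \<Rightarrow> nat \<Rightarrow> real \<Rightarrow> real" where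
  "csum y X W M t = (\<Sum>n\<in>copies W M. \<Sum>k<X. y k * haar_real (2 ^ k * n) t)"

lemma csum_Suc: "W \<ge> 1 \<Longrightarrow> csum y X W (Suc M) t = csum y X W M t + layer y X (M * W) t"
  unfolding csum_def layer_def by (rule sum_copies_Suc)

lemma csum_measurable [measurable]: "csum y X W M \<in> borel_measurable MI"
  unfolding csum_def by measurable

text \<open>This is where \<open>X < W\<close> enters: the chains of block \<open>b\<close> use
  levels up to \<open>b * W + X\<close>, strictly below \<open>Suc b * W\<close>. Blocks before
  \<open>M\<close> are thus constant on the intervals on which block \<open>M\<close> is
  built.\<close>

lemma csum_constant:
  assumes "X < W" "n \<in> lev (M * W)" "s \<in> dyad n" "t \<in> dyad n"
  shows "csum y X W M s = csum y X W M t"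
  unfolding csum_def
proof (intro sum.cong refl)
  fix m k assume m: "m \<in> copies W M" and k: "k \<in> {..<X}"
  obtain b where b: "b < M" "dlog m = Suc (b * W)" using copies_E[OF m] by metis
  have m1: "m \<ge> 1" using copies_ge_1[OF m] .
  have "Suc b * W \<le> M * W" using b by (intro mult_le_mono1) simp
  then have "dlog (2 ^ k * m) < dlog n" using assms b k m1 by (simp add: dlog_mult_pow2 lev_iff)
  then have "haar_real (2 ^ k * m) constant_on dyad n"
    using m1 assms by (intro haar_real_constant) (auto simp: lev_iff)
  then show "y k * haar_real (2 ^ k * m) s = y k * haar_real (2 ^ k * m) t"
    using assms by (auto simp: constant_on_def)
qed

lemma exp_moment_csum:
  assumes "X < W" and small: "\<bar>r\<bar> * (\<Sum>k<X. \<bar>y k\<bar>) \<le> 1"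
  shows "integrable MI (\<lambda>t. exp (r * csum y X W M t))"
    and "integral\<^sup>L MI (\<lambda>t. exp (r * csum y X W M t)) \<le> (1 + r\<^sup>2 * (\<Sum>k<X. (y k)\<^sup>2 / 2 ^ k) / 2) ^ M"
proof -
  \<comment> \<open>The value on an interval, read off at an arbitrary point of it.\<close>
  define v where "v N n = exp (r * csum y X W N (SOME t. t \<in> dyad n))" for N n
  have v: "exp (r * csum y X W N t) = v N n" if "n \<in> lev (N * W)" "t \<in> dyad n" for N n t
    unfolding v_def using csum_constant[OF assms(1) that(1) that(2) someI[of "\<lambda>t. t \<in> dyad n", OF that(2)]] by simp
  have m: "(\<lambda>t. exp (r * csum y X W N t)) \<in> borel_measurable MI" for N by measurable
  have W: "W \<ge> 1" using assms by simp
  show "integrable MI (\<lambda>t. exp (r * csum y X W M t))"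
  proof -
    have "\<bar>exp (r * csum y X W M t)\<bar> \<le> (\<Sum>n\<in>lev (M * W). \<bar>v M n\<bar>)" if "t \<in> I01" for t
      by (rule step_abs_le[of "\<lambda>t. exp (r * csum y X W M t)" "M * W" "v M", OF m v that])
    from integrable_bounded_mult[OF m _ this, of "\<lambda>_. 1" 1] show ?thesis by simp
  qed
  show "integral\<^sup>L MI (\<lambda>t. exp (r * csum y X W M t)) \<le> (1 + r\<^sup>2 * (\<Sum>k<X. (y k)\<^sup>2 / 2 ^ k) / 2) ^ M"
  proof (induction M)
    case 0
    show ?case by (simp add: csum_def)
  next
    case (Suc M)
    let ?A = "1 + r\<^sup>2 * (\<Sum>k<X. (y k)\<^sup>2 / 2 ^ k) / 2"
    have A: "?A \<ge> 0" by (intro add_nonneg_nonneg divide_nonneg_nonneg mult_nonneg_nonneg sum_nonneg) auto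
    have "integral\<^sup>L MI (\<lambda>t. exp (r * csum y X W (Suc M) t)) = integral\<^sup>L MI (\<lambda>t. exp (r * csum y X W M t) * exp (r * layer y X (M * W) t))"
      by (simp add: csum_Suc[OF W] distrib_left exp_add)
    also have "\<dots> \<le> ?A * integral\<^sup>L MI (\<lambda>t. exp (r * csum y X W M t))"
      by (rule integral_step_exp_layer_le[of "\<lambda>t. exp (r * csum y X W M t)" "M * W" "v M", OF m v _ small]) auto
    also have "\<dots> \<le> ?A * ?A ^ M" by (rule mult_left_mono[OF Suc A])
    finally show ?case by simp
  qed
qed

definition wnorm :: "nat \<Rightarrow> (nat \<Rightarrow> complex) \<Rightarrow> real" where
  "wnorm X x = sqrt (\<Sum>k<X. (norm (x k))\<^sup>2 / 2 ^ k)"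

text \<open>The exponential moments at \<open>r\<close> and \<open>-r\<close>, where \<open>1/r\<close> is \<open>sqrt M\<close> times the weighted norm of \<open>y\<close>,
  are bounded independently of \<open>M\<close> once \<open>M\<close> is so large that each layer times \<open>r\<close> is at most 1.\<close>

lemma moment_csum:
  assumes "X < W" "s \<ge> 1" "M \<ge> 1"
    and large: "(\<Sum>k<X. \<bar>y k\<bar>)\<^sup>2 \<le> real M * (\<Sum>k<X. (y k)\<^sup>2 / 2 ^ k)"
  shows "Lq_norm s (\<lambda>t. of_real (csum y X W M t)) \<le> s * (2 * exp (1/2)) powr (1/s) * (sqrt (real M) * sqrt (\<Sum>k<X. (y k)\<^sup>2 / 2 ^ k))"
proof (cases "(\<Sum>k<X. (y k)\<^sup>2 / 2 ^ k) = 0")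
  case True
  then have "y k = 0" if "k < X" for k
    using that by (subst (asm) sum_nonneg_eq_0_iff) auto
  then have "csum y X W M t = 0" for t by (simp add: csum_def)
  then show ?thesis using True by simp
next
  case False
  define \<sigma> where "\<sigma> = sqrt (\<Sum>k<X. (y k)\<^sup>2 / 2 ^ k)"
  have "(\<Sum>k<X. (y k)\<^sup>2 / 2 ^ k) \<ge> 0" by (intro sum_nonneg) auto
  then have \<sigma>: "\<sigma> > 0" "\<sigma>\<^sup>2 = (\<Sum>k<X. (y k)\<^sup>2 / 2 ^ k)" using False by (auto simp: \<sigma>_def)
  have M: "sqrt (real M) > 0" "(sqrt (real M))\<^sup>2 = real M" using assms by auto
  \<comment> \<open>With this scaling every block contributes the factor
    \<open>1 + 1 / (2 * M)\<close>, whose \<open>M\<close>-th power stays below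
    \<open>exp (1/2)\<close>.\<close>
  define r where "r = 1 / (\<sigma> * sqrt (real M))"
  have r: "r > 0" using \<sigma> M by (simp add: r_def)
  have "(\<Sum>k<X. \<bar>y k\<bar>) \<le> sqrt (real M) * \<sigma>"
    by (rule power2_le_imp_le) (use large \<sigma> M in \<open>auto simp: power_mult_distrib\<close>)
  then have small: "\<bar>r\<bar> * (\<Sum>k<X. \<bar>y k\<bar>) \<le> 1"
    using \<sigma> M by (simp add: r_def field_simps)
  then have small': "\<bar>-r\<bar> * (\<Sum>k<X. \<bar>y k\<bar>) \<le> 1" by simp
  have r2: "r\<^sup>2 * (\<Sum>k<X. (y k)\<^sup>2 / 2 ^ k) / 2 = 1 / (2 * real M)"
    unfolding \<sigma>(2)[symmetric] r_def using \<sigma>(1) M by (simp add: power_divide power_mult_distrib)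
  have pw: "(1 + 1 / (2 * real M)) ^ M \<le> exp (1/2)"
  proof -
    have "(1 + 1 / (2 * real M)) ^ M \<le> exp (1 / (2 * real M)) ^ M"
      by (intro power_mono exp_ge_add_one_self) auto
    also have "\<dots> = exp (1/2)" using assms by (simp flip: exp_of_nat_mult)
    finally show ?thesis .
  qed
  note E1 = exp_moment_csum[OF assms(1) small, of M]
  note E2 = exp_moment_csum[OF assms(1) small', of M]
  \<comment> \<open>The inequality \<open>x \<le> exp x\<close> at
    \<open>x = r * \<bar>csum\<bar> / s\<close>, raised to the power \<open>s\<close>, trades the
    \<open>s\<close>-th moment for the exponential moments at \<open>r\<close> and
    \<open>-r\<close>.\<close>
  have pt: "norm (complex_of_real (csum y X W M t)) powr s \<le> (s/r) powr s * (exp (r * csum y X W M t) + exp (- r * csum y X W M t))" for t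
  proof -
    let ?u = "\<bar>csum y X W M t\<bar>"
    have "r * ?u / s \<le> exp (r * ?u / s)" using exp_ge_add_one_self[of "r * ?u / s"] by linarith
    then have "?u * r / s \<le> exp (r * ?u / s)" by (simp add: mult.commute)
    then have "(?u * r / s) powr s \<le> exp (r * ?u / s) powr s" using assms r by (intro powr_mono2) auto
    also have "\<dots> = exp (r * ?u)" using assms by (simp add: powr_def)
    also have "\<dots> \<le> exp (r * csum y X W M t) + exp (- r * csum y X W M t)" by (simp add: abs_if)
    finally have "(s/r) powr s * (?u * r / s) powr s \<le> (s/r) powr s * (exp (r * csum y X W M t) + exp (- r * csum y X W M t))"
      by (rule mult_left_mono) simp
    also have "(s/r) powr s * (?u * r / s) powr s = ?u powr s"
      unfolding powr_mult[symmetric] using assms r by simp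
    finally show ?thesis by simp
  qed
  have "integral\<^sup>L MI (\<lambda>t. norm (complex_of_real (csum y X W M t)) powr s) \<le> integral\<^sup>L MI (\<lambda>t. (s/r) powr s * (exp (r * csum y X W M t) + exp (- r * csum y X W M t)))"
    by (rule integral_mono') (use E1(1) E2(1) pt in auto)
  also have "\<dots> = (s/r) powr s * (integral\<^sup>L MI (\<lambda>t. exp (r * csum y X W M t)) + integral\<^sup>L MI (\<lambda>t. exp (- r * csum y X W M t)))"
    using E1(1) E2(1) by simp
  also have "\<dots> \<le> (s/r) powr s * (exp (1/2) + exp (1/2))"
    using E1(2) E2(2) pw r2 by (intro mult_left_mono add_mono) auto
  finally have "Lq_norm s (\<lambda>t. of_real (csum y X W M t)) \<le> ((s/r) powr s * (2 * exp (1/2))) powr (1/s)"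
    unfolding Lq_norm_def using assms by (intro powr_mono2) auto
  also have "\<dots> = (s/r) * (2 * exp (1/2)) powr (1/s)"
    using assms r by (simp add: powr_mult powr_powr)
  also have "\<dots> = s * (2 * exp (1/2)) powr (1/s) * (sqrt (real M) * \<sigma>)"
    by (simp add: r_def mult_ac)
  finally show ?thesis by (simp add: \<sigma>_def)
qed

text \<open>The threshold depends on \<open>y\<close>. This does no harm, because \<open>M\<close>
  cancels from the final inequality.\<close>

lemma large_copies:
  "\<exists>M0. \<forall>M\<ge>M0. (\<Sum>k<X. \<bar>y k\<bar>)\<^sup>2 \<le> real M * (\<Sum>k<X. (y k)\<^sup>2 / 2 ^ k)"
proof (cases "(\<Sum>k<X. (y k)\<^sup>2 / 2 ^ k) = 0")
  case True
  then have "y k = 0" if "k < X" for k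
    using that by (subst (asm) sum_nonneg_eq_0_iff) auto
  then show ?thesis by simp
next
  case False
  have "(\<Sum>k<X. (y k)\<^sup>2 / 2 ^ k) \<ge> 0" by (intro sum_nonneg) auto
  then have pos: "(\<Sum>k<X. (y k)\<^sup>2 / 2 ^ k) > 0" using False by linarith
  obtain M0 where "(\<Sum>k<X. \<bar>y k\<bar>)\<^sup>2 \<le> real M0 * (\<Sum>k<X. (y k)\<^sup>2 / 2 ^ k)"
    using reals_Archimedean3[OF pos] less_imp_le by blast
  moreover have "real M0 * (\<Sum>k<X. (y k)\<^sup>2 / 2 ^ k) \<le> real M * (\<Sum>k<X. (y k)\<^sup>2 / 2 ^ k)" if "M \<ge> M0" for M
    using pos that by (intro mult_right_mono) auto
  ultimately show ?thesis by (meson order.trans)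
qed

lemma chaos_finite:
  assumes "\<And>k. k \<ge> X \<Longrightarrow> x k = 0"
  shows "chaos x n t = (\<Sum>k<X. x k * haarC (2 ^ k * n) t)"
  unfolding chaos_def by (rule suminf_finite) (use assms in auto)

text \<open>The constant of the real moment bound; the factor 2 pays for treating real and imaginary
  parts separately.\<close>

definition khinchin_const :: "real \<Rightarrow> real" where
  "khinchin_const s = 2 * (s * (2 * exp (1/2)) powr (1/s))"

lemma khinchin_const_nonneg: "s \<ge> 1 \<Longrightarrow> khinchin_const s \<ge> 0"
  by (simp add: khinchin_const_def)

lemma moment_copies:
  assumes X: "\<And>k. k \<ge> X \<Longrightarrow> x k = 0" and "X < W" "s \<ge> 1"
  shows "\<exists>M0. \<forall>M\<ge>M0. Lq_norm s (\<lambda>t. \<Sum>n\<in>copies W M. chaos x n t) \<le> khinchin_const s * (sqrt (real M) * wnorm X x)"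
proof -
  obtain M1 where M1: "\<And>M. M \<ge> M1 \<Longrightarrow> (\<Sum>k<X. \<bar>Re (x k)\<bar>)\<^sup>2 \<le> real M * (\<Sum>k<X. (Re (x k))\<^sup>2 / 2 ^ k)"
    using large_copies by meson
  obtain M2 where M2: "\<And>M. M \<ge> M2 \<Longrightarrow> (\<Sum>k<X. \<bar>Im (x k)\<bar>)\<^sup>2 \<le> real M * (\<Sum>k<X. (Im (x k))\<^sup>2 / 2 ^ k)"
    using large_copies by meson
  let ?K = "s * (2 * exp (1/2)) powr (1/s)"
  have re: "sqrt (\<Sum>k<X. (Re (x k))\<^sup>2 / 2 ^ k) \<le> wnorm X x" "sqrt (\<Sum>k<X. (Im (x k))\<^sup>2 / 2 ^ k) \<le> wnorm X x"
    unfolding wnorm_def by (intro real_sqrt_le_mono sum_mono divide_right_mono; simp add: cmod_power2)+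
  show ?thesis
  proof (intro exI[of _ "max 1 (max M1 M2)"] allI impI)
    fix M assume "max 1 (max M1 M2) \<le> M"
    then have M: "M \<ge> 1" "M \<ge> M1" "M \<ge> M2" by auto
    let ?R = "\<lambda>t. complex_of_real (csum (\<lambda>k. Re (x k)) X W M t)" and ?I = "\<lambda>t. complex_of_real (csum (\<lambda>k. Im (x k)) X W M t)"
    have L: "Lq s (\<lambda>t. complex_of_real (csum y X W M t))" for y
      unfolding csum_def of_real_sum of_real_mult using assms copies_ge_1 by (intro Lq_sum Lq_cmult Lq_haarC) (auto simp: Suc_le_eq)
    have "(\<Sum>n\<in>copies W M. chaos x n t) = ?R t + \<i> * ?I t" for t
      unfolding csum_def of_real_sum of_real_mult sum_distrib_left sum.distrib[symmetric]
      by (intro sum.cong refl) (subst chaos_finite[OF X], simp, intro sum.cong refl, simp add: complex_eq_iff)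
    then have "Lq_norm s (\<lambda>t. \<Sum>n\<in>copies W M. chaos x n t) = Lq_norm s (\<lambda>t. ?R t + \<i> * ?I t)" by simp
    also have "\<dots> \<le> Lq_norm s ?R + Lq_norm s (\<lambda>t. \<i> * ?I t)"
      using assms by (intro Lq_norm_triangle Lq_cmult L) auto
    also have "Lq_norm s (\<lambda>t. \<i> * ?I t) = Lq_norm s ?I" using assms by (subst Lq_norm_cmult) auto
    also have "Lq_norm s ?R \<le> ?K * (sqrt (real M) * wnorm X x)"
      by (rule order.trans[OF moment_csum[OF assms(2,3) M(1) M1[OF M(2)]]]) (intro mult_left_mono re, use assms in auto)
    also have "Lq_norm s ?I \<le> ?K * (sqrt (real M) * wnorm X x)"
      by (rule order.trans[OF moment_csum[OF assms(2,3) M(1) M2[OF M(3)]]]) (intro mult_left_mono re, use assms in auto)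
    finally show "Lq_norm s (\<lambda>t. \<Sum>n\<in>copies W M. chaos x n t) \<le> khinchin_const s * (sqrt (real M) * wnorm X x)"
      by (simp add: khinchin_const_def mult_ac)
  qed
qed

text \<open>Copies start at odd indices, so the chains of distinct copies are disjoint and
  orthogonality leaves equal copies and equal \<open>k\<close>. The intervals of each block have
  total length \<open>1/2\<close>, hence \<open>M/2\<close>. Without conjugation the form stays
  bilinear.\<close>

lemma pairing_copies:
  assumes q: "q > 1" and y: "summable (\<lambda>k. norm (y k) * (2 powr (-1/q)) ^ k)"
    and z: "\<And>k. k \<ge> X \<Longrightarrow> z k = 0" and W: "W \<ge> 1"
  shows "integral\<^sup>L MI (\<lambda>t. (\<Sum>n\<in>copies W M. chaos y n t) * (\<Sum>n\<in>copies W M. chaos z n t))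
    = of_real (real M / 2) * (\<Sum>k<X. y k * z k / 2 ^ k)"
proof -
  let ?A = "copies W M"
  have pos: "1 \<le> 2 ^ k * n" if "n \<in> ?A" for k n using copies_ge_1[OF that] by (simp add: Suc_le_eq)
  have i: "integrable MI (\<lambda>t. chaos y n t * haarC (2 ^ k * n') t)" if "n \<in> ?A" "n' \<in> ?A" for n n' k
    by (rule Lq_pairing_le(1)[OF q Lq_chaos(1)[OF _ _ y] haarC_measurable norm_haarC_le[OF pos[OF that(2)]]])
       (use q copies_ge_1[OF that(1)] in auto)
  have val: "integral\<^sup>L MI (\<lambda>t. chaos y n t * haarC (2 ^ k * n') t) = (if n = n' then y k / 2 ^ k * (1 / 2 ^ dlog n) else 0)"
    if n: "n \<in> ?A" "n' \<in> ?A" for n n' k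
  proof -
    obtain m where m: "n = Suc (2 * m)" using copies_E[OF n(1)] by metis
    obtain m' where m': "n' = Suc (2 * m')" using copies_E[OF n(2)] by metis
    have eq: "2 ^ j * n = 2 ^ k * n' \<longleftrightarrow> j = k \<and> n = n'" for j
      unfolding m m' inj_pow2_odd by simp
    have kl: "k < 2 ^ k * n'"
    proof -
      have "k < 2 ^ k" by (rule less_exp)
      also have "(2::nat) ^ k \<le> 2 ^ k * n'" using copies_ge_1[OF n(2)] by simp
      finally show ?thesis .
    qed
    have "integral\<^sup>L MI (\<lambda>t. chaos y n t * haarC (2 ^ k * n') t) = (\<Sum>j<2 ^ k * n'. if 2 ^ j * n = 2 ^ k * n' then y j else 0) / 2 ^ dlog (2 ^ k * n')"
      by (rule integral_chaos_haar[OF q copies_ge_1[OF n(1)] y pos[OF n(2)]])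
    also have "(\<Sum>j<2 ^ k * n'. if 2 ^ j * n = 2 ^ k * n' then y j else 0) = (\<Sum>j<2 ^ k * n'. if j = k then (if n = n' then y k else 0) else 0)"
      by (intro sum.cong refl) (simp add: eq)
    also have "\<dots> = (if n = n' then y k else 0)" using kl by simp
    finally show ?thesis using copies_ge_1[OF n(2)] by (simp add: dlog_mult_pow2 power_add)
  qed
  have ex: "(\<Sum>n\<in>?A. chaos y n t) * (\<Sum>n\<in>?A. chaos z n t) = (\<Sum>n\<in>?A. \<Sum>n'\<in>?A. \<Sum>k<X. z k * (chaos y n t * haarC (2 ^ k * n') t))" for t
    unfolding sum_product by (intro sum.cong refl) (simp add: chaos_finite[OF z] sum_distrib_left mult_ac)
  have "integral\<^sup>L MI (\<lambda>t. (\<Sum>n\<in>?A. chaos y n t) * (\<Sum>n\<in>?A. chaos z n t)) = 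
     (\<Sum>n\<in>?A. \<Sum>n'\<in>?A. \<Sum>k<X. z k * integral\<^sup>L MI (\<lambda>t. chaos y n t * haarC (2 ^ k * n') t))"
    unfolding ex using i by (simp add: Bochner_Integration.integral_sum)
  also have "\<dots> = (\<Sum>n\<in>?A. \<Sum>n'\<in>?A. if n = n' then (\<Sum>k<X. y k * z k / 2 ^ k) * (1 / 2 ^ dlog n) else 0)"
  proof (intro sum.cong refl)
    fix n n' assume n: "n \<in> ?A" "n' \<in> ?A"
    show "(\<Sum>k<X. z k * integral\<^sup>L MI (\<lambda>t. chaos y n t * haarC (2 ^ k * n') t)) = (if n = n' then (\<Sum>k<X. y k * z k / 2 ^ k) * (1 / 2 ^ dlog n) else 0)"
      unfolding val[OF n] by (cases "n = n'") (simp_all add: sum_divide_distrib mult_ac)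
  qed
  also have "\<dots> = (\<Sum>n\<in>?A. (\<Sum>k<X. y k * z k / 2 ^ k) * of_real (1 / 2 ^ dlog n))"
    by simp
  also have "\<dots> = (\<Sum>k<X. y k * z k / 2 ^ k) * of_real (\<Sum>n\<in>?A. 1 / 2 ^ dlog n)"
    unfolding of_real_sum sum_distrib_left ..
  finally show ?thesis unfolding copies_weight[OF W] by (simp add: mult.commute)
qed

subsection \<open>Multipliers\<close>

definition cauchy_prod :: "(nat \<Rightarrow> complex) \<Rightarrow> (nat \<Rightarrow> complex) \<Rightarrow> nat \<Rightarrow> complex" where
  "cauchy_prod e x k = (\<Sum>i\<le>k. e i * x (k - i))"

lemma cauchy_prod_summable:
  fixes r :: real
  assumes r: "r \<ge> 0" and e: "summable (\<lambda>k. norm (e k) * r ^ k)" and x: "summable (\<lambda>k. norm (x k) * r ^ k)"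
  shows "summable (\<lambda>k. norm (cauchy_prod e x k) * r ^ k)"
    and "(\<Sum>k. norm (cauchy_prod e x k) * r ^ k) \<le> (\<Sum>k. norm (e k) * r ^ k) * (\<Sum>k. norm (x k) * r ^ k)"
proof -
  let ?a = "\<lambda>k. norm (e k) * r ^ k" and ?b = "\<lambda>k. norm (x k) * r ^ k"
  have n: "summable (\<lambda>k. norm (?a k))" "summable (\<lambda>k. norm (?b k))" using e x r by auto
  have s: "summable (\<lambda>k. \<Sum>i\<le>k. ?a i * ?b (k - i))" by (rule summable_Cauchy_product[OF n])
  have le: "norm (cauchy_prod e x k) * r ^ k \<le> (\<Sum>i\<le>k. ?a i * ?b (k - i))" for k
  proof -
    have "norm (cauchy_prod e x k) \<le> (\<Sum>i\<le>k. norm (e i) * norm (x (k - i)))"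
      unfolding cauchy_prod_def by (rule order.trans[OF norm_sum]) (simp add: norm_mult)
    then have "norm (cauchy_prod e x k) * r ^ k \<le> (\<Sum>i\<le>k. norm (e i) * norm (x (k - i))) * r ^ k"
      using r by (intro mult_right_mono) auto
    also have "\<dots> = (\<Sum>i\<le>k. ?a i * ?b (k - i))"
      unfolding sum_distrib_right
    proof (intro sum.cong refl)
      fix i assume "i \<in> {..k}"
      then have "r ^ k = r ^ i * r ^ (k - i)" by (simp flip: power_add)
      then show "norm (e i) * norm (x (k - i)) * r ^ k = ?a i * ?b (k - i)" by (simp add: mult_ac)
    qed
    finally show ?thesis .
  qed
  show 1: "summable (\<lambda>k. norm (cauchy_prod e x k) * r ^ k)"
    by (rule summable_comparison_test'[OF s, of 0]) (use le r in auto)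
  show "(\<Sum>k. norm (cauchy_prod e x k) * r ^ k) \<le> suminf ?a * suminf ?b"
    unfolding Cauchy_product[OF n] by (rule suminf_le[OF le 1 s])
qed

text \<open>The pairing over \<open>M\<close> copies is \<open>M/2\<close> times the form, while
  Hoelder and the hypothesis bound it by a product of two quantities of order \<open>sqrt M\<close>.
  So \<open>M\<close> drops out, and \<open>D\<close> is uniform although the required size of
  \<open>M\<close> depends on \<open>x\<close> and \<open>z\<close>.\<close>

lemma multiplier_bound:
  assumes q: "q > 1" and e: "summable (\<lambda>k. norm (e k) * (2 powr (-1/q)) ^ k)" and C: "C \<ge> 0"
    and H: "\<And>A x X. finite A \<Longrightarrow> (\<And>n. n \<in> A \<Longrightarrow> n \<ge> 1) \<Longrightarrow> (\<And>k. k \<ge> X \<Longrightarrow> x k = 0) \<Longrightarrow>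
      Lq_norm q (\<lambda>t. \<Sum>n\<in>A. chaos (cauchy_prod e x) n t) \<le> C * Lq_norm q (\<lambda>t. \<Sum>n\<in>A. chaos x n t)"
  shows "\<exists>D\<ge>0. \<forall>X x z. (\<forall>k\<ge>X. x k = 0) \<longrightarrow> (\<forall>k\<ge>X. z k = 0) \<longrightarrow>
      norm (\<Sum>k<X. cauchy_prod e x k * z k / 2 ^ k) \<le> D * (wnorm X x * wnorm X z)"
proof -
  define q' where "q' = q / (q - 1)"
  have q': "q' > 0" "1/q + 1/q' = 1" "q' \<ge> 1" using q by (auto simp: q'_def field_simps)
  define D where "D = 2 * (C * khinchin_const q * khinchin_const q')"
  have q1: "q \<ge> 1" "q > 0" using q by auto
  have D: "D \<ge> 0" unfolding D_def using C khinchin_const_nonneg q1 q' by simp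
  have "norm (\<Sum>k<X. cauchy_prod e x k * z k / 2 ^ k) \<le> D * (wnorm X x * wnorm X z)"
    if x: "\<forall>k\<ge>X. x k = 0" and z: "\<forall>k\<ge>X. z k = 0" for X x z
  proof -
    define W where "W = Suc X"
    have W: "X < W" "W \<ge> 1" by (auto simp: W_def)
    obtain M1 where M1: "\<And>M. M \<ge> M1 \<Longrightarrow> Lq_norm q (\<lambda>t. \<Sum>n\<in>copies W M. chaos x n t) \<le> khinchin_const q * (sqrt (real M) * wnorm X x)"
      using moment_copies[of X x W q] x W q1 by auto
    obtain M2 where M2: "\<And>M. M \<ge> M2 \<Longrightarrow> Lq_norm q' (\<lambda>t. \<Sum>n\<in>copies W M. chaos z n t) \<le> khinchin_const q' * (sqrt (real M) * wnorm X z)"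
      using moment_copies[of X z W q'] z W q' by auto
    define M where "M = max 1 (max M1 M2)"
    have M: "M \<ge> 1" "M \<ge> M1" "M \<ge> M2" by (auto simp: M_def)
    let ?A = "copies W M"
    have sx: "summable (\<lambda>k. norm (x k) * (2 powr (-1/q)) ^ k)"
      by (rule summable_finite[of "{..<X}"]) (use x in auto)
    have sy: "summable (\<lambda>k. norm (cauchy_prod e x k) * (2 powr (-1/q)) ^ k)"
      by (rule cauchy_prod_summable(1)[OF _ e sx]) simp
    have sz: "summable (\<lambda>k. norm (z k) * (2 powr (-1/q')) ^ k)"
      by (rule summable_finite[of "{..<X}"]) (use z in auto)
    have L1: "Lq q (\<lambda>t. \<Sum>n\<in>?A. chaos (cauchy_prod e x) n t)"
      by (intro Lq_sum Lq_chaos(1) q1 sy copies_ge_1)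
    have L2: "Lq q' (\<lambda>t. \<Sum>n\<in>?A. chaos z n t)"
      by (intro Lq_sum Lq_chaos(1) q' sz copies_ge_1)
    have "norm (of_real (real M / 2) * (\<Sum>k<X. cauchy_prod e x k * z k / 2 ^ k))
       = norm (integral\<^sup>L MI (\<lambda>t. (\<Sum>n\<in>?A. chaos (cauchy_prod e x) n t) * (\<Sum>n\<in>?A. chaos z n t)))"
      by (subst pairing_copies[OF q sy _ W(2), of X z]) (use z in auto)
    also have "\<dots> \<le> integral\<^sup>L MI (\<lambda>t. norm ((\<Sum>n\<in>?A. chaos (cauchy_prod e x) n t) * (\<Sum>n\<in>?A. chaos z n t)))"
      by (rule integral_norm_bound)
    also have "\<dots> \<le> Lq_norm q (\<lambda>t. \<Sum>n\<in>?A. chaos (cauchy_prod e x) n t) * Lq_norm q' (\<lambda>t. \<Sum>n\<in>?A. chaos z n t)"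
      by (rule Holder_inequality(2)[OF q1(2) q'(1,2) L1 L2])
    also have "\<dots> \<le> (C * (khinchin_const q * (sqrt (real M) * wnorm X x))) * (khinchin_const q' * (sqrt (real M) * wnorm X z))"
    proof (rule mult_mono)
      have "Lq_norm q (\<lambda>t. \<Sum>n\<in>?A. chaos (cauchy_prod e x) n t) \<le> C * Lq_norm q (\<lambda>t. \<Sum>n\<in>?A. chaos x n t)"
        by (rule H[of _ X]) (use x copies_ge_1 in auto)
      also have "\<dots> \<le> C * (khinchin_const q * (sqrt (real M) * wnorm X x))"
        by (intro mult_left_mono M1 M C)
      finally show "Lq_norm q (\<lambda>t. \<Sum>n\<in>?A. chaos (cauchy_prod e x) n t) \<le> C * (khinchin_const q * (sqrt (real M) * wnorm X x))" .
      show "0 \<le> C * (khinchin_const q * (sqrt (real M) * wnorm X x))"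
        using C khinchin_const_nonneg[OF q1(1)] by (intro mult_nonneg_nonneg) (auto simp: wnorm_def intro!: sum_nonneg)
    qed (use M2[OF M(3)] in auto)
    also have "\<dots> = (sqrt (real M) * sqrt (real M)) * (C * khinchin_const q * khinchin_const q' * (wnorm X x * wnorm X z))"
      by (simp only: mult_ac)
    also have "\<dots> = (real M / 2) * (D * (wnorm X x * wnorm X z))"
      by (simp add: D_def)
    finally have "(real M / 2) * norm (\<Sum>k<X. cauchy_prod e x k * z k / 2 ^ k) \<le> (real M / 2) * (D * (wnorm X x * wnorm X z))"
      by (simp add: norm_mult)
    then show ?thesis using M(1) by simp
  qed
  with D show ?thesis by blast
qed

lemma half_root_power_sq: "((2 powr (-1/2)) ^ k)\<^sup>2 = 1 / (2::real) ^ k"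
proof -
  have "((2 powr (-1/2)) ^ k)\<^sup>2 = ((2 powr (-1/2))\<^sup>2) ^ k" by (simp add: power_mult[symmetric] mult.commute)
  also have "(2 powr (-1/2))\<^sup>2 = (1/2::real)"
    by (simp add: power2_eq_square powr_add[symmetric] powr_minus_divide)
  finally show ?thesis by (simp add: power_one_over)
qed

text \<open>A bounded bilinear form \<open>(x, z) \<mapsto> \<Sum>k. (e * x) k * z k / 2^k\<close> means that multiplication by the symbol
  of \<open>e\<close> is bounded on the Hardy space of the disk of radius \<open>2 powr (-1/2)\<close>; testing with reproducing kernels
  bounds the symbol.\<close>

lemma multiplier_bounded_analytic:
  assumes D: "D \<ge> 0" and bound: "\<And>X x z. (\<forall>k\<ge>X. x k = 0) \<Longrightarrow> (\<forall>k\<ge>X. z k = 0) \<Longrightarrow>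
      norm (\<Sum>k<X. cauchy_prod e x k * z k / 2 ^ k) \<le> D * (wnorm X x * wnorm X z)"
    and w: "norm w < 2 powr (-1/2)"
  shows "summable (\<lambda>k. norm (e k * w ^ k))" and "norm (symbol e w) \<le> D"
proof -
  define s where "s = (2::real) powr (-1/2)"
  have s: "s > 0" by (simp add: s_def)
  \<comment> \<open>Unit sequences at 0 and \<open>k\<close> give
    \<open>norm (e k) / 2^k \<le> D * 2^(-k/2)\<close>. This secures absolute convergence in the
    open disk before the symbol itself is estimated.\<close>
  have coef: "norm (e k) * s ^ k \<le> D" for k
  proof -
    define x z :: "nat \<Rightarrow> complex" where "x j = (if j = 0 then 1 else 0)" and "z j = (if j = k then 1 else 0)" for j
    have cp: "cauchy_prod e x j = e j" for j
    proof -
      have "cauchy_prod e x j = (\<Sum>i\<le>j. if i = j then e i else 0)"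
        unfolding cauchy_prod_def x_def by (intro sum.cong) auto
      then show ?thesis by simp
    qed
    have "(\<Sum>j<Suc k. cauchy_prod e x j * z j / 2 ^ j) = (\<Sum>j<Suc k. if j = k then e k / 2 ^ k else 0)"
      by (intro sum.cong) (auto simp: cp z_def)
    then have "norm (e k / 2 ^ k) \<le> D * (wnorm (Suc k) x * wnorm (Suc k) z)"
      using bound[of "Suc k" x z] by (simp add: x_def z_def)
    also have "(\<Sum>j<Suc k. (norm (x j))\<^sup>2 / 2 ^ j) = (\<Sum>j<Suc k. if j = 0 then 1 else 0)"
      by (intro sum.cong) (auto simp: x_def)
    then have "wnorm (Suc k) x = 1" by (simp add: wnorm_def)
    also have "(\<Sum>j<Suc k. (norm (z j))\<^sup>2 / 2 ^ j) = (\<Sum>j<Suc k. if j = k then 1 / 2 ^ k else 0)"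
      by (intro sum.cong) (auto simp: z_def)
    then have "wnorm (Suc k) z = s ^ k"
      using s by (simp add: wnorm_def s_def half_root_power_sq[symmetric])
    finally have "norm (e k) * (s ^ k)\<^sup>2 \<le> D * s ^ k"
      unfolding s_def half_root_power_sq by (simp add: norm_divide norm_power)
    then have "(norm (e k) * s ^ k) * s ^ k \<le> D * s ^ k" by (simp add: power2_eq_square mult.assoc)
    then show ?thesis using s by simp
  qed
  have g: "norm (norm w / s) < 1" using w s by (simp add: s_def)
  show sm: "summable (\<lambda>k. norm (e k * w ^ k))"
  proof (rule summable_comparison_test'[of "\<lambda>k. D * (norm w / s) ^ k" 0])
    show "summable (\<lambda>k. D * (norm w / s) ^ k)" by (intro summable_mult summable_geometric g)
    fix k
    have "norm (e k) * s ^ k * (norm w / s) ^ k \<le> D * (norm w / s) ^ k"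
      using s by (intro mult_right_mono coef) auto
    then show "norm (norm (e k * w ^ k)) \<le> D * (norm w / s) ^ k"
      using s by (simp add: norm_mult norm_power power_divide)
  qed
  define \<rho> where "\<rho> = 2 * (norm w)\<^sup>2"
  have "(norm w)\<^sup>2 < s\<^sup>2" using w s by (intro power_strict_mono) (auto simp: s_def)
  then have \<rho>: "\<rho> < 1" "\<rho> \<ge> 0" using half_root_power_sq[of 1] by (auto simp: \<rho>_def s_def)
  have gs: "summable (\<lambda>k. \<rho> ^ k)" using \<rho> by (intro summable_geometric) simp
  define S where "S L = (\<Sum>k<L. \<rho> ^ k)" for L :: nat
  \<comment> \<open>Truncated reproducing kernels. Against the weight \<open>2^(-k)\<close>, the
    sequence \<open>z\<close> evaluates a power series at \<open>w\<close>. The conjugate in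
    \<open>x\<close> makes its symbol at \<open>w\<close> the positive number \<open>S L\<close>,
    which is also the square of its norm.\<close>
  define x where "x L k = (if k < L then (2 * cnj w) ^ k else 0)" for L k :: nat
  define z where "z X k = (if k < X then (2 * w) ^ k else 0)" for X k :: nat
  have nrm: "(norm ((2 * u) ^ k))\<^sup>2 / 2 ^ k = \<rho> ^ k" if "norm u = norm w" for u :: complex and k
  proof -
    have "norm ((2 * u) ^ k) = (2 * norm w) ^ k" using that by (simp add: norm_power norm_mult)
    then have "(norm ((2 * u) ^ k))\<^sup>2 = ((2 * norm w)\<^sup>2) ^ k"
      by (simp only: power_mult[symmetric] mult.commute)
    moreover have "(2 * norm w)\<^sup>2 / 2 = \<rho>" by (simp add: \<rho>_def power_mult_distrib)
    ultimately show ?thesis by (simp only: power_divide[symmetric])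
  qed
  have wz: "wnorm X (z X) = sqrt (S X)" for X
    unfolding wnorm_def S_def by (intro arg_cong[of _ _ sqrt] sum.cong refl)
      (simp only: z_def lessThan_iff if_True nrm[OF refl])
  have wx: "wnorm X (x L) = sqrt (S L)" if "L \<le> X" for X L
  proof -
    have "(\<Sum>k<X. (norm (x L k))\<^sup>2 / 2 ^ k) = (\<Sum>k<L. (norm (x L k))\<^sup>2 / 2 ^ k)"
      using that by (intro sum.mono_neutral_right) (auto simp: x_def)
    also have "\<dots> = S L" unfolding S_def
      by (intro sum.cong refl) (simp only: x_def lessThan_iff if_True nrm[OF complex_mod_cnj])
    finally show ?thesis by (simp add: wnorm_def)
  qed
  define E where "E = (\<Sum>k. e k * w ^ k)"
  have lim: "(\<lambda>X. \<Sum>k<X. cauchy_prod e (x L) k * z X k / 2 ^ k) \<longlonglongrightarrow> E * of_real (S L)" for L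
  proof -
    have sx: "summable (\<lambda>k. norm (x L k * w ^ k))"
      by (rule summable_finite[of "{..<L}"]) (auto simp: x_def)
    have "(\<Sum>k. x L k * w ^ k) = (\<Sum>k<L. x L k * w ^ k)"
      by (rule suminf_finite) (auto simp: x_def)
    also have "\<dots> = (\<Sum>k<L. of_real (\<rho> ^ k))"
    proof (intro sum.cong refl)
      fix k assume "k \<in> {..<L}"
      then have "x L k * w ^ k = (2 * (w * cnj w)) ^ k" by (simp add: x_def power_mult_distrib)
      also have "2 * (w * cnj w) = of_real \<rho>" by (simp add: \<rho>_def complex_norm_square[symmetric])
      finally show "x L k * w ^ k = of_real (\<rho> ^ k)" by simp
    qed
    finally have xs: "(\<Sum>k. x L k * w ^ k) = of_real (S L)" by (simp add: S_def)
    have "(\<lambda>k. \<Sum>i\<le>k. (e i * w ^ i) * (x L (k - i) * w ^ (k - i))) sums (E * of_real (S L))"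
      using Cauchy_product_sums[OF sm sx] unfolding xs E_def .
    also have "(\<lambda>k. \<Sum>i\<le>k. (e i * w ^ i) * (x L (k - i) * w ^ (k - i))) = (\<lambda>k. cauchy_prod e (x L) k * w ^ k)"
    proof
      fix k
      have "w ^ i * w ^ (k - i) = w ^ k" if "i \<le> k" for i using that by (simp flip: power_add)
      then show "(\<Sum>i\<le>k. (e i * w ^ i) * (x L (k - i) * w ^ (k - i))) = cauchy_prod e (x L) k * w ^ k"
        unfolding cauchy_prod_def sum_distrib_right by (intro sum.cong refl) (simp add: mult_ac)
    qed
    finally have "(\<lambda>X. \<Sum>k<X. cauchy_prod e (x L) k * w ^ k) \<longlonglongrightarrow> E * of_real (S L)" by (simp add: sums_def)
    moreover have "(\<Sum>k<X. cauchy_prod e (x L) k * z X k / 2 ^ k) = (\<Sum>k<X. cauchy_prod e (x L) k * w ^ k)" for X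
      by (intro sum.cong refl) (simp add: z_def power_mult_distrib)
    ultimately show ?thesis by simp
  qed
  have Slim: "S \<longlonglongrightarrow> 1 / (1 - \<rho>)"
    using geometric_sums[of \<rho>] \<rho> unfolding S_def sums_def by simp
  have Sle: "S X \<le> 1 / (1 - \<rho>)" for X
    unfolding S_def using sum_le_suminf[OF gs, of "{..<X}"] \<rho> suminf_geometric[of \<rho>] by simp
  \<comment> \<open>Two separate truncations: \<open>X\<close> tends to infinity with
    \<open>L\<close> fixed, since \<open>cauchy_prod e (x L)\<close> need not have finite support,
    and \<open>L\<close> follows afterwards.\<close>
  have *: "norm E * S L \<le> D * (sqrt (S L) * sqrt (1 / (1 - \<rho>)))" for L
  proof (rule LIMSEQ_le_const2)
    have S0: "S L \<ge> 0" unfolding S_def using \<rho> by (intro sum_nonneg) auto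
    show "(\<lambda>X. norm (\<Sum>k<X. cauchy_prod e (x L) k * z X k / 2 ^ k)) \<longlonglongrightarrow> norm E * S L"
      using tendsto_norm[OF lim[of L]] S0 by (simp add: norm_mult)
    show "\<exists>N. \<forall>X\<ge>N. norm (\<Sum>k<X. cauchy_prod e (x L) k * z X k / 2 ^ k) \<le> D * (sqrt (S L) * sqrt (1 / (1 - \<rho>)))"
    proof (intro exI[of _ L] allI impI)
      fix X assume X: "L \<le> X"
      have "norm (\<Sum>k<X. cauchy_prod e (x L) k * z X k / 2 ^ k) \<le> D * (wnorm X (x L) * wnorm X (z X))"
        by (rule bound) (use X in \<open>auto simp: x_def z_def\<close>)
      also have "\<dots> \<le> D * (sqrt (S L) * sqrt (1 / (1 - \<rho>)))"
        unfolding wz wx[OF X] using S0 by (intro mult_left_mono real_sqrt_le_mono Sle D) auto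
      finally show "norm (\<Sum>k<X. cauchy_prod e (x L) k * z X k / 2 ^ k) \<le> D * (sqrt (S L) * sqrt (1 / (1 - \<rho>)))" .
    qed
  qed
  have l1: "(\<lambda>L. norm E * S L) \<longlonglongrightarrow> norm E * (1 / (1 - \<rho>))"
    by (intro tendsto_intros Slim)
  have l2: "(\<lambda>L. D * (sqrt (S L) * sqrt (1 / (1 - \<rho>)))) \<longlonglongrightarrow> D * (sqrt (1 / (1 - \<rho>)) * sqrt (1 / (1 - \<rho>)))"
    by (intro tendsto_intros Slim)
  have "norm E * (1 / (1 - \<rho>)) \<le> D * (sqrt (1 / (1 - \<rho>)) * sqrt (1 / (1 - \<rho>)))"
    by (rule LIMSEQ_le[OF l1 l2]) (use * in blast)
  also have "\<dots> = D * (1 / (1 - \<rho>))" using \<rho> by simp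
  finally have "norm E \<le> D" using \<rho> by (simp add: divide_le_cancel)
  then show "norm (symbol e w) \<le> D" by (simp add: symbol_def E_def)
qed

section \<open>From an isomorphism to multiplier inequalities\<close>

lemma cauchy_prod_fps: "cauchy_prod e x = fps_nth (Abs_fps e * Abs_fps x)"
  by (simp add: fun_eq_iff cauchy_prod_def fps_mult_nth atMost_atLeast0)

lemma chaos_diff:
  assumes "n \<ge> 1" shows "chaos (\<lambda>k. x k - y k) n t = chaos x n t - chaos y n t"
proof -
  have "(\<lambda>k. x k * haarC (2 ^ k * n) t - y k * haarC (2 ^ k * n) t) sums (chaos x n t - chaos y n t)"
    by (intro sums_diff chaos_sums assms)
  then show ?thesis unfolding chaos_def[of "\<lambda>k. x k - y k"] by (simp add: sums_iff left_diff_distrib)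
qed

text \<open>Applying the series of \<open>c_m V^m\<close> to a finite chaos and regrouping by powers
  of \<open>V\<close>. It expresses the image of \<open>chaos x n\<close> under
  \<open>h_m \<mapsto> f_m\<close> as a chaos with coefficients \<open>c * x\<close>.\<close>

lemma chaos_cauchy_prod:
  assumes n: "n \<ge> 1" and x: "\<And>k. k \<ge> X \<Longrightarrow> x k = 0"
  shows "chaos (cauchy_prod c x) n t = (\<Sum>k<X. x k * chaos c (2 ^ k * n) t)"
proof -
  \<comment> \<open>The \<open>k\<close>-th series shifted by \<open>k\<close> places and padded
    with zeros, so that all the series run over the same Haar functions
    \<open>2^j * n\<close>.\<close>
  define f where "f k j = (if j < k then 0 else c (j - k) * haarC (2 ^ j * n) t)" for k j
  have f: "f k sums chaos c (2 ^ k * n) t" for k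
  proof -
    have "(\<lambda>m. c m * haarC (2 ^ m * (2 ^ k * n)) t) sums chaos c (2 ^ k * n) t"
      using n by (intro chaos_sums) (simp add: Suc_le_eq)
    also have "(\<lambda>m. c m * haarC (2 ^ m * (2 ^ k * n)) t) = (\<lambda>m. f k (m + k))"
      by (simp add: f_def power_add mult.assoc)
    finally show ?thesis by (subst (asm) sums_zero_iff_shift) (auto simp: f_def)
  qed
  have "(\<lambda>j. \<Sum>k<X. x k * f k j) sums (\<Sum>k<X. x k * chaos c (2 ^ k * n) t)"
    by (intro sums_sum sums_mult f)
  also have "(\<lambda>j. \<Sum>k<X. x k * f k j) = (\<lambda>j. cauchy_prod c x j * haarC (2 ^ j * n) t)"
  proof
    fix j
    have "(\<Sum>k<X. x k * f k j) = (\<Sum>k\<le>max X j. x k * f k j)"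
      by (rule sum.mono_neutral_left) (use x in auto)
    also have "\<dots> = (\<Sum>k\<le>j. x k * f k j)"
      by (rule sum.mono_neutral_right) (auto simp: f_def)
    also have "\<dots> = (\<Sum>i\<le>j. x (j - i) * f (j - i) j)"
      by (rule sum.reindex_bij_witness[of _ "\<lambda>i. j - i" "\<lambda>i. j - i"]) auto
    also have "\<dots> = cauchy_prod c x j * haarC (2 ^ j * n) t"
      unfolding cauchy_prod_def sum_distrib_right by (intro sum.cong refl) (auto simp: f_def mult_ac)
    finally show "(\<Sum>k<X. x k * f k j) = cauchy_prod c x j * haarC (2 ^ j * n) t" .
  qed
  finally show ?thesis by (simp add: chaos_def sums_iff)
qed

lemma Lq0_haar_sys: "q > 1 \<Longrightarrow> n \<ge> 1 \<Longrightarrow> Lq0 q (haar_sys n)"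
proof -
  assume q: "q > 1" and n: "n \<ge> 1"
  have "haar_sys n = haarC n" by (simp add: fun_eq_iff haar_sys_eq[OF n])
  then show "Lq0 q (haar_sys n)"
    using Lq_haarC[of q n] q n integral_haar[OF n] by (simp add: Lq0_def integral_complex_of_real)
qed

lemma Lq0_sum:
  assumes q: "q > 1" and u: "\<And>i. i \<in> I \<Longrightarrow> Lq0 q (u i)"
  shows "Lq0 q (\<lambda>t. \<Sum>i\<in>I. a i * u i t)"
proof -
  have L: "Lq q (\<lambda>t. a i * u i t)" if "i \<in> I" for i using u[OF that] by (intro Lq_cmult) (simp add: Lq0_def)
  have "integral\<^sup>L MI (\<lambda>t. \<Sum>i\<in>I. a i * u i t) = (\<Sum>i\<in>I. integral\<^sup>L MI (\<lambda>t. a i * u i t))"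
    by (rule Bochner_Integration.integral_sum) (rule Lq_integrable(1)[OF q L])
  also have "\<dots> = 0" using u by (intro sum.neutral) (auto simp: Lq0_def)
  finally show ?thesis using L q by (auto simp: Lq0_def intro: Lq_sum)
qed

text \<open>An isomorphism with \<open>h_n \<mapsto> f_n\<close> sends sums of finite chaoses to the
  corresponding sums with coefficients \<open>c * x\<close>. Only finite combinations occur, so
  linearity up to null sets is enough, and the bounds for it and its inverse become the two
  inequalities.\<close>

lemma equiv_haar_multiplier:
  assumes q: "q > 1" and c: "summable (\<lambda>k. norm (c k) * (2 powr (-1/q)) ^ k)"
    and E: "equiv_haar_Lq0 q (dil (haar_chaos c))"
  shows "\<exists>C\<ge>0. \<forall>A x X. finite A \<longrightarrow> (\<forall>n\<in>A. n \<ge> 1) \<longrightarrow> (\<forall>k\<ge>X. x k = 0) \<longrightarrow>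
     Lq_norm q (\<lambda>t. \<Sum>n\<in>A. chaos (cauchy_prod c x) n t) \<le> C * Lq_norm q (\<lambda>t. \<Sum>n\<in>A. chaos x n t) \<and>
     Lq_norm q (\<lambda>t. \<Sum>n\<in>A. chaos x n t) \<le> C * Lq_norm q (\<lambda>t. \<Sum>n\<in>A. chaos (cauchy_prod c x) n t)"
proof -
  obtain T C1 C2 where T0: "\<And>g. Lq0 q g \<Longrightarrow> Lq0 q (T g)"
    and Tl: "\<And>g u a b. Lq0 q g \<Longrightarrow> Lq0 q u \<Longrightarrow> (AE t in MI. T (\<lambda>s. a * g s + b * u s) t = a * T g t + b * T u t)"
    and T1: "\<And>g. Lq0 q g \<Longrightarrow> Lq_norm q (T g) \<le> C1 * Lq_norm q g"
    and T2: "\<And>g. Lq0 q g \<Longrightarrow> Lq_norm q g \<le> C2 * Lq_norm q (T g)"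
    and Th: "\<And>n. n \<ge> 1 \<Longrightarrow> (AE t in MI. T (haar_sys n) t = dil (haar_chaos c) n t)"
    using E unfolding equiv_haar_Lq0_def by (elim exE conjE) blast
  have z0: "Lq0 q (\<lambda>t. 0)" by (simp add: Lq0_def)
  have Tsum: "AE t in MI. T (\<lambda>s. \<Sum>i\<in>I. a i * u i s) t = (\<Sum>i\<in>I. a i * T (u i) t)"
    if "finite I" "\<And>i. i \<in> I \<Longrightarrow> Lq0 q (u i)" for I :: "(nat \<times> nat) set" and a u
    using that
  proof (induction I rule: finite_induct)
    case empty
    \<comment> \<open>That \<open>T\<close> maps zero to zero almost everywhere follows from
      linearity with both scalars equal to 0.\<close>
    show ?case using Tl[OF z0 z0, of 0 0] by simp
  next
    case (insert i I)
    have s: "Lq0 q (\<lambda>s. \<Sum>i\<in>I. a i * u i s)" using insert.prems by (intro Lq0_sum q) auto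
    have "AE t in MI. T (\<lambda>s. a i * u i s + 1 * (\<Sum>i\<in>I. a i * u i s)) t = a i * T (u i) t + 1 * T (\<lambda>s. \<Sum>i\<in>I. a i * u i s) t"
      by (rule Tl[OF insert.prems s]) simp
    moreover have "AE t in MI. T (\<lambda>s. \<Sum>i\<in>I. a i * u i s) t = (\<Sum>i\<in>I. a i * T (u i) t)"
      using insert by auto
    ultimately show ?case
      by eventually_elim (use insert.hyps in simp)
  qed
  \<comment> \<open>One nonnegative constant for both directions; the given constants carry no sign
    condition.\<close>
  define C where "C = \<bar>C1\<bar> + \<bar>C2\<bar>"
  have main: "Lq_norm q (\<lambda>t. \<Sum>n\<in>A. chaos (cauchy_prod c x) n t) \<le> C * Lq_norm q (\<lambda>t. \<Sum>n\<in>A. chaos x n t) \<and>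
     Lq_norm q (\<lambda>t. \<Sum>n\<in>A. chaos x n t) \<le> C * Lq_norm q (\<lambda>t. \<Sum>n\<in>A. chaos (cauchy_prod c x) n t)"
    if A: "finite A" "\<forall>n\<in>A. n \<ge> 1" and x: "\<forall>k\<ge>X. x k = 0" for A x X
  proof -
    define I where "I = A \<times> {..<X}"
    define u where "u p = haar_sys (2 ^ snd p * fst p)" for p :: "nat \<times> nat"
    define g where "g t = (\<Sum>n\<in>A. chaos x n t)" for t
    define G where "G t = (\<Sum>n\<in>A. chaos (cauchy_prod c x) n t)" for t
    have pos: "2 ^ snd p * fst p \<ge> 1" if "p \<in> I" for p using that A by (auto simp: I_def Suc_le_eq)
    have finI: "finite I" using A by (simp add: I_def)
    have Lu: "Lq0 q (u p)" if "p \<in> I" for p unfolding u_def by (rule Lq0_haar_sys[OF q pos[OF that]])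
    have g: "g = (\<lambda>t. \<Sum>p\<in>I. x (snd p) * u p t)"
    proof
      fix t
      have "g t = (\<Sum>n\<in>A. \<Sum>k<X. x k * u (n, k) t)"
        unfolding g_def
      proof (intro sum.cong refl)
        fix n assume "n \<in> A"
        then show "chaos x n t = (\<Sum>k<X. x k * u (n, k) t)"
          using A x by (subst chaos_finite[of X]) (auto intro!: sum.cong simp: u_def haar_sys_eq Suc_le_eq)
      qed
      then show "g t = (\<Sum>p\<in>I. x (snd p) * u p t)"
        by (simp add: I_def sum.cartesian_product case_prod_beta)
    qed
    have Lg: "Lq0 q g" unfolding g by (intro Lq0_sum q Lu)
    have TI: "AE t in MI. T g t = (\<Sum>p\<in>I. x (snd p) * T (u p) t)"
      unfolding g by (rule Tsum[OF finI Lu])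
    have "AE t in MI. \<forall>p\<in>I. T (u p) t = dil (haar_chaos c) (2 ^ snd p * fst p) t"
      unfolding u_def by (intro AE_finite_allI finI Th pos)
    then have "AE t in MI. T g t = G t"
      using TI
    proof eventually_elim
      fix t assume "\<forall>p\<in>I. T (u p) t = dil (haar_chaos c) (2 ^ snd p * fst p) t" "T g t = (\<Sum>p\<in>I. x (snd p) * T (u p) t)"
      then have "T g t = (\<Sum>p\<in>I. x (snd p) * chaos c (2 ^ snd p * fst p) t)"
        by (auto intro!: sum.cong simp: dil_haar_chaos[OF pos])
      also have "\<dots> = (\<Sum>n\<in>A. \<Sum>k<X. x k * chaos c (2 ^ k * n) t)"
        by (simp add: I_def sum.cartesian_product case_prod_beta)
      also have "\<dots> = G t"
        unfolding G_def using A x by (intro sum.cong refl chaos_cauchy_prod[symmetric]) auto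
      finally show "T g t = G t" .
    qed
    moreover have "T g \<in> borel_measurable MI" using T0[OF Lg] by (simp add: Lq0_def Lq_def)
    moreover have "Lq q G"
    proof -
      have "summable (\<lambda>k. norm (x k) * (2 powr (-1/q)) ^ k)"
        by (rule summable_finite[of "{..<X}"]) (use x in auto)
      then have "summable (\<lambda>k. norm (cauchy_prod c x k) * (2 powr (-1/q)) ^ k)"
        by (intro cauchy_prod_summable(1) c) auto
      then show ?thesis unfolding G_def using q A by (intro Lq_sum Lq_chaos) auto
    qed
    ultimately have e: "Lq_norm q (T g) = Lq_norm q G"
      by (intro Lq_norm_cong_AE) (auto simp: Lq_def)
    have "Lq_norm q G \<le> C1 * Lq_norm q g" "Lq_norm q g \<le> C2 * Lq_norm q G"
      using T1[OF Lg] T2[OF Lg] e by auto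
    moreover have "C1 * Lq_norm q g \<le> C * Lq_norm q g" "C2 * Lq_norm q G \<le> C * Lq_norm q G"
      unfolding C_def by (intro mult_right_mono; simp)+
    ultimately have "Lq_norm q G \<le> C * Lq_norm q g \<and> Lq_norm q g \<le> C * Lq_norm q G" by linarith
    moreover have "(\<lambda>t. \<Sum>n\<in>A. chaos x n t) = g" "(\<lambda>t. \<Sum>n\<in>A. chaos (cauchy_prod c x) n t) = G"
      by (simp_all add: g_def G_def fun_eq_iff)
    ultimately show ?thesis by (simp only:)
  qed
  show ?thesis by (rule exI[of _ C]) (use main in \<open>auto simp: C_def\<close>)
qed

lemma Lq_norm_sum_chaos_le:
  assumes q: "q \<ge> 1" and A: "\<forall>n\<in>A. n \<ge> 1" and v: "summable (\<lambda>k. norm (v k) * (2 powr (-1/q)) ^ k)"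
  shows "Lq q (\<lambda>t. \<Sum>n\<in>A. chaos v n t)"
    and "Lq_norm q (\<lambda>t. \<Sum>n\<in>A. chaos v n t) \<le> real (card A) * (\<Sum>k. norm (v k) * (2 powr (-1/q)) ^ k)"
proof -
  have L: "Lq q (chaos v n)" if "n \<in> A" for n using that A by (intro Lq_chaos q v) auto
  show "Lq q (\<lambda>t. \<Sum>n\<in>A. chaos v n t)" by (intro Lq_sum q L)
  have "Lq_norm q (\<lambda>t. \<Sum>n\<in>A. chaos v n t) \<le> (\<Sum>n\<in>A. Lq_norm q (chaos v n))"
    by (intro Lq_norm_sum q L)
  also have "\<dots> \<le> (\<Sum>n\<in>A. \<Sum>k. norm (v k) * (2 powr (-1/q)) ^ k)"
    using A by (intro sum_mono Lq_chaos q v) auto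
  finally show "Lq_norm q (\<lambda>t. \<Sum>n\<in>A. chaos v n t) \<le> real (card A) * (\<Sum>k. norm (v k) * (2 powr (-1/q)) ^ k)"
    by simp
qed

lemma cauchy_prod_diff: "cauchy_prod c (\<lambda>k. x k - y k) = (\<lambda>k. cauchy_prod c x k - cauchy_prod c y k)"
  by (simp add: cauchy_prod_def fun_eq_iff sum_subtractf right_diff_distrib)

text \<open>For \<open>x\<close> finitely supported, \<open>d * x\<close> is not; the lower bound is applied to its truncations.\<close>

lemma inverse_multiplier:
  assumes q: "q > 1" and c: "summable (\<lambda>k. norm (c k) * (2 powr (-1/q)) ^ k)"
    and d: "summable (\<lambda>k. norm (d k) * (2 powr (-1/q)) ^ k)"
    and inv: "Abs_fps c * Abs_fps d = 1" and C: "C \<ge> 0"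
    and A: "\<forall>n\<in>A. n \<ge> 1" and x: "\<forall>k\<ge>X. x k = 0"
    and low: "\<And>x X. \<forall>k\<ge>X. x k = 0 \<Longrightarrow>
      Lq_norm q (\<lambda>t. \<Sum>n\<in>A. chaos x n t) \<le> C * Lq_norm q (\<lambda>t. \<Sum>n\<in>A. chaos (cauchy_prod c x) n t)"
  shows "Lq_norm q (\<lambda>t. \<Sum>n\<in>A. chaos (cauchy_prod d x) n t) \<le> C * Lq_norm q (\<lambda>t. \<Sum>n\<in>A. chaos x n t)"
proof -
  define r where "r = (2::real) powr (-1/q)"
  have r: "r \<ge> 0" by (simp add: r_def)
  have q1: "q \<ge> 1" using q by simp
  define U where "U v t = (\<Sum>n\<in>A. chaos v n t)" for v t
  define nn where "nn v = (\<Sum>k. norm (v k) * r ^ k)" for v :: "nat \<Rightarrow> complex"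
  define y where "y = cauchy_prod d x"
  have cy: "cauchy_prod c y = x"
  proof -
    have "Abs_fps y = Abs_fps d * Abs_fps x" by (simp add: y_def cauchy_prod_fps fps_nth_inverse)
    then have "cauchy_prod c y = fps_nth ((Abs_fps c * Abs_fps d) * Abs_fps x)" 
      by (simp add: cauchy_prod_fps[of c] mult.assoc)
    then show ?thesis by (simp add: inv fun_eq_iff)
  qed
  have sx: "summable (\<lambda>k. norm (x k) * r ^ k)"
    by (rule summable_finite[of "{..<X}"]) (use x in auto)
  have sy: "summable (\<lambda>k. norm (y k) * r ^ k)"
    unfolding y_def by (rule cauchy_prod_summable(1)[OF r d[folded r_def] sx])
  define yK where "yK K k = (if k < K then y k else 0)" for K k
  define yT where "yT K k = (if k < K then 0 else y k)" for K k
  have yKT: "yK K = (\<lambda>k. y k - yT K k)" for K by (auto simp: yK_def yT_def fun_eq_iff)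
  have sT: "summable (\<lambda>k. norm (yT K k) * r ^ k)" for K
    by (rule summable_comparison_test'[OF sy]) (use r in \<open>auto simp: yT_def\<close>)
  have scT: "summable (\<lambda>k. norm (cauchy_prod c (yT K) k) * r ^ k)" for K
    by (rule cauchy_prod_summable(1)[OF r c[folded r_def] sT])
  have Udiff: "U (\<lambda>k. v k - w k) = (\<lambda>t. U v t - U w t)" for v w
    unfolding U_def fun_eq_iff sum_subtractf[symmetric] using A by (auto intro!: sum.cong chaos_diff)
  have LU: "Lq q (U v)" "Lq_norm q (U v) \<le> real (card A) * nn v" if "summable (\<lambda>k. norm (v k) * r ^ k)" for v
    using Lq_norm_sum_chaos_le[OF q1 A, of v] that unfolding U_def nn_def r_def by auto
  \<comment> \<open>Passing from \<open>y\<close> to its truncation costs at most a multiple of the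
    weighted \<open>l^1\<close> norm of the tail. The factor \<open>card A\<close> is harmless
    because \<open>A\<close> is fixed while \<open>K\<close> tends to infinity.\<close>
  have bd: "Lq_norm q (U y) \<le> C * Lq_norm q (U x) + (C * real (card A) * nn c + real (card A)) * nn (yT K)" for K
  proof -
    have "Lq_norm q (U (yK K)) \<le> C * Lq_norm q (U (cauchy_prod c (yK K)))"
      unfolding U_def by (rule low[of K]) (simp add: yK_def)
    also have "U (cauchy_prod c (yK K)) = (\<lambda>t. U x t - U (cauchy_prod c (yT K)) t)"
      unfolding yKT cauchy_prod_diff cy Udiff ..
    also have "Lq_norm q (\<lambda>t. U x t - U (cauchy_prod c (yT K)) t) \<le> Lq_norm q (U x) + Lq_norm q (U (cauchy_prod c (yT K)))"
      by (intro Lq_norm_triangle_diff q1 LU sx scT)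
    also have "Lq_norm q (U (cauchy_prod c (yT K))) \<le> real (card A) * (nn c * nn (yT K))"
    proof (rule order.trans[OF LU(2)[OF scT]])
      show "real (card A) * nn (cauchy_prod c (yT K)) \<le> real (card A) * (nn c * nn (yT K))"
        using cauchy_prod_summable(2)[OF r c[folded r_def] sT[of K]] unfolding nn_def by (intro mult_left_mono) auto
    qed
    finally have 1: "Lq_norm q (U (yK K)) \<le> C * (Lq_norm q (U x) + real (card A) * (nn c * nn (yT K)))"
      using C by (simp add: mult_left_mono)
    have "Lq_norm q (U y) \<le> Lq_norm q (U (yT K)) + Lq_norm q (\<lambda>t. U y t - U (yT K) t)"
      by (rule Lq_norm_le_add_diff[OF q1 LU(1)[OF sy] LU(1)[OF sT]])
    also have "(\<lambda>t. U y t - U (yT K) t) = U (yK K)" unfolding yKT Udiff ..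
    finally show ?thesis using 1 LU(2)[OF sT[of K]] by (simp add: algebra_simps)
  qed
  have "(\<lambda>K. nn (yT K)) = (\<lambda>K. \<Sum>k. if k < K then 0 else norm (y k) * r ^ k)"
    unfolding nn_def yT_def by (intro ext suminf_cong) auto
  then have t0: "(\<lambda>K. nn (yT K)) \<longlonglongrightarrow> 0" using suminf_tail_tendsto_0[OF sy] by simp
  have "(\<lambda>K. C * Lq_norm q (U x) + (C * real (card A) * nn c + real (card A)) * nn (yT K)) \<longlonglongrightarrow> C * Lq_norm q (U x) + (C * real (card A) * nn c + real (card A)) * 0"
    by (intro tendsto_intros t0)
  then have "Lq_norm q (U y) \<le> C * Lq_norm q (U x) + (C * real (card A) * nn c + real (card A)) * 0"
    by (rule LIMSEQ_le_const) (use bd in blast)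
  then have "Lq_norm q (U y) \<le> C * Lq_norm q (U x)" by simp
  moreover have "U v = (\<lambda>t. \<Sum>n\<in>A. chaos v n t)" for v by (simp add: U_def fun_eq_iff)
  ultimately show ?thesis by (simp only: y_def)
qed

section \<open>Radii of convergence and the conclusion\<close>

lemma symbol_eq_eval_fps: "symbol c z = eval_fps (Abs_fps c) z"
  by (simp add: symbol_def eval_fps_def)

lemma conv_radius_ge_ball:
  fixes c :: "nat \<Rightarrow> complex"
  assumes "\<forall>z\<in>ball 0 R. summable (\<lambda>k. c k * z ^ k)"
  shows "fps_conv_radius (Abs_fps c) \<ge> ereal R"
  unfolding fps_conv_radius_def
proof (rule conv_radius_geI_ex')
  fix r assume "0 < r" "ereal r < ereal R"
  then show "summable (\<lambda>n. fps_nth (Abs_fps c) n * of_real r ^ n)" using assms by auto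
qed

text \<open>The weight \<open>Suc k\<close> is produced by differentiating \<open>F * fps_X\<close>,
  which does not decrease the radius of convergence below \<open>R\<close>.\<close>

lemma summable_weighted:
  fixes F :: "complex fps"
  assumes "fps_conv_radius F \<ge> ereal R" "0 \<le> r" "r < R"
  shows "summable (\<lambda>k. norm (fps_nth F k) * r ^ k * real (Suc k))"
proof -
  have "ereal R \<le> min (fps_conv_radius F) (fps_conv_radius (fps_X :: complex fps))" using assms by simp
  also have "\<dots> \<le> fps_conv_radius (F * fps_X)" by (rule fps_conv_radius_mult)
  also have "\<dots> \<le> fps_conv_radius (fps_deriv (F * fps_X))" by (rule fps_conv_radius_deriv)
  finally have R: "ereal R \<le> fps_conv_radius (fps_deriv (F * fps_X))" .
  have "ereal (norm (of_real r :: complex)) < ereal R" using assms by simp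
  then have "ereal (norm (of_real r :: complex)) < conv_radius (fps_nth (fps_deriv (F * fps_X)))"
    using R unfolding fps_conv_radius_def by (rule less_le_trans)
  then have "summable (\<lambda>k. norm (fps_nth (fps_deriv (F * fps_X)) k * of_real r ^ k))"
    by (rule abs_summable_in_conv_radius)
  also have "(\<lambda>k. norm (fps_nth (fps_deriv (F * fps_X)) k * of_real r ^ k)) = (\<lambda>k. norm (fps_nth F k) * r ^ k * real (Suc k))"
  proof
    fix k
    have "fps_nth (fps_deriv (F * fps_X)) k = of_nat (Suc k) * fps_nth F k"
      by (simp add: algebra_simps)
    then show "norm (fps_nth (fps_deriv (F * fps_X)) k * of_real r ^ k) = norm (fps_nth F k) * r ^ k * real (Suc k)"
      using assms(2) by (simp only: norm_mult norm_power norm_of_nat norm_of_real abs_of_nonneg mult_ac)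
  qed
  finally show ?thesis .
qed

theorem theorem3:
  fixes p :: real and c :: "nat \<Rightarrow> complex"
  assumes "1 < p" and "p \<le> 2"
    and "Lq 1 (haar_chaos c)"
    and "\<forall>z\<in>ball 0 (2 powr (-1/p)). summable (\<lambda>k. c k * z ^ k)"
    and "\<forall>z\<in>ball 0 (2 powr (-1/p)). symbol c z \<noteq> 0"
    and "\<not> ((\<forall>z\<in>ball 0 (2 powr (-1/2)). summable (\<lambda>k. c k * z ^ k))
            \<and> symbol c holomorphic_on ball 0 (2 powr (-1/2))
            \<and> bounded (symbol c ` ball 0 (2 powr (-1/2)))
            \<and> (\<forall>z\<in>ball 0 (2 powr (-1/2)). symbol c z \<noteq> 0)
            \<and> (\<lambda>z. 1 / symbol c z) holomorphic_on ball 0 (2 powr (-1/2))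
            \<and> bounded ((\<lambda>z. 1 / symbol c z) ` ball 0 (2 powr (-1/2))))"
  shows "\<forall>q. 1 < q \<and> q < p \<longrightarrow>
           schauder_basis_Lq0 q (dil (haar_chaos c))
           \<and> \<not> equiv_haar_Lq0 q (dil (haar_chaos c))"
proof (intro allI impI)
  fix q assume "1 < q \<and> q < p"
  then have q: "1 < q" "q < p" by auto
  define R where "R = (2::real) powr (-1/p)"
  define F where "F = Abs_fps c"
  define d where "d = fps_nth (inverse F)"
  have Fc: "c = fps_nth F" by (simp add: F_def fun_eq_iff)
  have Fd: "Abs_fps d = inverse F" by (simp add: d_def fps_nth_inverse)
  have RF: "fps_conv_radius F \<ge> ereal R"
    unfolding F_def R_def by (rule conv_radius_ge_ball) (rule assms(4))
  have nz: "eval_fps F z \<noteq> 0" if "ereal (norm z) < ereal R" for z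
    using assms(5) that by (auto simp: symbol_eq_eval_fps F_def R_def)
  \<comment> \<open>Absence of zeros in the disk makes the series of the reciprocal converge there
    as well.\<close>
  have "min (ereal R) (fps_conv_radius F) \<le> fps_conv_radius (inverse F)"
    by (rule fps_conv_radius_inverse[OF nz])
  then have RI: "fps_conv_radius (inverse F) \<ge> ereal R" using RF by simp
  have "fps_nth F 0 \<noteq> 0" using nz[of 0] by (simp add: R_def eval_fps_at_0)
  then have inv': "F * inverse F = 1" by (rule inverse_mult_eq_1')
  then have inv: "Abs_fps c * Abs_fps d = 1" by (simp add: Fd F_def)
  \<comment> \<open>Because \<open>q < p\<close>, the radius \<open>2^(-1/q)\<close> is strictly
    smaller than \<open>R\<close>, which leaves room for the weight \<open>Suc m\<close>.\<close>
  have "-1/q < -1/p" using q by (simp add: field_simps)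
  then have rR: "2 powr (-1/q) < R" unfolding R_def by (intro powr_less_mono) auto
  have sc1: "summable (\<lambda>m. norm (c m) * (2 powr (-1/q)) ^ m * real (Suc m))"
    unfolding Fc by (rule summable_weighted[OF RF _ rR]) simp
  have sd1: "summable (\<lambda>m. norm (d m) * (2 powr (-1/q)) ^ m * real (Suc m))"
    unfolding d_def by (rule summable_weighted[OF RI _ rR]) simp
  have sc: "summable (\<lambda>m. norm (c m) * (2 powr (-1/q)) ^ m)"
    by (rule summable_of_summable_mult_Suc[OF sc1]) simp
  have sd: "summable (\<lambda>m. norm (d m) * (2 powr (-1/q)) ^ m)"
    by (rule summable_of_summable_mult_Suc[OF sd1]) simp
  have "\<not> equiv_haar_Lq0 q (dil (haar_chaos c))"
  proof
    assume "equiv_haar_Lq0 q (dil (haar_chaos c))"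
    then obtain C where C: "C \<ge> 0"
      and up: "\<And>A x X. finite A \<Longrightarrow> \<forall>n\<in>A. n \<ge> 1 \<Longrightarrow> \<forall>k\<ge>X. x k = 0 \<Longrightarrow>
        Lq_norm q (\<lambda>t. \<Sum>n\<in>A. chaos (cauchy_prod c x) n t) \<le> C * Lq_norm q (\<lambda>t. \<Sum>n\<in>A. chaos x n t)"
      and low: "\<And>A x X. finite A \<Longrightarrow> \<forall>n\<in>A. n \<ge> 1 \<Longrightarrow> \<forall>k\<ge>X. x k = 0 \<Longrightarrow>
        Lq_norm q (\<lambda>t. \<Sum>n\<in>A. chaos x n t) \<le> C * Lq_norm q (\<lambda>t. \<Sum>n\<in>A. chaos (cauchy_prod c x) n t)"
      using equiv_haar_multiplier[OF q(1) sc] by metis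
    let ?B = "ball (0::complex) (2 powr (-1/2))"
    \<comment> \<open>Stated for general \<open>e\<close> since it is used twice: for
      \<open>c\<close> with the upper bound of the isomorphism, for \<open>d\<close> with its lower
      bound transferred by \<open>inverse_multiplier\<close>.\<close>
    have analytic: "\<exists>D. \<forall>w\<in>?B. summable (\<lambda>k. e k * w ^ k) \<and> norm (symbol e w) \<le> D"
      if se: "summable (\<lambda>m. norm (e m) * (2 powr (-1/q)) ^ m)"
        and H: "\<forall>A x X. finite A \<longrightarrow> (\<forall>n\<in>A. n \<ge> 1) \<longrightarrow> (\<forall>k\<ge>X. x k = 0) \<longrightarrow>
        Lq_norm q (\<lambda>t. \<Sum>n\<in>A. chaos (cauchy_prod e x) n t) \<le> C * Lq_norm q (\<lambda>t. \<Sum>n\<in>A. chaos x n t)" for e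
    proof -
      have "\<exists>D\<ge>0. \<forall>X x z. (\<forall>k\<ge>X. x k = 0) \<longrightarrow> (\<forall>k\<ge>X. z k = 0) \<longrightarrow>
          norm (\<Sum>k<X. cauchy_prod e x k * z k / 2 ^ k) \<le> D * (wnorm X x * wnorm X z)"
        by (rule multiplier_bound[OF q(1) se C], rule H[rule_format]) auto
      then obtain D where D: "D \<ge> 0" "\<And>X x z. \<forall>k\<ge>X. x k = 0 \<Longrightarrow> \<forall>k\<ge>X. z k = 0 \<Longrightarrow>
          norm (\<Sum>k<X. cauchy_prod e x k * z k / 2 ^ k) \<le> D * (wnorm X x * wnorm X z)"
        by blast
      have "summable (\<lambda>k. e k * w ^ k) \<and> norm (symbol e w) \<le> D" if "w \<in> ?B" for w
      proof
        have n: "norm w < 2 powr (-1/2)" using that by simp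
        show "summable (\<lambda>k. e k * w ^ k)"
          by (rule summable_norm_cancel, rule multiplier_bounded_analytic(1)[OF D(1) _ n], rule D(2))
        show "norm (symbol e w) \<le> D"
          by (rule multiplier_bounded_analytic(2)[OF D(1) _ n], rule D(2))
      qed
      then show ?thesis by blast
    qed
    have "\<exists>D. \<forall>w\<in>?B. summable (\<lambda>k. c k * w ^ k) \<and> norm (symbol c w) \<le> D"
      by (rule analytic[OF sc]) (intro allI impI, rule up)
    then obtain Dc where "\<forall>w\<in>?B. summable (\<lambda>k. c k * w ^ k) \<and> norm (symbol c w) \<le> Dc" ..
    then have Dc: "\<And>w. w \<in> ?B \<Longrightarrow> summable (\<lambda>k. c k * w ^ k)" "\<And>w. w \<in> ?B \<Longrightarrow> norm (symbol c w) \<le> Dc"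
      by simp_all
    have dn: "Lq_norm q (\<lambda>t. \<Sum>n\<in>A. chaos (cauchy_prod d x) n t) \<le> C * Lq_norm q (\<lambda>t. \<Sum>n\<in>A. chaos x n t)"
      if "finite A" "\<forall>n\<in>A. n \<ge> 1" "\<forall>k\<ge>X. x k = 0" for A x X
      by (rule inverse_multiplier[OF q(1) sc sd inv C that(2,3) low[OF that(1,2)]])
    have "\<exists>D. \<forall>w\<in>?B. summable (\<lambda>k. d k * w ^ k) \<and> norm (symbol d w) \<le> D"
      by (rule analytic[OF sd]) (intro allI impI, rule dn)
    then obtain Dd where "\<forall>w\<in>?B. summable (\<lambda>k. d k * w ^ k) \<and> norm (symbol d w) \<le> Dd" ..
    then have Dd: "\<And>w. w \<in> ?B \<Longrightarrow> summable (\<lambda>k. d k * w ^ k)" "\<And>w. w \<in> ?B \<Longrightarrow> norm (symbol d w) \<le> Dd"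
      by simp_all
    have RF2: "fps_conv_radius F \<ge> ereal (2 powr (-1/2))"
      unfolding F_def by (rule conv_radius_ge_ball) (use Dc(1) in blast)
    have RI2: "fps_conv_radius (inverse F) \<ge> ereal (2 powr (-1/2))"
      unfolding Fd[symmetric] by (rule conv_radius_ge_ball) (use Dd(1) in blast)
    \<comment> \<open>Both series are now known to converge for
      \<open>norm w < 2 powr (-1/2)\<close>, so the formal identity holds between functions there.
      It yields at once that the symbol has no zeros and that its reciprocal is the bounded function
      \<open>symbol d\<close>.\<close>
    have prod: "symbol c w * symbol d w = 1" if "w \<in> ?B" for w
    proof -
      have n: "ereal (norm w) < ereal (2 powr (-1/2))" using that by simp
      have "eval_fps (F * inverse F) w = eval_fps F w * eval_fps (inverse F) w"
        by (rule eval_fps_mult) (rule less_le_trans[OF n RF2], rule less_le_trans[OF n RI2])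
      then show ?thesis by (simp add: inv' symbol_eq_eval_fps Fd F_def[symmetric])
    qed
    have nz2: "symbol c w \<noteq> 0" and rec: "1 / symbol c w = symbol d w" if "w \<in> ?B" for w
    proof -
      show nz: "symbol c w \<noteq> 0" using prod[OF that] by auto
      show "1 / symbol c w = symbol d w" using prod[OF that] nz by (simp add: divide_eq_eq mult.commute)
    qed
    have hol: "symbol c holomorphic_on ?B"
      unfolding symbol_eq_eval_fps[abs_def] F_def[symmetric]
    proof (rule holomorphic_on_eval_fps, rule subsetI)
      fix w assume "w \<in> ?B"
      then have "ereal (norm w) < ereal (2 powr (-1/2))" by simp
      also note RF2
      finally show "w \<in> eball 0 (fps_conv_radius F)" by (simp add: in_eball_iff)
    qed
    have "bounded (symbol c ` ?B)" by (rule boundedI[where B=Dc], erule imageE, simp only: Dc(2))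
    moreover have "(\<lambda>z. 1 / symbol c z) holomorphic_on ?B"
      by (intro holomorphic_intros hol nz2)
    moreover have "bounded ((\<lambda>z. 1 / symbol c z) ` ?B)" by (rule boundedI[where B=Dd], erule imageE, simp only: rec Dd(2))
    ultimately show False using assms(6) Dc(1) nz2 hol by blast
  qed
  then show "schauder_basis_Lq0 q (dil (haar_chaos c)) \<and> \<not> equiv_haar_Lq0 q (dil (haar_chaos c))"
    using schauder_basis_chaos[OF q(1) inv sc1 sd] by blast
qed

end
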